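(* Suppose conditions (B1)–(B4) hold and let $\phi$ be admissible at infinity. Then there are constants $b_2\ge b_1>0$ such that for all $x,y\in M$, $$\liminf_{t\to\infty}\frac{\sup_{0<s\le t}d(x,X_s)}{\phi^{-1}(t/\log\log t)}\in[b_1,b_2]\qquad\mathbb P^y\text{-a.s.},$$ where $\phi^{-1}(t)=\sup\{r>0:\phi(r)\le t\}$.
   Context: Standing setting: $(M,d,\mu)$ is a locally compact separable metric space with a positive Radon measure $\mu$ of full support; $M_\partial=M\cup\{\partial\}$. $X$ is a Borel standard Markov process on $M_\partial$ with laws $\mathbb P^x$ and a Lévy system $(J(x,dy),ds)$: for $z\in M$, $t>0$, nonnegative Borel $F$ on $M\times M_\partial$ vanishing on the diagonal, $\mathbb E^z[\sum_{s\le t}F(X_{s-},X_s)]=\mathbb E^z[\int_0^t\int_{M_\partial}F(X_s,y)J(X_s,dy)ds]$. $B(x,r)$ is the open ball; $\tau_D=\inf\{t>0:X_t\in M_\partial\setminus D\}$. Fix a base point $o\in M$ and set $\mathsf d(x)=d(x,o)+1$. Conditions (B1)–(B4): there exist constants $R_\infty\ge1$, $\upsilon\in(0,1)$, $\ell>1$, $C_1>1$, $C_2,\dots,C_7>0$ such that for every $x\in M$ and $r>R_\infty\mathsf d(x)^\upsilon$: (B1) $C_1^{-1}\mathbb E^o[\tau_{B(o,r)}]\le\mathbb E^x[\tau_{B(x,r)}]\le C_1\mathbb E^o[\tau_{B(o,r)}]$; (B2) $2\mathbb E^o[\tau_{B(o,s/\ell)}]\le\mathbb E^o[\tau_{B(o,s)}]\le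 C_2\mathbb E^o[\tau_{B(o,s/2)}]$ for all $s>R_\infty$; (B3) $J(x,M_\partial\setminus B(x,r))\le C_3/\mathbb E^x[\tau_{B(x,r)}]$; (B4) $C_4e^{-C_5n}\le\mathbb P^x(\tau_{B(x,r)}\ge n\mathbb E^x[\tau_{B(x,r)}])\le C_6e^{-C_7n}$ for all $n\ge1$. Admissible at infinity: a nondecreasing function $\phi:(0,\infty)\to(0,\infty)$ such that for some $C\ge1$, $C^{-1}\mathbb E^x[\tau_{B(x,r)}]\le\phi(r)\le C\mathbb E^x[\tau_{B(x,r)}]$ for all $x\in M$ and $r>R_\infty\mathsf d(x)^\upsilon$. *)

theory Defs
  imports "HOL-Probability.Probability"
begin

text \<open>M_partial is modelled as the type 'a option: Some x is the point x of M, None is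
the cemetery point partial. Its topology is the Alexandroff (one-point) extension:
U is open iff its trace on M is open and, if partial is in U, the complement of U in M
is compact (if M is compact, partial is an isolated point).\<close>

definition cem_top :: "'a::metric_space option topology" where
  "cem_top = topology (\<lambda>U. open (Some -` U) \<and> (None \<in> U \<longrightarrow> compact (- (Some -` U))))"

definition cemB :: "'a::metric_space option measure" where
  "cemB = sigma UNIV (Collect (openin cem_top))"

definition cdist :: "'a::metric_space \<Rightarrow> 'a option \<Rightarrow> ereal" where
  "cdist x z = (case z of None \<Rightarrow> \<infinity> | Some y \<Rightarrow> ereal (dist x y))"

text \<open>Sample space: the common measurable space of the laws P z (z in M_partial);
X t \<omega> is the position at time t; \<theta> t the shift operators; F a filtration.
Stopping times take values in [0,\<infinity>] (ennreal).\<close>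

definition stopping_time_F :: "'w measure \<Rightarrow> (real \<Rightarrow> 'w set set) \<Rightarrow> ('w \<Rightarrow> ennreal) \<Rightarrow> bool" where
  "stopping_time_F \<Omega> F T \<longleftrightarrow> (\<forall>t\<ge>0. {\<omega>\<in>space \<Omega>. T \<omega> \<le> ennreal t} \<in> F t)"

definition stopped_sigma :: "'w measure \<Rightarrow> (real \<Rightarrow> 'w set set) \<Rightarrow> ('w \<Rightarrow> ennreal) \<Rightarrow> 'w set set" where
  "stopped_sigma \<Omega> F T = {A \<in> sets \<Omega>. \<forall>t\<ge>0. A \<inter> {\<omega>\<in>space \<Omega>. T \<omega> \<le> ennreal t} \<in> F t}"

definition path_sigma :: "'w measure \<Rightarrow> (real \<Rightarrow> 'w \<Rightarrow> 'a::metric_space option) \<Rightarrow> 'w set set" where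
  "path_sigma \<Omega> X = sigma_sets (space \<Omega>)
     {X t -` A \<inter> space \<Omega> | t A. t \<ge> 0 \<and> A \<in> sets cemB}"

definition borel_standard_markov ::
  "('a::metric_space option \<Rightarrow> 'w measure) \<Rightarrow> (real \<Rightarrow> 'w \<Rightarrow> 'a option) \<Rightarrow>
   (real \<Rightarrow> 'w \<Rightarrow> 'w) \<Rightarrow> (real \<Rightarrow> 'w set set) \<Rightarrow> bool" where
  "borel_standard_markov P X \<theta> F \<longleftrightarrow>
     \<comment> \<open>laws: probability measures on a common measurable space\<close>
     (\<forall>z. prob_space (P z)) \<and> (\<forall>z z'. sets (P z) = sets (P z')) \<and>
     (\<forall>z t. t \<ge> 0 \<longrightarrow> X t \<in> measurable (P z) cemB) \<and>
     \<comment> \<open>right-continuous filtration to which X is adapted\<close>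
     (\<forall>t. t \<ge> 0 \<longrightarrow> sigma_algebra (space (P None)) (F t) \<and> F t \<subseteq> sets (P None)) \<and>
     (\<forall>s t. 0 \<le> s \<longrightarrow> s \<le> t \<longrightarrow> F s \<subseteq> F t) \<and>
     (\<forall>t. t \<ge> 0 \<longrightarrow> F t = (\<Inter>u\<in>{t<..}. F u)) \<and>
     (\<forall>t A. t \<ge> 0 \<longrightarrow> A \<in> sets cemB \<longrightarrow> X t -` A \<inter> space (P None) \<in> F t) \<and>
     \<comment> \<open>normality\<close>
     (\<forall>z. AE \<omega> in P z. X 0 \<omega> = z) \<and>
     \<comment> \<open>partial is an absorbing cemetery\<close>
     (\<forall>\<omega> t s. \<omega> \<in> space (P None) \<longrightarrow> 0 \<le> t \<longrightarrow> t \<le> s \<longrightarrow> X t \<omega> = None \<longrightarrow> X s \<omega> = None) \<and>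
     \<comment> \<open>right-continuous paths, left limits before the lifetime\<close>
     (\<forall>\<omega> t. \<omega> \<in> space (P None) \<longrightarrow> t \<ge> 0 \<longrightarrow>
        limitin cem_top (\<lambda>s. X s \<omega>) (X t \<omega>) (at_right t)) \<and>
     (\<forall>\<omega> t. \<omega> \<in> space (P None) \<longrightarrow> t > 0 \<longrightarrow> X t \<omega> \<noteq> None \<longrightarrow>
        (\<exists>l. limitin cem_top (\<lambda>s. X s \<omega>) l (at_left t))) \<and>
     \<comment> \<open>shift operators\<close>
     (\<forall>t. t \<ge> 0 \<longrightarrow> \<theta> t \<in> space (P None) \<rightarrow> space (P None)) \<and>
     (\<forall>t s \<omega>. t \<ge> 0 \<longrightarrow> s \<ge> 0 \<longrightarrow> \<omega> \<in> space (P None) \<longrightarrow> X s (\<theta> t \<omega>) = X (s + t) \<omega>) \<and>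
     \<comment> \<open>Borel measurability of the laws\<close>
     (\<forall>\<Lambda>\<in>path_sigma (P None) X. (\<lambda>z. emeasure (P z) \<Lambda>) \<in> borel_measurable cemB) \<and>
     \<comment> \<open>strong Markov property\<close>
     (\<forall>T z A \<Lambda>. stopping_time_F (P None) F T \<longrightarrow> A \<in> stopped_sigma (P None) F T \<longrightarrow>
        \<Lambda> \<in> path_sigma (P None) X \<longrightarrow>
        emeasure (P z) {\<omega> \<in> A. T \<omega> < \<top> \<and> \<theta> (enn2real (T \<omega>)) \<omega> \<in> \<Lambda>} =
        (\<integral>\<^sup>+ \<omega>. indicator {\<omega>' \<in> A. T \<omega>' < \<top>} \<omega> *
              emeasure (P (X (enn2real (T \<omega>)) \<omega>)) \<Lambda> \<partial>P z)) \<and>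
     \<comment> \<open>quasi-left-continuity on [0, lifetime)\<close>
     (\<forall>Tn T z. (\<forall>n. stopping_time_F (P None) F (Tn n)) \<longrightarrow> stopping_time_F (P None) F T \<longrightarrow>
        (\<forall>\<omega>. incseq (\<lambda>n. Tn n \<omega>)) \<longrightarrow> (\<forall>\<omega>. (\<lambda>n. Tn n \<omega>) \<longlonglongrightarrow> T \<omega>) \<longrightarrow>
        (AE \<omega> in P z. T \<omega> < \<top> \<longrightarrow> X (enn2real (T \<omega>)) \<omega> \<noteq> None \<longrightarrow>
           limitin cem_top (\<lambda>n. X (enn2real (Tn n \<omega>)) \<omega>) (X (enn2real (T \<omega>)) \<omega>) sequentially))"

text \<open>Sum over jump times s in (0,t] of F(X_{s-}, X_s) (terms with X_{s-} = partial or
without a left limit contribute 0); as a supremum of finite partial sums.\<close>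
definition left_lim :: "(real \<Rightarrow> 'w \<Rightarrow> 'a::metric_space option) \<Rightarrow> real \<Rightarrow> 'w \<Rightarrow> 'a option" where
  "left_lim X s \<omega> = (if \<exists>l. limitin cem_top (\<lambda>r. X r \<omega>) l (at_left s)
                      then (THE l. limitin cem_top (\<lambda>r. X r \<omega>) l (at_left s)) else None)"

definition jump_sum :: "(real \<Rightarrow> 'w \<Rightarrow> 'a::metric_space option) \<Rightarrow> ('a \<Rightarrow> 'a option \<Rightarrow> ennreal) \<Rightarrow> real \<Rightarrow> 'w \<Rightarrow> ennreal" where
  "jump_sum X G t \<omega> = (SUP S \<in> {S. finite S \<and> S \<subseteq> {0<..t}}.
      \<Sum>s\<in>S. (case left_lim X s \<omega> of None \<Rightarrow> 0 | Some x \<Rightarrow> G x (X s \<omega>)))"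

definition levy_system ::
  "('a::metric_space option \<Rightarrow> 'w measure) \<Rightarrow> (real \<Rightarrow> 'w \<Rightarrow> 'a option) \<Rightarrow> ('a \<Rightarrow> 'a option measure) \<Rightarrow> bool" where
  "levy_system P X J \<longleftrightarrow>
     (\<forall>x. sets (J x) = sets cemB) \<and>
     (\<forall>A\<in>sets cemB. (\<lambda>x. emeasure (J x) A) \<in> borel_measurable borel) \<and>
     (\<forall>G z t. G \<in> borel_measurable (borel \<Otimes>\<^sub>M cemB) \<longrightarrow> t > 0 \<longrightarrow>
        (\<forall>x. G (x, Some x) = 0) \<longrightarrow>
        (\<integral>\<^sup>+ \<omega>. jump_sum X (\<lambda>x y. G (x, y)) t \<omega> \<partial>P (Some z)) =
        (\<integral>\<^sup>+ \<omega>. (\<integral>\<^sup>+ s. indicator {0..t} s *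
            (case X s \<omega> of None \<Rightarrow> 0 | Some x \<Rightarrow> \<integral>\<^sup>+ y. G (x, y) \<partial>J x) \<partial>lborel) \<partial>P (Some z)))"

definition exit_time :: "(real \<Rightarrow> 'w \<Rightarrow> 'a option) \<Rightarrow> 'a set \<Rightarrow> 'w \<Rightarrow> ennreal" where
  "exit_time X D \<omega> = Inf {ennreal t | t. t > 0 \<and> X t \<omega> \<notin> Some ` D}"

definition Etau :: "('a::metric_space option \<Rightarrow> 'w measure) \<Rightarrow> (real \<Rightarrow> 'w \<Rightarrow> 'a option) \<Rightarrow> 'a \<Rightarrow> real \<Rightarrow> ennreal" where
  "Etau P X x r = (\<integral>\<^sup>+ \<omega>. exit_time X (ball x r) \<omega> \<partial>P (Some x))"

definition dd :: "'a::metric_space \<Rightarrow> 'a \<Rightarrow> real" where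
  "dd ob x = dist x ob + 1"

definition conditions_B ::
  "('a::metric_space option \<Rightarrow> 'w measure) \<Rightarrow> (real \<Rightarrow> 'w \<Rightarrow> 'a option) \<Rightarrow> ('a \<Rightarrow> 'a option measure) \<Rightarrow>
   'a \<Rightarrow> real \<Rightarrow> real \<Rightarrow> bool" where
  "conditions_B P X J ob Rinf \<upsilon> \<longleftrightarrow> Rinf \<ge> 1 \<and> 0 < \<upsilon> \<and> \<upsilon> < 1 \<and>
    (\<exists>ell C1 C2 C3 C4 C5 C6 C7 :: real. ell > 1 \<and> C1 > 1 \<and> C2 > 0 \<and> C3 > 0 \<and> C4 > 0 \<and> C5 > 0 \<and> C6 > 0 \<and> C7 > 0 \<and>
      \<comment> \<open>(B1)\<close>
      (\<forall>x r. r > Rinf * dd ob x powr \<upsilon> \<longrightarrow>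
         ennreal (1 / C1) * Etau P X ob r \<le> Etau P X x r \<and> Etau P X x r \<le> ennreal C1 * Etau P X ob r) \<and>
      \<comment> \<open>(B2)\<close>
      (\<forall>s. s > Rinf \<longrightarrow>
         2 * Etau P X ob (s / ell) \<le> Etau P X ob s \<and> Etau P X ob s \<le> ennreal C2 * Etau P X ob (s / 2)) \<and>
      \<comment> \<open>(B3)\<close>
      (\<forall>x r. r > Rinf * dd ob x powr \<upsilon> \<longrightarrow>
         emeasure (J x) (- (Some ` ball x r)) \<le> ennreal C3 / Etau P X x r) \<and>
      \<comment> \<open>(B4)\<close>
      (\<forall>x r (n::nat). r > Rinf * dd ob x powr \<upsilon> \<longrightarrow> n \<ge> 1 \<longrightarrow>
         C4 * exp (- C5 * n) \<le> measure (P (Some x)) {\<omega> \<in> space (P (Some x)).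
              exit_time X (ball x r) \<omega> \<ge> of_nat n * Etau P X x r} \<and>
         measure (P (Some x)) {\<omega> \<in> space (P (Some x)).
              exit_time X (ball x r) \<omega> \<ge> of_nat n * Etau P X x r} \<le> C6 * exp (- C7 * n)))"

definition admissible_at_infinity ::
  "('a::metric_space option \<Rightarrow> 'w measure) \<Rightarrow> (real \<Rightarrow> 'w \<Rightarrow> 'a option) \<Rightarrow> 'a \<Rightarrow> real \<Rightarrow> real \<Rightarrow> (real \<Rightarrow> real) \<Rightarrow> bool" where
  "admissible_at_infinity P X ob Rinf \<upsilon> \<phi> \<longleftrightarrow>
     mono_on {0<..} \<phi> \<and> (\<forall>r>0. \<phi> r > 0) \<and>
     (\<exists>C::real. C \<ge> 1 \<and> (\<forall>x r. r > Rinf * dd ob x powr \<upsilon> \<longrightarrow>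
        ennreal (1 / C) * Etau P X x r \<le> ennreal (\<phi> r) \<and> ennreal (\<phi> r) \<le> ennreal C * Etau P X x r))"

definition gen_inv :: "(real \<Rightarrow> real) \<Rightarrow> real \<Rightarrow> real" where
  "gen_inv \<phi> t = Sup {r. r > 0 \<and> \<phi> r \<le> t}"

end

theory Submission
  imports Defs "HOL-Real_Asymp.Real_Asymp"
begin

text \<open>
  Write \<open>c = C4 e^(-C5)\<close>. By (B4) the process stays in \<open>B(x, r)\<close> up to time \<open>\<phi>(r) / C\<close> with
  probability at least \<open>c\<close>; letting \<open>r\<close> tend to infinity, it survives forever with probability at
  least \<open>c\<close> from every starting point. Hence death cannot be announced by stopping times, so it has
  to occur by a jump from a left limit in \<open>M\<close>; but (B3) gives \<open>J(x, {\<partial>}) = 0\<close>, so the process is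
  conservative and has left limits in \<open>M\<close>.

  The lower bound on the liminf follows from the upper estimate in (B4) and the Borel-Cantelli lemma
  along \<open>r k = ell^k\<close>; it uses neither the Markov property nor (B3). For the upper bound let
  \<open>r n = ell^(n^2)\<close> and \<open>t n = 8 \<phi>(r n) ln n\<close>. From time \<open>t (n - 1)\<close> on, the process stays within a
  multiple of \<open>r n\<close> during time \<open>t n\<close> with conditional probability at least \<open>c / n\<close>, provided that it
  was within distance of order \<open>r n\<close> up to time \<open>t (n - 1)\<close>. The latter fails with summable
  probability: crossing \<open>n\<close> nested shells without a big jump costs a factor \<open>1 - c\<close> for each shell,
  and big jumps are controlled by the Levy system and (B3).
\<close>

section \<open>The topology of the one-point extension\<close>

text \<open>(B3) and (B4) are available at a point only above a radius growing like its distance to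
  the base point to the power \<upsilon>, so a restarted estimate must check its new starting point.
  Since \<upsilon> < 1, radii of order ell^(n^2 - n) are admissible for all points at distance
  O(ell^(n^2)). This explains the quadratic exponent: n shells of width ell^(n^2 - n + 1) fit below
  r n, while t (n - 1) is only O(ln n / 2^n) times phi of that width, so both error terms are
  summable. On the other hand ln (phi (r n)) is O(n^2), so log log t n stays of order ln n and the
  probabilities c / n still have a divergent sum. Measurability shapes many statements: the
  filtration is right-continuous but not assumed complete, so the hitting times are those of open
  sets, and closed balls occur beside the open balls of (B4). The axioms give left limits only in
  the one-point extension and only while the process is alive, so left limits in M need an argument
  of their own, at death and before it.\<close>

lemma istopology_cem:
  "istopology (\<lambda>U::'a::metric_space option set. open (Some -` U) \<and> (None \<in> U \<longrightarrow> compact (- (Some -` U))))"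
  unfolding istopology_def
proof (intro conjI allI impI)
  fix S T :: "'a option set"
  assume "open (Some -` S) \<and> (None \<in> S \<longrightarrow> compact (- (Some -` S)))"
    "open (Some -` T) \<and> (None \<in> T \<longrightarrow> compact (- (Some -` T)))"
  then show "open (Some -` (S \<inter> T))" "None \<in> S \<inter> T \<Longrightarrow> compact (- (Some -` (S \<inter> T)))"
    by (auto simp: vimage_Int Compl_Int)
next
  fix \<K> :: "'a option set set"
  assume *: "\<forall>K\<in>\<K>. open (Some -` K) \<and> (None \<in> K \<longrightarrow> compact (- (Some -` K)))"
  then show op: "open (Some -` \<Union>\<K>)" by (auto simp: vimage_Union)
  assume "None \<in> \<Union>\<K>"
  then obtain K where K: "K \<in> \<K>" "None \<in> K" by auto
  with * have "compact (- (Some -` K))" by auto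
  moreover have "- (Some -` \<Union>\<K>) = (- (Some -` K)) \<inter> (- (Some -` \<Union>\<K>))" using K by auto
  ultimately show "compact (- (Some -` \<Union>\<K>))"
    using op by (metis closed_Compl compact_Int_closed)
qed

lemma openin_cem_top:
  "openin cem_top U \<longleftrightarrow> open (Some -` U) \<and> (None \<in> U \<longrightarrow> compact (- (Some -` U)))"
  unfolding cem_top_def topology_inverse'[OF istopology_cem] ..

lemma topspace_cem_top [simp]: "topspace cem_top = UNIV"
  by (metis (no_types) openin_cem_top openin_subset Compl_UNIV_eq compact_empty open_UNIV subset_UNIV top.extremum_unique vimage_UNIV)

lemma openin_cem_Some: "open V \<Longrightarrow> openin cem_top (Some ` V)"
  by (auto simp: openin_cem_top inj_vimage_image_eq)

lemma openin_cem_Compl_compact: "compact K \<Longrightarrow> openin cem_top (- Some ` K)"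
  by (auto simp: openin_cem_top vimage_Compl inj_vimage_image_eq compact_imp_closed)

lemma limitin_cem_Some:
  assumes "limitin cem_top f (Some l) G" "open V" "l \<in> V"
  shows "eventually (\<lambda>x. f x \<in> Some ` V) G"
  using assms openin_cem_Some[OF assms(2)] by (auto simp: limitin_def)

lemma limitin_cem_None:
  assumes "limitin cem_top f None G" "compact K"
  shows "eventually (\<lambda>x. f x \<notin> Some ` K) G"
  using assms openin_cem_Compl_compact[OF assms(2)] by (auto simp: limitin_def)

lemma compact_nhd:
  fixes l :: "'a::metric_space"
  assumes "locally_compact_space (euclidean :: 'a topology)"
  obtains U K where "open U" "compact K" "l \<in> U" "U \<subseteq> K"
  using assms unfolding locally_compact_space_def by simp blast

text \<open>\<open>None\<close> is excluded as a second limit by local compactness: a neighbourhood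
  of \<open>l\<close> inside a compact set misses a neighbourhood of \<open>None\<close>. Uniqueness
  identifies the \<open>THE\<close> in \<open>left_lim\<close>.\<close>

lemma limitin_cem_unique:
  fixes l :: "'a::metric_space"
  assumes lc: "locally_compact_space (euclidean :: 'a topology)"
    and l: "limitin cem_top f (Some l) G" and m: "limitin cem_top f m G" and G: "G \<noteq> bot"
  shows "m = Some l"
proof (cases m)
  case None
  obtain U K where U: "open U" "compact K" "l \<in> U" "U \<subseteq> K" using compact_nhd[OF lc] .
  have "eventually (\<lambda>x. f x \<in> Some ` U) G" "eventually (\<lambda>x. f x \<notin> Some ` K) G"
    using limitin_cem_Some[OF l] limitin_cem_None m None U by auto
  then have "eventually (\<lambda>x. False) G" by eventually_elim (use U in auto)
  then show ?thesis using G by simp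
next
  case (Some n)
  have "n = l"
  proof (rule ccontr)
    assume "n \<noteq> l"
    then obtain U V where U: "open U" "open V" "n \<in> U" "l \<in> V" "U \<inter> V = {}" 
      using hausdorff by metis
    have "eventually (\<lambda>x. f x \<in> Some ` U) G" "eventually (\<lambda>x. f x \<in> Some ` V) G"
      using limitin_cem_Some[OF l] limitin_cem_Some m Some U by auto
    then have "eventually (\<lambda>x. False) G" by eventually_elim (use U in auto)
    then show False using G by simp
  qed
  then show ?thesis using Some by simp
qed

text \<open>Lindelof reduces the cover by relatively compact open sets to a countable one. Because
  the interiors cover, a path that converges in M is eventually inside one
  \<open>K n\<close>.\<close>

lemma compact_exhaustion:
  assumes "locally_compact_space (euclidean :: 'a topology)"
  obtains K :: "nat \<Rightarrow> 'a::{metric_space, second_countable_topology} set" where "\<And>n. compact (K n)" "incseq K" "(\<Union>n. interior (K n)) = UNIV"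
proof -
  define \<F> where "\<F> = {U::'a set. open U \<and> (\<exists>K. compact K \<and> U \<subseteq> K)}"
  have un: "\<Union>\<F> = UNIV"
    unfolding \<F>_def using compact_nhd[OF assms] by (auto; metis)
  obtain \<F>' where F': "\<F>' \<subseteq> \<F>" "countable \<F>'" "\<Union>\<F>' = \<Union>\<F>"
    using Lindelof[of \<F>] unfolding \<F>_def by blast
  have ne: "\<F>' \<noteq> {}" using F' un by auto
  define U where "U = from_nat_into \<F>'"
  have rU: "range U = \<F>'" unfolding U_def using ne F' by (simp add: range_from_nat_into)
  have "\<forall>n. \<exists>K. compact K \<and> U n \<subseteq> K"
    using rU F' unfolding \<F>_def by blast
  then obtain L where L: "\<And>n. compact (L n)" "\<And>n. U n \<subseteq> L n" by metis
  define K where "K n = (\<Union>i\<le>n. L i)" for n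
  show ?thesis
  proof
    show "compact (K n)" for n unfolding K_def using L by auto
    show "incseq K" unfolding K_def by (auto simp: incseq_def intro: order_trans)
    have "U n \<subseteq> interior (K n)" for n
    proof (rule interior_maximal)
      show "U n \<subseteq> K n" using L unfolding K_def by auto
      show "open (U n)" using rU F' unfolding \<F>_def by blast
    qed
    then have "(\<Union>n. U n) \<subseteq> (\<Union>n. interior (K n))" by blast
    then show "(\<Union>n. interior (K n)) = UNIV" using F' rU un by auto
  qed
qed

section \<open>Borel sets of the one-point extension\<close>

lemma space_cemB [simp]: "space cemB = UNIV"
  unfolding cemB_def by (simp add: space_measure_of_conv)

lemma sets_cemB: "sets cemB = sigma_sets UNIV (Collect (openin cem_top))"
  unfolding cemB_def by (simp add: sets_measure_of_conv)

lemma openin_sets_cemB: "openin cem_top U \<Longrightarrow> U \<in> sets cemB"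
  unfolding sets_cemB by (auto intro: sigma_sets.Basic)

lemma None_sets_cemB [measurable]: "{None} \<in> sets (cemB :: 'a::metric_space option measure)"
proof -
  have "UNIV - Some ` (UNIV::'a set) \<in> sets cemB"
    by (metis open_UNIV openin_cem_Some openin_sets_cemB sets.compl_sets space_cemB)
  moreover have "UNIV - Some ` (UNIV::'a set) = {None}" by (auto simp: image_def)
  ultimately show ?thesis by simp
qed

text \<open>As \<open>{None}\<close> is measurable, only the trace on M counts. This covers
  complements of closed noncompact sets of M, which contain \<open>None\<close> without being open
  in \<open>cem_top\<close>.\<close>

lemma sets_cemB_open:
  assumes "open (Some -` U)"
  shows "U \<in> sets cemB"
proof -
  have *: "Some ` (Some -` U) \<in> sets cemB" using openin_cem_Some[OF assms] openin_sets_cemB by blast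
  have "U = Some ` (Some -` U) \<or> U = Some ` (Some -` U) \<union> {None}"
    by (cases "None \<in> U") (auto simp: image_iff, metis option.exhaust)
  then show ?thesis using * by (metis None_sets_cemB sets.Un)
qed

text \<open>\<open>the None\<close> is an unspecified fixed point; whichever it is, the preimage of
  an open set has that set as its trace.\<close>

lemma measurable_the [measurable]: "the \<in> measurable cemB borel"
proof (rule borel_measurableI)
  fix S :: "'a set" assume "open S"
  have *: "Some -` (the -` S) = S" by auto
  show "the -` S \<inter> space cemB \<in> sets cemB"
    using sets_cemB_open[of "the -` S"] \<open>open S\<close> by (simp add: *)
qed

section \<open>Hitting times and the strong Markov property\<close>

locale standard_process =
  fixes P :: "'a::{metric_space, second_countable_topology} option \<Rightarrow> 'w measure"
    and X :: "real \<Rightarrow> 'w \<Rightarrow> 'a option"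
    and \<theta> :: "real \<Rightarrow> 'w \<Rightarrow> 'w"
    and F :: "real \<Rightarrow> 'w set set"
  assumes lc: "locally_compact_space (euclidean :: 'a topology)"
    and markov: "borel_standard_markov P X \<theta> F"
begin

abbreviation "\<Omega> \<equiv> space (P None)"

section \<open>The axioms of a Borel standard process, one by one\<close>

lemmas markov_conjuncts = markov[unfolded borel_standard_markov_def]

lemma prob_P: "prob_space (P z)"
  by (rule markov_conjuncts[THEN conjunct1, rule_format])

lemma sets_P: "sets (P z) = sets (P None)"
  by (rule markov_conjuncts[THEN conjunct2, THEN conjunct1, rule_format])

lemma F_sigma: "t \<ge> 0 \<Longrightarrow> sigma_algebra \<Omega> (F t)"
  by (rule markov_conjuncts[THEN conjunct2, THEN conjunct2, THEN conjunct2, THEN conjunct1, rule_format, THEN conjunct1])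

lemma F_subset: "t \<ge> 0 \<Longrightarrow> F t \<subseteq> sets (P None)"
  by (rule markov_conjuncts[THEN conjunct2, THEN conjunct2, THEN conjunct2, THEN conjunct1, rule_format, THEN conjunct2])

lemma F_mono: "0 \<le> s \<Longrightarrow> s \<le> t \<Longrightarrow> F s \<subseteq> F t"
  by (rule markov_conjuncts[THEN conjunct2, THEN conjunct2, THEN conjunct2, THEN conjunct2, THEN conjunct1, rule_format])

lemma F_right: "t \<ge> 0 \<Longrightarrow> F t = (\<Inter>u\<in>{t<..}. F u)"
  by (rule markov_conjuncts[THEN conjunct2, THEN conjunct2, THEN conjunct2, THEN conjunct2, THEN conjunct2, THEN conjunct1, rule_format])

lemma F_adapted: "t \<ge> 0 \<Longrightarrow> A \<in> sets cemB \<Longrightarrow> X t -` A \<inter> \<Omega> \<in> F t"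
  by (rule markov_conjuncts[THEN conjunct2, THEN conjunct2, THEN conjunct2, THEN conjunct2, THEN conjunct2, THEN conjunct2, THEN conjunct1, rule_format])

lemma X_0: "AE \<omega> in P z. X 0 \<omega> = z"
  by (rule markov_conjuncts[THEN conjunct2, THEN conjunct2, THEN conjunct2, THEN conjunct2, THEN conjunct2, THEN conjunct2, THEN conjunct2, THEN conjunct1, rule_format])

lemma absorbing: "\<omega> \<in> \<Omega> \<Longrightarrow> 0 \<le> t \<Longrightarrow> t \<le> s \<Longrightarrow> X t \<omega> = None \<Longrightarrow> X s \<omega> = None"
  by (rule markov_conjuncts[THEN conjunct2, THEN conjunct2, THEN conjunct2, THEN conjunct2, THEN conjunct2, THEN conjunct2, THEN conjunct2, THEN conjunct2, THEN conjunct1, rule_format])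

lemma right_cont: "\<omega> \<in> \<Omega> \<Longrightarrow> t \<ge> 0 \<Longrightarrow> limitin cem_top (\<lambda>s. X s \<omega>) (X t \<omega>) (at_right t)"
  by (rule markov_conjuncts[THEN conjunct2, THEN conjunct2, THEN conjunct2, THEN conjunct2, THEN conjunct2, THEN conjunct2, THEN conjunct2, THEN conjunct2, THEN conjunct2, THEN conjunct1, rule_format])

lemma left_limit: "\<omega> \<in> \<Omega> \<Longrightarrow> t > 0 \<Longrightarrow> X t \<omega> \<noteq> None \<Longrightarrow> \<exists>l. limitin cem_top (\<lambda>s. X s \<omega>) l (at_left t)"
  by (rule markov_conjuncts[THEN conjunct2, THEN conjunct2, THEN conjunct2, THEN conjunct2, THEN conjunct2, THEN conjunct2, THEN conjunct2, THEN conjunct2, THEN conjunct2, THEN conjunct2, THEN conjunct1, rule_format])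

lemma shift_space: "t \<ge> 0 \<Longrightarrow> \<omega> \<in> \<Omega> \<Longrightarrow> \<theta> t \<omega> \<in> \<Omega>"
  using markov_conjuncts[THEN conjunct2, THEN conjunct2, THEN conjunct2, THEN conjunct2, THEN conjunct2, THEN conjunct2, THEN conjunct2, THEN conjunct2, THEN conjunct2, THEN conjunct2, THEN conjunct2, THEN conjunct1] by (simp add: Pi_iff)

lemma shift: "t \<ge> 0 \<Longrightarrow> s \<ge> 0 \<Longrightarrow> \<omega> \<in> \<Omega> \<Longrightarrow> X s (\<theta> t \<omega>) = X (s + t) \<omega>"
  by (rule markov_conjuncts[THEN conjunct2, THEN conjunct2, THEN conjunct2, THEN conjunct2, THEN conjunct2, THEN conjunct2, THEN conjunct2, THEN conjunct2, THEN conjunct2, THEN conjunct2, THEN conjunct2, THEN conjunct2, THEN conjunct1, rule_format])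

lemma strong_markov: "stopping_time_F (P None) F T \<Longrightarrow> B \<in> stopped_sigma (P None) F T \<Longrightarrow>
        \<Lambda> \<in> path_sigma (P None) X \<Longrightarrow>
        emeasure (P z) {\<omega> \<in> B. T \<omega> < \<top> \<and> \<theta> (enn2real (T \<omega>)) \<omega> \<in> \<Lambda>} =
        (\<integral>\<^sup>+ \<omega>. indicator {\<omega>' \<in> B. T \<omega>' < \<top>} \<omega> *
              emeasure (P (X (enn2real (T \<omega>)) \<omega>)) \<Lambda> \<partial>P z)"
  by (rule markov_conjuncts[THEN conjunct2, THEN conjunct2, THEN conjunct2, THEN conjunct2, THEN conjunct2, THEN conjunct2, THEN conjunct2, THEN conjunct2, THEN conjunct2, THEN conjunct2, THEN conjunct2, THEN conjunct2, THEN conjunct2, THEN conjunct2, THEN conjunct1, rule_format])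

lemma quasi_left_cont: "(\<And>n. stopping_time_F (P None) F (Tn n)) \<Longrightarrow> stopping_time_F (P None) F T \<Longrightarrow>
        (\<And>\<omega>. incseq (\<lambda>n. Tn n \<omega>)) \<Longrightarrow> (\<And>\<omega>. (\<lambda>n. Tn n \<omega>) \<longlonglongrightarrow> T \<omega>) \<Longrightarrow>
        (AE \<omega> in P z. T \<omega> < \<top> \<longrightarrow> X (enn2real (T \<omega>)) \<omega> \<noteq> None \<longrightarrow>
           limitin cem_top (\<lambda>n. X (enn2real (Tn n \<omega>)) \<omega>) (X (enn2real (T \<omega>)) \<omega>) sequentially)"
  by (rule markov_conjuncts[THEN conjunct2, THEN conjunct2, THEN conjunct2, THEN conjunct2, THEN conjunct2, THEN conjunct2, THEN conjunct2, THEN conjunct2, THEN conjunct2, THEN conjunct2, THEN conjunct2, THEN conjunct2, THEN conjunct2, THEN conjunct2, THEN conjunct2, rule_format])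

lemma space_P: "space (P z) = \<Omega>"
  using sets_P sets_eq_imp_space_eq by blast

lemma F_sets: "t \<ge> 0 \<Longrightarrow> A \<in> F t \<Longrightarrow> A \<in> sets (P z)"
  using F_subset sets_P by blast

lemma F_X: 
  assumes "0 \<le> s" "s \<le> t" "open (Some -` U)"
  shows "{\<omega>\<in>\<Omega>. X s \<omega> \<in> U} \<in> F t"
proof -
  have "X s -` U \<inter> \<Omega> \<in> F s" using F_adapted assms sets_cemB_open by blast
  moreover have "X s -` U \<inter> \<Omega> = {\<omega>\<in>\<Omega>. X s \<omega> \<in> U}" by auto
  ultimately show ?thesis using F_mono[of s t] assms by auto
qed

text \<open>An open trace is enough, although right continuity refers to neighbourhoods in
  \<open>cem_top\<close>, because a path at \<open>None\<close> never moves again.\<close>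

lemma right_stable:
  assumes w: "\<omega> \<in> \<Omega>" "t \<ge> 0" and U: "X t \<omega> \<in> U" "open (Some -` U)"
  obtains \<delta> where "\<delta> > 0" "\<And>s. t \<le> s \<Longrightarrow> s < t + \<delta> \<Longrightarrow> X s \<omega> \<in> U"
proof (cases "X t \<omega>")
  case None
  then have "X s \<omega> \<in> U" if "t \<le> s" for s using absorbing[OF w that] U by simp
  then show ?thesis using that[of 1] by auto
next
  case (Some z)
  have "eventually (\<lambda>s. X s \<omega> \<in> Some ` (Some -` U)) (at_right t)"
    using limitin_cem_Some[OF _ U(2)] right_cont[OF w] Some U(1) by auto
  then obtain b where b: "b > t" "\<And>s. t < s \<Longrightarrow> s < b \<Longrightarrow> X s \<omega> \<in> U"
    unfolding eventually_at_right_field by auto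
  show ?thesis
    by (rule that[of "b - t"]) (use b U in \<open>auto simp: le_less\<close>)
qed

section \<open>Hitting times of open sets\<close>

definition hit_after :: "'a option set \<Rightarrow> ('w \<Rightarrow> ennreal) \<Rightarrow> 'w \<Rightarrow> ennreal" where
  "hit_after U T \<omega> = Inf {ennreal s | s. s > 0 \<and> T \<omega> < ennreal s \<and> X s \<omega> \<in> U}"

lemma exit_time_hit_after: "exit_time X D = hit_after (- Some ` D) (\<lambda>_. 0)"
  unfolding exit_time_def hit_after_def by (intro ext arg_cong[where f=Inf]) auto

lemma hit_after_less:
  "hit_after U T \<omega> < ennreal t \<longleftrightarrow> (\<exists>s. 0 < s \<and> s < t \<and> T \<omega> < ennreal s \<and> X s \<omega> \<in> U)"
  unfolding hit_after_def Inf_less_iff by (auto simp: ennreal_less_iff)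

lemma hit_after_ge: "T \<omega> \<le> hit_after U T \<omega>"
  unfolding hit_after_def by (auto intro!: Inf_greatest)

text \<open>A visit to \<open>U\<close> lasts for a short interval by right continuity, hence
  contains a rational time; countably many coordinates then decide the event.\<close>

lemma hit_after_less_rat:
  assumes w: "\<omega> \<in> \<Omega>" and U: "open (Some -` U)"
  shows "hit_after U T \<omega> < ennreal t \<longleftrightarrow> (\<exists>q\<in>\<rat>. (0 < q \<and> q < t) \<and> T \<omega> < ennreal q \<and> X q \<omega> \<in> U)"
proof
  assume "hit_after U T \<omega> < ennreal t"
  then obtain s where s: "0 < s" "s < t" "T \<omega> < ennreal s" "X s \<omega> \<in> U"
    unfolding hit_after_less by blast
  obtain \<delta> where d: "\<delta> > 0" "\<And>s'. s \<le> s' \<Longrightarrow> s' < s + \<delta> \<Longrightarrow> X s' \<omega> \<in> U"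
    using right_stable[OF w _ s(4) U] s by (metis less_imp_le)
  obtain q where q: "q \<in> \<rat>" "s < q" "q < min t (s + \<delta>)" 
    using Rats_dense_in_real[of s "min t (s+\<delta>)"] s d by auto
  have "T \<omega> < ennreal q" using s(1,3) q(2) by (metis ennreal_less_iff less_imp_le less_trans)
  then show "\<exists>q\<in>\<rat>. (0 < q \<and> q < t) \<and> T \<omega> < ennreal q \<and> X q \<omega> \<in> U" using q s d(2)[of q] by (intro bexI[of _ q]) auto
qed (auto simp: hit_after_less)

text \<open>Times \<open>T\<close> with \<open>{T < t} \<in> F t\<close>; since \<open>F\<close> is right-continuous these are stopping times.\<close>

definition optional_time :: "('w \<Rightarrow> ennreal) \<Rightarrow> bool" where
  "optional_time T \<longleftrightarrow> (\<forall>t>0. {\<omega>\<in>\<Omega>. T \<omega> < ennreal t} \<in> F t)"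

lemma optional_timeD: "optional_time T \<Longrightarrow> 0 < s \<Longrightarrow> s \<le> t \<Longrightarrow> {\<omega>\<in>\<Omega>. T \<omega> < ennreal s} \<in> F t"
  unfolding optional_time_def using F_mono[of s t] by fastforce

lemma optional_time_const: "optional_time (\<lambda>_. c)"
  unfolding optional_time_def
proof (intro allI impI)
  fix t :: real assume "t > 0"
  then interpret sigma_algebra \<Omega> "F t" using F_sigma by simp
  show "{\<omega>\<in>\<Omega>. c < ennreal t} \<in> F t" by (rule sets_Collect_const)
qed

lemma optional_time_hit_after:
  assumes T: "optional_time T" and U: "open (Some -` U)"
  shows "optional_time (hit_after U T)"
  unfolding optional_time_def
proof (intro allI impI)
  fix t :: real assume t: "t > 0"
  interpret sigma_algebra \<Omega> "F t" using F_sigma t by simp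
  have "{\<omega>\<in>\<Omega>. \<exists>q\<in>\<rat>. (0 < q \<and> q < t) \<and> T \<omega> < ennreal q \<and> X q \<omega> \<in> U} \<in> F t"
  proof (intro sets_Collect_countable_Ex')
    show "countable (\<rat>::real set)" by (rule countable_rat)
    fix q :: real
    show "{\<omega>\<in>\<Omega>. (0 < q \<and> q < t) \<and> T \<omega> < ennreal q \<and> X q \<omega> \<in> U} \<in> F t"
    proof (cases "0 < q \<and> q < t")
      case True
      then have "{\<omega>\<in>\<Omega>. T \<omega> < ennreal q \<and> X q \<omega> \<in> U} \<in> F t"
        by (intro sets_Collect_conj optional_timeD T F_X U) auto
      then show ?thesis using True by simp
    qed auto
  qed
  moreover have "{\<omega>\<in>\<Omega>. hit_after U T \<omega> < ennreal t} = {\<omega>\<in>\<Omega>. \<exists>q\<in>\<rat>. (0 < q \<and> q < t) \<and> T \<omega> < ennreal q \<and> X q \<omega> \<in> U}"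
    using hit_after_less_rat[OF _ U] by auto
  ultimately show "{\<omega>\<in>\<Omega>. hit_after U T \<omega> < ennreal t} \<in> F t" by simp
qed

lemma optional_time_exit:
  assumes "closed D" shows "optional_time (exit_time X D)"
  unfolding exit_time_hit_after using assms
  by (intro optional_time_hit_after optional_time_const) (auto simp: vimage_Compl inj_vimage_image_eq)

text \<open>The event is the intersection over \<open>n\<close> of
  \<open>T < s + (u - s) / (n + 1)\<close>, and so lies in \<open>F u\<close>. As this holds for
  every \<open>u > s\<close>, right continuity of the filtration puts it in
  \<open>F s\<close>.\<close>

lemma optional_time_le:
  assumes T: "optional_time T" and t: "0 \<le> s" "s \<le> t"
  shows "{\<omega>\<in>\<Omega>. T \<omega> \<le> ennreal s} \<in> F t"
proof -
  have "{\<omega>\<in>\<Omega>. T \<omega> \<le> ennreal s} \<in> F u" if u: "u > s" for u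
  proof -
    interpret sigma_algebra \<Omega> "F u" using F_sigma t u by simp
    have "T \<omega> \<le> ennreal s \<longleftrightarrow> (\<forall>n. T \<omega> < ennreal (s + (u - s) / Suc n))" for \<omega>
    proof
      assume *: "T \<omega> \<le> ennreal s"
      show "\<forall>n. T \<omega> < ennreal (s + (u - s) / Suc n)"
        using t u by (auto intro!: le_less_trans[OF *] simp: ennreal_less_iff)
    next
      assume *: "\<forall>n. T \<omega> < ennreal (s + (u - s) / Suc n)"
      have "(\<lambda>n. s + (u - s) / Suc n) \<longlonglongrightarrow> s + 0"
        by (intro tendsto_add tendsto_const LIMSEQ_Suc[OF lim_const_over_n])
      then have "(\<lambda>n. ennreal (s + (u - s) / Suc n)) \<longlonglongrightarrow> ennreal s" by (simp add: tendsto_ennrealI)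
      then show "T \<omega> \<le> ennreal s"
        by (rule LIMSEQ_le_const) (use * less_imp_le in blast)
    qed
    then have "{\<omega>\<in>\<Omega>. T \<omega> \<le> ennreal s} = {\<omega>\<in>\<Omega>. \<forall>n. T \<omega> < ennreal (s + (u - s) / Suc n)}" by auto
    also have "\<dots> \<in> F u"
    proof (intro sets_Collect_countable_All optional_timeD[OF T])
      fix n show "0 < s + (u - s) / real (Suc n)" using t u by (simp add: add_nonneg_pos)
      have "(u - s) / real (Suc n) \<le> (u - s) / 1" using u by (intro divide_left_mono) auto
      then show "s + (u - s) / real (Suc n) \<le> u" by simp
    qed
    finally show ?thesis .
  qed
  then have "{\<omega>\<in>\<Omega>. T \<omega> \<le> ennreal s} \<in> F s" using F_right[OF t(1)] by auto
  then show ?thesis using F_mono[of s t] t by auto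
qed

lemma optional_time_stopping: "optional_time T \<Longrightarrow> stopping_time_F (P None) F T"
  unfolding stopping_time_F_def using optional_time_le by auto

lemma optional_time_sets: 
  assumes "optional_time T" "0 < t"
  shows "{\<omega>\<in>\<Omega>. T \<omega> < ennreal t} \<in> sets (P z)" "{\<omega>\<in>\<Omega>. T \<omega> \<le> ennreal t} \<in> sets (P z)"
  using optional_timeD[OF assms] optional_time_le[OF assms(1)] F_sets[of t] assms by auto

text \<open>From a position outside the closure the path would avoid \<open>U\<close> for a while
  after \<open>h\<close>, so \<open>h\<close> could not be the infimum of the visits. The infimum
  need not be a visit itself, hence the closure.\<close>

lemma X_hit_after:
  assumes w: "\<omega> \<in> \<Omega>" and h: "hit_after U T \<omega> = ennreal h" "h \<ge> 0" and z: "X h \<omega> = Some z"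
  shows "z \<in> closure (Some -` U)"
proof (rule ccontr)
  assume n: "z \<notin> closure (Some -` U)"
  define V where "V = Some ` (- closure (Some -` U))"
  have V: "open (Some -` V)" "X h \<omega> \<in> V" unfolding V_def using n z by (auto simp: inj_vimage_image_eq)
  obtain \<delta> where d: "\<delta> > 0" "\<And>s'. h \<le> s' \<Longrightarrow> s' < h + \<delta> \<Longrightarrow> X s' \<omega> \<in> V"
    using right_stable[OF w h(2) V(2,1)] by blast
  have "hit_after U T \<omega> < ennreal (h + \<delta>)" using h d by (simp add: ennreal_less_iff)
  then obtain s where s: "0 < s" "s < h + \<delta>" "T \<omega> < ennreal s" "X s \<omega> \<in> U"
    unfolding hit_after_less by blast
  have "hit_after U T \<omega> \<le> ennreal s" unfolding hit_after_def by (rule Inf_lower) (use s in auto)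
  then have "h \<le> s" using h s by (simp add: ennreal_le_iff)
  then have "X s \<omega> \<in> V" using d s by auto
  then obtain y where "X s \<omega> = Some y" "y \<notin> closure (Some -` U)" unfolding V_def by auto
  then show False using s(4) closure_subset[of "Some -` U"] by auto
qed

section \<open>Path events and one-sided strong Markov estimates\<close>

lemma path_sigma_algebra: "sigma_algebra \<Omega> (path_sigma (P None) X)"
  unfolding path_sigma_def by (rule sigma_algebra_sigma_sets) auto

lemma path_sigma_X: 
  assumes "t \<ge> 0" "open (Some -` U)"
  shows "{\<omega>\<in>\<Omega>. X t \<omega> \<in> U} \<in> path_sigma (P None) X"
proof -
  have "X t -` U \<inter> \<Omega> \<in> path_sigma (P None) X" unfolding path_sigma_def 
    using assms sets_cemB_open[of U] by (intro sigma_sets.Basic) auto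
  moreover have "X t -` U \<inter> \<Omega> = {\<omega>\<in>\<Omega>. X t \<omega> \<in> U}" by auto
  ultimately show ?thesis by simp
qed

text \<open>The strong Markov axiom speaks only of events in \<open>path_sigma\<close>, so exit
  events are expressed by coordinates at rational times.\<close>

lemma path_sigma_exit:
  assumes "closed D"
  shows "{\<omega>\<in>\<Omega>. exit_time X D \<omega> < ennreal t} \<in> path_sigma (P None) X"
proof -
  interpret sigma_algebra \<Omega> "path_sigma (P None) X" by (rule path_sigma_algebra)
  have D: "open (Some -` (- Some ` D))" using assms by (auto simp: vimage_Compl inj_vimage_image_eq)
  have "{\<omega>\<in>\<Omega>. \<exists>q\<in>\<rat>. (0 < q \<and> q < t) \<and> (\<lambda>_. 0) \<omega> < ennreal q \<and> X q \<omega> \<in> - Some ` D} \<in> path_sigma (P None) X"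
  proof (intro sets_Collect_countable_Ex')
    fix q :: real
    show "{\<omega>\<in>\<Omega>. (0 < q \<and> q < t) \<and> 0 < ennreal q \<and> X q \<omega> \<in> - Some ` D} \<in> path_sigma (P None) X"
    proof (cases "0 < q \<and> q < t")
      case True
      then show ?thesis using path_sigma_X[OF _ D, of q] by simp
    qed auto
  qed (rule countable_rat)
  moreover have "{\<omega>\<in>\<Omega>. exit_time X D \<omega> < ennreal t} = {\<omega>\<in>\<Omega>. \<exists>q\<in>\<rat>. (0 < q \<and> q < t) \<and> (\<lambda>_. 0) \<omega> < ennreal q \<and> X q \<omega> \<in> - Some ` D}"
    unfolding exit_time_hit_after using hit_after_less_rat[OF _ D, where T="\<lambda>_. 0"] by simp blast
  ultimately show ?thesis by simp
qed

lemma exit_time_less: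
  "exit_time X D \<omega> < ennreal t \<longleftrightarrow> (\<exists>s. 0 < s \<and> s < t \<and> X s \<omega> \<notin> Some ` D)"
  unfolding exit_time_hit_after hit_after_less by auto

lemma strong_markov_upper:
  assumes "stopping_time_F (P None) F T" "A \<in> stopped_sigma (P None) F T" "\<Lambda> \<in> path_sigma (P None) X"
    and "\<And>\<omega>. \<omega> \<in> A \<Longrightarrow> T \<omega> < \<top> \<Longrightarrow> emeasure (P (X (enn2real (T \<omega>)) \<omega>)) \<Lambda> \<le> \<kappa>"
  shows "emeasure (P z) {\<omega> \<in> A. T \<omega> < \<top> \<and> \<theta> (enn2real (T \<omega>)) \<omega> \<in> \<Lambda>} \<le> \<kappa> * emeasure (P z) A"
proof -
  have A: "A \<in> sets (P z)" using assms(2) sets_P[of z] unfolding stopped_sigma_def by auto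
  have "emeasure (P z) {\<omega> \<in> A. T \<omega> < \<top> \<and> \<theta> (enn2real (T \<omega>)) \<omega> \<in> \<Lambda>} \<le> (\<integral>\<^sup>+ \<omega>. \<kappa> * indicator A \<omega> \<partial>P z)"
    unfolding strong_markov[OF assms(1-3)]
    by (intro nn_integral_mono) (auto simp: indicator_def assms(4))
  also have "\<dots> = \<kappa> * emeasure (P z) A" using A by (simp add: nn_integral_cmult_indicator)
  finally show ?thesis .
qed

text \<open>\<open>E\<close> is any event on which the kernel is bounded below, not necessarily one
  decided at time \<open>T\<close>: in \<open>no_announced_death\<close> it depends on the later
  path.\<close>

lemma strong_markov_lower:
  assumes "stopping_time_F (P None) F T" "A \<in> stopped_sigma (P None) F T" "\<Lambda> \<in> path_sigma (P None) X"
    and "E \<in> sets (P z)" "E \<subseteq> {\<omega>\<in>A. T \<omega> < \<top>}"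
    and "\<And>\<omega>. \<omega> \<in> E \<Longrightarrow> \<kappa> \<le> emeasure (P (X (enn2real (T \<omega>)) \<omega>)) \<Lambda>"
  shows "\<kappa> * emeasure (P z) E \<le> emeasure (P z) {\<omega> \<in> A. T \<omega> < \<top> \<and> \<theta> (enn2real (T \<omega>)) \<omega> \<in> \<Lambda>}"
proof -
  have "\<kappa> * emeasure (P z) E = (\<integral>\<^sup>+ \<omega>. \<kappa> * indicator E \<omega> \<partial>P z)"
    using assms(4) by (simp add: nn_integral_cmult_indicator)
  also have "\<dots> \<le> emeasure (P z) {\<omega> \<in> A. T \<omega> < \<top> \<and> \<theta> (enn2real (T \<omega>)) \<omega> \<in> \<Lambda>}"
    unfolding strong_markov[OF assms(1-3)]
    using assms(5) by (intro nn_integral_mono) (auto simp: indicator_def assms(6))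
  finally show ?thesis .
qed

end

section \<open>The scale function and the survival probability\<close>

locale stable_like_process = standard_process P X \<theta> F
  for P :: "'a::{metric_space, second_countable_topology} option \<Rightarrow> 'w measure"
    and X :: "real \<Rightarrow> 'w \<Rightarrow> 'a option" and \<theta> F +
  fixes J :: "'a \<Rightarrow> 'a option measure" and ob :: 'a and R \<upsilon> :: real and \<phi> :: "real \<Rightarrow> real"
    and ell C C2 C3 C4 C5 C6 C7 :: real
  assumes levy: "levy_system P X J"
    and params: "R \<ge> 1" "0 < \<upsilon>" "\<upsilon> < 1" "ell > 1" "C \<ge> 1" "C2 > 0" "C3 > 0" "C4 > 0" "C5 > 0" "C6 > 0" "C7 > 0"
    and B2: "\<And>s. s > R \<Longrightarrow> 2 * Etau P X ob (s / ell) \<le> Etau P X ob s"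
      "\<And>s. s > R \<Longrightarrow> Etau P X ob s \<le> ennreal C2 * Etau P X ob (s / 2)"
    and B3: "\<And>x r. r > R * dd ob x powr \<upsilon> \<Longrightarrow> emeasure (J x) (- (Some ` ball x r)) \<le> ennreal C3 / Etau P X x r"
    and B4: "\<And>x r n. r > R * dd ob x powr \<upsilon> \<Longrightarrow> n \<ge> 1 \<Longrightarrow>
         C4 * exp (- C5 * real n) \<le> measure (P (Some x)) {\<omega> \<in> space (P (Some x)). exit_time X (ball x r) \<omega> \<ge> of_nat n * Etau P X x r}"
      "\<And>x r n. r > R * dd ob x powr \<upsilon> \<Longrightarrow> n \<ge> 1 \<Longrightarrow>
         measure (P (Some x)) {\<omega> \<in> space (P (Some x)). exit_time X (ball x r) \<omega> \<ge> of_nat n * Etau P X x r} \<le> C6 * exp (- C7 * real n)"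
    and phi_mono: "mono_on {0<..} \<phi>" and phi_pos: "\<And>r. r > 0 \<Longrightarrow> \<phi> r > 0"
    and phi_Etau: "\<And>x r. r > R * dd ob x powr \<upsilon> \<Longrightarrow> ennreal (1 / C) * Etau P X x r \<le> ennreal (\<phi> r)"
      "\<And>x r. r > R * dd ob x powr \<upsilon> \<Longrightarrow> ennreal (\<phi> r) \<le> ennreal C * Etau P X x r"
begin

section \<open>Growth of the scale function\<close>

definition far :: "'a \<Rightarrow> real \<Rightarrow> bool" where "far x r \<longleftrightarrow> r > R * dd ob x powr \<upsilon>"

lemma far_ob: "far ob r \<longleftrightarrow> r > R" by (simp add: far_def dd_def)

lemma far_gt_1: assumes "far x r" shows "r > 1"
proof -
  have "1 \<le> dd ob x powr \<upsilon>" using params by (intro ge_one_powr_ge_zero) (auto simp: dd_def)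
  then have "1 * 1 \<le> R * dd ob x powr \<upsilon>" using params by (intro mult_mono) auto
  then show ?thesis using assms by (simp add: far_def)
qed

lemma eventually_far: "eventually (far x) at_top"
  unfolding far_def by (rule eventually_gt_at_top)

text \<open>Admissibility bounds a positive multiple of \<open>Etau\<close> by the real number
  \<open>\<phi> r\<close>; hence \<open>Etau\<close> is finite and the inequalities in
  \<open>ennreal\<close> can be solved for it.\<close>

lemma Etau_bounds:
  assumes "far x r"
  shows "ennreal (\<phi> r / C) \<le> Etau P X x r" "Etau P X x r \<le> ennreal (C * \<phi> r)"
proof -
  have r: "\<phi> r > 0" using phi_pos far_gt_1[OF assms] by simp
  note b = phi_Etau[OF assms[unfolded far_def]]
  have fin: "Etau P X x r \<noteq> \<top>"
  proof
    assume "Etau P X x r = \<top>"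
    then show False using b(1) params by (simp add: ennreal_mult_top top_unique)
  qed
  then obtain e where e: "e \<ge> 0" "Etau P X x r = ennreal e" by (cases "Etau P X x r") auto
  have "1 / C * e \<le> \<phi> r" "\<phi> r \<le> C * e"
    using b e params r by (auto simp: ennreal_mult[symmetric] ennreal_le_iff)
  then have "e \<le> C * \<phi> r" "\<phi> r / C \<le> e" using params by (auto simp: field_simps)
  then show "ennreal (\<phi> r / C) \<le> Etau P X x r" "Etau P X x r \<le> ennreal (C * \<phi> r)"
    using e by (auto intro: ennreal_leI)
qed

text \<open>The first half of (B2) is iterated \<open>j\<close> times at the base point, where
  \<open>far\<close> just means \<open>s > R\<close>. One factor \<open>C\<close> pays for passing
  from \<open>\<phi>\<close> to expected exit times, the other for the way back.\<close>

lemma phi_growth: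
  assumes "s > R"
  shows "2 ^ j * \<phi> s \<le> C\<^sup>2 * \<phi> (ell ^ j * s)"
proof -
  have s0: "s > 0" using assms params by simp
  have big: "ell ^ j * s > R" for j
  proof -
    have "1 * s \<le> ell ^ j * s" using params s0 by (intro mult_right_mono) auto
    then show ?thesis using assms by simp
  qed
  have "2 ^ j * Etau P X ob s \<le> Etau P X ob (ell ^ j * s)"
  proof (induction j)
    case (Suc j)
    have "2 ^ Suc j * Etau P X ob s = 2 * (2 ^ j * Etau P X ob s)" by (simp add: mult.assoc)
    also have "\<dots> \<le> 2 * Etau P X ob (ell ^ j * s)" using Suc by (intro mult_left_mono) auto
    also have "\<dots> \<le> Etau P X ob (ell ^ Suc j * s)"
      using B2(1)[OF big[of "Suc j"]] params by (simp add: mult.assoc)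
    finally show ?case .
  qed simp
  moreover have "ennreal (2 ^ j * (\<phi> s / C)) \<le> 2 ^ j * Etau P X ob s"
  proof -
    have "ennreal (2 ^ j * (\<phi> s / C)) = 2 ^ j * ennreal (\<phi> s / C)"
      using params phi_pos[OF s0] by (subst ennreal_mult) (auto simp: ennreal_power[symmetric])
    then show ?thesis using Etau_bounds(1)[of ob s] assms by (auto simp: far_ob intro!: mult_left_mono)
  qed
  moreover have "Etau P X ob (ell ^ j * s) \<le> ennreal (C * \<phi> (ell ^ j * s))"
    using Etau_bounds(2)[of ob] big by (simp add: far_ob)
  ultimately have "ennreal (2 ^ j * (\<phi> s / C)) \<le> ennreal (C * \<phi> (ell ^ j * s))" by (meson order_trans)
  moreover have "C * \<phi> (ell ^ j * s) \<ge> 0" using params phi_pos[of "ell ^ j * s"] big[of j] by simp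
  ultimately have "2 ^ j * (\<phi> s / C) \<le> C * \<phi> (ell ^ j * s)" by (simp add: ennreal_le_iff)
  then show ?thesis using params by (simp add: field_simps power2_eq_square)
qed

text \<open>The counterpart from the second half of (B2). It is the source of the polynomial growth
  bound used in \<open>eventually_gen_inv_ge\<close>.\<close>

lemma phi_doubling:
  assumes "s > R"
  shows "\<phi> (2 ^ j * s) \<le> C\<^sup>2 * C2 ^ j * \<phi> s"
proof -
  have s0: "s > 0" using assms params by simp
  have big: "2 ^ j * s > R" for j
  proof -
    have "1 * s \<le> 2 ^ j * s" using s0 by (intro mult_right_mono) auto
    then show ?thesis using assms by simp
  qed
  have "Etau P X ob (2 ^ j * s) \<le> ennreal (C2 ^ j) * Etau P X ob s"
  proof (induction j)
    case (Suc j)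
    have "Etau P X ob (2 ^ Suc j * s) \<le> ennreal C2 * Etau P X ob (2 ^ j * s)"
      using B2(2)[OF big[of "Suc j"]] by simp
    also have "\<dots> \<le> ennreal C2 * (ennreal (C2 ^ j) * Etau P X ob s)" using Suc by (intro mult_left_mono) auto
    also have "\<dots> = ennreal (C2 ^ Suc j) * Etau P X ob s"
      using params by (simp add: ennreal_mult mult.assoc)
    finally show ?case .
  qed simp
  also have "\<dots> \<le> ennreal (C2 ^ j) * ennreal (C * \<phi> s)"
    using Etau_bounds(2)[of ob s] assms by (intro mult_left_mono) (auto simp: far_ob)
  finally have "ennreal (\<phi> (2 ^ j * s) / C) \<le> ennreal (C2 ^ j) * ennreal (C * \<phi> s)"
    using Etau_bounds(1)[of ob "2 ^ j * s"] big[of j] by (auto simp: far_ob intro: order_trans)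
  also have "\<dots> = ennreal (C2 ^ j * (C * \<phi> s))"
    using params phi_pos[OF s0] by (simp add: ennreal_mult)
  finally have "\<phi> (2 ^ j * s) / C \<le> C2 ^ j * (C * \<phi> s)"
    using params phi_pos[OF s0] by (subst (asm) ennreal_le_iff) auto
  then show ?thesis using params by (simp add: field_simps power2_eq_square)
qed

lemma phi_le: "0 < r \<Longrightarrow> r \<le> s \<Longrightarrow> \<phi> r \<le> \<phi> s"
  using phi_mono by (auto simp: mono_on_def)

lemma phi_at_top: "filterlim \<phi> at_top at_top"
  unfolding filterlim_at_top
proof
  fix Z :: real
  have p: "\<phi> (2 * R) > 0" using phi_pos params by simp
  obtain j where j: "Z * C\<^sup>2 / \<phi> (2 * R) < 2 ^ j" using real_arch_pow[of 2] by auto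
  show "eventually (\<lambda>r. Z \<le> \<phi> r) at_top"
    using eventually_ge_at_top[of "ell ^ j * (2 * R)"]
  proof eventually_elim
    case (elim r)
    have "Z * C\<^sup>2 \<le> 2 ^ j * \<phi> (2 * R)" using j p by (simp add: field_simps)
    also have "\<dots> \<le> C\<^sup>2 * \<phi> (ell ^ j * (2 * R))" using phi_growth[of "2 * R" j] params by simp
    also have "\<dots> \<le> C\<^sup>2 * \<phi> r" using elim params by (intro mult_left_mono phi_le) auto
    finally show ?case using params by simp
  qed
qed

text \<open>A time unit \<open>\<phi> r / C\<close> is at most one expected exit time, so (B4)
  applies with \<open>n = m\<close>. Passing to a closed \<open>D\<close> makes the early exit an
  event.\<close>

lemma stay_prob:
  assumes far: "far x r" and D: "closed D" "ball x r \<subseteq> D" and m: "m \<ge> 1" "t \<le> real m * (\<phi> r / C)"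
  shows "measure (P (Some x)) {\<omega>\<in>\<Omega>. exit_time X D \<omega> < ennreal t} \<le> 1 - C4 * exp (- C5 * real m)"
proof -
  interpret prob_space "P (Some x)" by (rule prob_P)
  define A where "A = {\<omega> \<in> space (P (Some x)). exit_time X (ball x r) \<omega> \<ge> of_nat m * Etau P X x r}"
  have Am: "C4 * exp (- C5 * real m) \<le> measure (P (Some x)) A"
    unfolding A_def by (rule B4(1)) (use far m in \<open>auto simp: far_def\<close>)
  \<comment> \<open>A nonmeasurable set has \<open>measure\<close> 0, so the positive lower bound in
    (B4) itself shows that \<open>A\<close> is an event.\<close>
  then have "measure (P (Some x)) A > 0" using params by (smt (verit) exp_gt_zero mult_pos_pos)
  then have A: "A \<in> sets (P (Some x))" using measure_notin_sets[of A] by (metis less_irrefl)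
  have "{\<omega>\<in>\<Omega>. exit_time X D \<omega> < ennreal t} \<subseteq> space (P (Some x)) - A"
  proof
    fix \<omega> assume "\<omega> \<in> {\<omega>\<in>\<Omega>. exit_time X D \<omega> < ennreal t}"
    then have w: "\<omega> \<in> \<Omega>" "exit_time X D \<omega> < ennreal t" by auto
    obtain s where s: "0 < s" "s < t" "X s \<omega> \<notin> Some ` D" using w(2) unfolding exit_time_less by auto
    have "X s \<omega> \<notin> Some ` ball x r" using s(3) D(2) by auto
    then have "exit_time X (ball x r) \<omega> < ennreal t" using s(1,2) unfolding exit_time_less by auto
    also have "\<dots> \<le> of_nat m * ennreal (\<phi> r / C)"
      using m(2) params phi_pos[of r] far_gt_1[OF far]
      by (simp add: ennreal_of_nat_eq_real_of_nat ennreal_mult[symmetric] ennreal_leI del: times_divide_eq_right)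
    also have "\<dots> \<le> of_nat m * Etau P X x r" by (rule mult_left_mono[OF Etau_bounds(1)[OF far]]) simp
    finally have "\<omega> \<notin> A" by (simp add: A_def not_le)
    then show "\<omega> \<in> space (P (Some x)) - A" using w(1) by (simp add: space_P[of "Some x"])
  qed
  then have "measure (P (Some x)) {\<omega>\<in>\<Omega>. exit_time X D \<omega> < ennreal t} \<le> measure (P (Some x)) (space (P (Some x)) - A)"
    using A by (intro finite_measure_mono) auto
  also have "\<dots> = 1 - measure (P (Some x)) A" using A by (simp add: prob_compl)
  finally show ?thesis using Am by simp
qed

section \<open>Survival and announced death\<close>

definition stay_const :: real where "stay_const = C4 * exp (- C5)"

lemma stay_const_pos: "stay_const > 0" using params by (simp add: stay_const_def)

text \<open>Integer times suffice because \<open>None\<close> is absorbing, and a countable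
  intersection of coordinate events lies in \<open>path_sigma\<close>.\<close>

definition immortal :: "'w set" where "immortal = {\<omega>\<in>\<Omega>. \<forall>n::nat. X (real n) \<omega> \<noteq> None}"

lemma immortalD: "\<omega> \<in> immortal \<Longrightarrow> X t \<omega> \<noteq> None" if "t \<ge> 0"
proof -
  assume w: "\<omega> \<in> immortal"
  obtain n :: nat where n: "t \<le> n" using real_arch_simple by blast
  show ?thesis using absorbing[OF _ that n, of \<omega>] w unfolding immortal_def by blast
qed

lemma immortal_path: "immortal \<in> path_sigma (P None) X"
proof -
  interpret sigma_algebra \<Omega> "path_sigma (P None) X" by (rule path_sigma_algebra)
  have "{\<omega>\<in>\<Omega>. X (real n) \<omega> \<in> - {None}} \<in> path_sigma (P None) X" for n :: nat
    by (rule path_sigma_X) (auto simp: vimage_def)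
  then show ?thesis unfolding immortal_def by (intro sets_Collect_countable_All) simp
qed

lemma alive_sets: "0 \<le> t \<Longrightarrow> {\<omega>\<in>\<Omega>. X t \<omega> \<noteq> None} \<in> sets (P z)"
  using F_sets[of t, OF _ F_X[of t t "- {None}"]] by (simp add: vimage_def)

lemma immortal_sets: "immortal \<in> sets (P z)"
proof -
  have "immortal = (\<Inter>n::nat. {\<omega>\<in>\<Omega>. X (real n) \<omega> \<noteq> None})" by (auto simp: immortal_def)
  then show ?thesis using alive_sets by auto
qed

text \<open>Apply (B4) with \<open>n = 1\<close> and let the radius tend to infinity.\<close>

lemma survival: "ennreal stay_const \<le> emeasure (P (Some x)) immortal"
proof -
  interpret prob_space "P (Some x)" by (rule prob_P)
  define A where "A n = {\<omega>\<in>\<Omega>. X (real n) \<omega> \<noteq> None}" for n :: nat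
  have A: "A n \<in> sets (P (Some x))" for n using alive_sets by (simp add: A_def)
  have "X (real m) \<omega> \<noteq> None" if "m \<le> n" "\<omega> \<in> \<Omega>" "X (real n) \<omega> \<noteq> None" for m n :: nat and \<omega>
    using absorbing[of \<omega> "real m" "real n"] that by auto
  then have dec: "decseq A" unfolding decseq_def A_def by blast
  have bound: "stay_const \<le> measure (P (Some x)) (A n)" for n
  proof -
    have "eventually (\<lambda>r. (real n + 1) * C \<le> \<phi> r) at_top" using phi_at_top by (simp add: filterlim_at_top)
    then have "eventually (\<lambda>r. (real n + 1) * C \<le> \<phi> r \<and> far x r) at_top"
      using eventually_far eventually_conj by blast
    then obtain r where r: "(real n + 1) * C \<le> \<phi> r" "far x r" 
      using eventually_happens' trivial_limit_at_top_linorder by blast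
    have "measure (P (Some x)) {\<omega>\<in>\<Omega>. exit_time X UNIV \<omega> < ennreal (real n + 1)} \<le> 1 - C4 * exp (- C5 * real 1)"
      using r params by (intro stay_prob[OF r(2)]) (auto simp: field_simps)
    moreover have "space (P (Some x)) - A n \<subseteq> {\<omega>\<in>\<Omega>. exit_time X UNIV \<omega> < ennreal (real n + 1)}"
    proof
      fix \<omega> assume "\<omega> \<in> space (P (Some x)) - A n"
      then have w: "\<omega> \<in> \<Omega>" "X (real n) \<omega> = None" by (auto simp: A_def space_P[of "Some x"])
      \<comment> \<open>The half step gives a time that is positive even for \<open>n = 0\<close>,
        as exit times ignore time 0, and strictly below \<open>n + 1\<close>.\<close>
      then have "X (real n + 1/2) \<omega> = None" using absorbing[of \<omega> "real n" "real n + 1/2"] by simp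
      then have "0 < real n + 1/2 \<and> real n + 1/2 < real n + 1 \<and> X (real n + 1/2) \<omega> \<notin> range Some"
        by auto
      then have "exit_time X UNIV \<omega> < ennreal (real n + 1)" unfolding exit_time_less by blast
      then show "\<omega> \<in> {\<omega>\<in>\<Omega>. exit_time X UNIV \<omega> < ennreal (real n + 1)}" using w by simp
    qed
    moreover have "{\<omega>\<in>\<Omega>. exit_time X UNIV \<omega> < ennreal (real n + 1)} \<in> sets (P (Some x))"
      by (rule optional_time_sets) (auto intro: optional_time_exit)
    ultimately have "measure (P (Some x)) (space (P (Some x)) - A n) \<le> 1 - C4 * exp (- C5 * real 1)"
      by (meson finite_measure_mono order_trans)
    then have "1 - measure (P (Some x)) (A n) \<le> 1 - C4 * exp (- C5 * real 1)" unfolding prob_compl[OF A[of n]] .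
    then show ?thesis by (simp add: stay_const_def)
  qed
  have "(\<lambda>n. measure (P (Some x)) (A n)) \<longlonglongrightarrow> measure (P (Some x)) (\<Inter>n. A n)"
    using A dec by (intro finite_Lim_measure_decseq) auto
  then have "stay_const \<le> measure (P (Some x)) (\<Inter>n. A n)"
    by (rule LIMSEQ_le_const) (use bound in auto)
  moreover have "(\<Inter>n. A n) = immortal" by (auto simp: A_def immortal_def)
  ultimately show ?thesis by (simp add: emeasure_eq_measure ennreal_leI)
qed

lemma stopped_sigma_le:
  assumes "optional_time S" "u \<ge> 0"
  shows "{\<omega>\<in>\<Omega>. S \<omega> \<le> ennreal u} \<in> stopped_sigma (P None) F S"
  unfolding stopped_sigma_def
proof (safe)
  show "{\<omega>\<in>\<Omega>. S \<omega> \<le> ennreal u} \<in> sets (P None)"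
    using optional_time_le[OF assms] F_subset assms by blast
  fix t :: real assume t: "t \<ge> 0"
  have "{\<omega>\<in>\<Omega>. S \<omega> \<le> ennreal u} \<inter> {\<omega>\<in>\<Omega>. S \<omega> \<le> ennreal t} = {\<omega>\<in>\<Omega>. S \<omega> \<le> ennreal (min u t)}"
    using assms t by (cases "u \<le> t") (auto simp: min_def intro: order_trans ennreal_leI)
  also have "\<dots> \<in> F t" using optional_time_le[OF assms(1), of "min u t" t] assms t by auto
  finally show "{\<omega>\<in>\<Omega>. S \<omega> \<le> ennreal u} \<inter> {\<omega>\<in>\<Omega>. S \<omega> \<le> ennreal t} \<in> F t" .
qed

text \<open>At each of the announcing times \<open>S j\<close> the conditional survival probability is at least
  \<open>stay_const\<close>, so death cannot be announced.\<close>

lemma no_announced_death: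
  assumes S: "\<And>j. optional_time (S j)" and inc: "\<And>\<omega>. incseq (\<lambda>j. S j \<omega>)" and u: "u > 0"
    and im: "AE \<omega> in P z. \<omega> \<in> immortal \<longrightarrow> \<not> (\<forall>j. S j \<omega> \<le> ennreal u)"
  shows "AE \<omega> in P z. \<not> (\<forall>j. S j \<omega> \<le> ennreal u \<and> (\<exists>q>0. S j \<omega> < ennreal q \<and> X q \<omega> \<noteq> None))"
proof -
  interpret prob_space "P z" by (rule prob_P)
  define A where "A j = {\<omega>\<in>\<Omega>. S j \<omega> \<le> ennreal u}" for j :: nat
  \<comment> \<open>\<open>Q j\<close> says that \<open>S j\<close> precedes death, with a rational
    witness for the sake of measurability.\<close>
  define Q where "Q j = {\<omega>\<in>\<Omega>. \<exists>q\<in>\<rat> \<inter> {0<..}. S j \<omega> < ennreal q \<and> X q \<omega> \<noteq> None}" for j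
  have A: "A j \<in> sets (P z)" for j unfolding A_def by (rule optional_time_sets[OF S u])
  have Q: "Q j \<in> sets (P z)" for j
    unfolding Q_def space_P[of z, symmetric]
    by (intro sets.sets_Collect_countable_Ex' sets.sets_Collect_conj countable_Int1 countable_rat)
       (use optional_time_sets(1)[OF S] alive_sets in \<open>auto simp: space_P[of z]\<close>)
  define E where "E = (\<Inter>j. A j \<inter> Q j)"
  have E: "E \<in> sets (P z)" unfolding E_def using A Q by auto
  have le: "ennreal stay_const * emeasure (P z) E \<le> emeasure (P z) (A j \<inter> immortal)" for j
  proof -
    have "ennreal stay_const * emeasure (P z) E \<le> emeasure (P z) {\<omega> \<in> A j. S j \<omega> < \<top> \<and> \<theta> (enn2real (S j \<omega>)) \<omega> \<in> immortal}"
    proof (rule strong_markov_lower[OF optional_time_stopping[OF S] _ immortal_path E])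
      show "A j \<in> stopped_sigma (P None) F (S j)" unfolding A_def using S u by (intro stopped_sigma_le) auto
      show "E \<subseteq> {\<omega> \<in> A j. S j \<omega> < \<top>}"
        unfolding E_def A_def using le_less_trans[OF _ ennreal_less_top] by blast
      fix \<omega> assume "\<omega> \<in> E"
      then obtain q where w: "\<omega> \<in> \<Omega>" and q: "q > 0" "S j \<omega> < ennreal q" "X q \<omega> \<noteq> None"
        unfolding E_def Q_def A_def by blast
      have "enn2real (S j \<omega>) \<le> q" using q by (intro enn2real_leI) auto
      then obtain x where "X (enn2real (S j \<omega>)) \<omega> = Some x"
        using absorbing[OF w, of "enn2real (S j \<omega>)" q] q by (cases "X (enn2real (S j \<omega>)) \<omega>") auto
      then show "ennreal stay_const \<le> emeasure (P (X (enn2real (S j \<omega>)) \<omega>)) immortal" using survival by simp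
    qed
    also have "\<dots> \<le> emeasure (P z) (A j \<inter> immortal)"
    proof (intro emeasure_mono subsetI)
      fix \<omega> assume "\<omega> \<in> {\<omega> \<in> A j. S j \<omega> < \<top> \<and> \<theta> (enn2real (S j \<omega>)) \<omega> \<in> immortal}"
      then have w: "\<omega> \<in> A j" "\<omega> \<in> \<Omega>" and i: "\<theta> (enn2real (S j \<omega>)) \<omega> \<in> immortal" by (auto simp: A_def)
      \<comment> \<open>Death by time \<open>n\<close> would persist to \<open>n + S j\<close>, so
        survival of the shifted path implies survival of the original one.\<close>
      have "X (real n) \<omega> \<noteq> None" for n :: nat
      proof
        assume *: "X (real n) \<omega> = None"
        have "X (real n) (\<theta> (enn2real (S j \<omega>)) \<omega>) = X (real n + enn2real (S j \<omega>)) \<omega>"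
          by (rule shift) (use w in auto)
        also have "\<dots> = None" using absorbing[OF w(2) _ _ *] by simp
        finally show False using i unfolding immortal_def by blast
      qed
      then show "\<omega> \<in> A j \<inter> immortal" using w by (simp add: immortal_def)
    qed (use A immortal_sets in auto)
    finally show ?thesis .
  qed
  have "decseq (\<lambda>j. A j \<inter> immortal)"
    unfolding decseq_def A_def using inc by (auto simp: incseq_def intro: order_trans)
  then have "(\<lambda>j. emeasure (P z) (A j \<inter> immortal)) \<longlonglongrightarrow> emeasure (P z) (\<Inter>j. A j \<inter> immortal)"
    using A immortal_sets by (intro Lim_emeasure_decseq) auto
  moreover have "emeasure (P z) (\<Inter>j. A j \<inter> immortal) = 0"
  proof -
    have "AE \<omega> in P z. \<omega> \<notin> (\<Inter>j. A j \<inter> immortal)" using im by eventually_elim (auto simp: A_def)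
    moreover have "(\<Inter>j. A j \<inter> immortal) \<in> sets (P z)" using A immortal_sets by auto
    ultimately show ?thesis using AE_iff_null_sets null_setsD1 by blast
  qed
  ultimately have "(\<lambda>j. emeasure (P z) (A j \<inter> immortal)) \<longlonglongrightarrow> 0" by simp
  \<comment> \<open>The left side does not depend on \<open>j\<close>, and the right side tends to 0
    since almost no immortal path has all \<open>S j\<close> below \<open>u\<close>.\<close>
  then have "ennreal stay_const * emeasure (P z) E \<le> 0" by (rule LIMSEQ_le_const) (use le in auto)
  then have "emeasure (P z) E = 0" using stay_const_pos by (auto simp: ennreal_eq_0_iff)
  then have "E \<in> null_sets (P z)" using E by auto
  then have "AE \<omega> in P z. \<omega> \<notin> E" by (rule AE_not_in)
  moreover have "AE \<omega> in P z. \<omega> \<in> \<Omega>" using AE_space[of "P z"] by (simp add: space_P[of z])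
  ultimately show ?thesis
  proof eventually_elim
    case (elim \<omega>)
    show ?case
    proof
      assume *: "\<forall>j. S j \<omega> \<le> ennreal u \<and> (\<exists>q>0. S j \<omega> < ennreal q \<and> X q \<omega> \<noteq> None)"
      have "\<omega> \<in> A j \<inter> Q j" for j
      proof -
        obtain q where q: "q > 0" "S j \<omega> < ennreal q" "X q \<omega> \<in> - {None}" using *[THEN spec, of j] by auto
        have op: "open (Some -` (- {None :: 'a option}))" by (auto simp: vimage_def)
        obtain \<delta> where d: "\<delta> > 0" "\<And>s. q \<le> s \<Longrightarrow> s < q + \<delta> \<Longrightarrow> X s \<omega> \<in> - {None}"
          using right_stable[OF elim(2) _ q(3) op] q(1) by (metis less_imp_le)
        obtain p where p: "p \<in> \<rat>" "q < p" "p < q + \<delta>" using Rats_dense_in_real[of q "q + \<delta>"] d by auto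
        have "S j \<omega> < ennreal p" using q p by (metis ennreal_less_iff less_imp_le less_trans)
        then show ?thesis using * elim(2) p q(1) d(2)[of p] by (auto simp: A_def Q_def intro!: bexI[of _ p])
      qed
      then show False using elim(1) by (simp add: E_def)
    qed
  qed
qed

end

section \<open>Left limits and crossings\<close>

text \<open>Taking \<open>q\<close> from a dense set and \<open>a\<close> rational keeps the number
  of crossing sequences, and thus of exceptional null sets, countable. \<open>q\<close> is chosen
  near a cluster point of the path along times increasing to \<open>\<zeta>\<close>.\<close>

lemma oscillation:
  fixes f :: "real \<Rightarrow> 'a::metric_space"
  assumes K: "compact K" and fK: "\<And>s. 0 < s \<Longrightarrow> s < \<zeta> \<Longrightarrow> f s \<in> K" and \<zeta>: "\<zeta> > 0"
    and D: "\<And>U. open U \<Longrightarrow> U \<noteq> {} \<Longrightarrow> \<exists>d\<in>D. d \<in> U"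
    and nolim: "\<And>l. \<not> (f \<longlongrightarrow> l) (at_left \<zeta>)"
  obtains q a where "q \<in> D" "a \<in> \<rat>" "a > 0"
    "\<And>b. b < \<zeta> \<Longrightarrow> \<exists>s. 0 < s \<and> b < s \<and> s < \<zeta> \<and> dist q (f s) < a"
    "\<And>b. b < \<zeta> \<Longrightarrow> \<exists>s. 0 < s \<and> b < s \<and> s < \<zeta> \<and> dist q (f s) > 2 * a"
proof -
  define s where "s i = \<zeta> - \<zeta> / real (i + 2)" for i :: nat
  have s: "0 < s i" "s i < \<zeta>" for i using \<zeta> by (auto simp: s_def field_simps add_pos_nonneg)
  have "(\<lambda>i. \<zeta> - \<zeta> / real (i + 2)) \<longlonglongrightarrow> \<zeta> - 0"
    by (intro tendsto_diff tendsto_const LIMSEQ_ignore_initial_segment[OF lim_const_over_n])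
  then have s_lim: "s \<longlonglongrightarrow> \<zeta>" unfolding s_def by simp
  have "\<forall>i. f (s i) \<in> K" using s fK by auto
  then obtain l r where l: "l \<in> K" "strict_mono r" "((\<lambda>i. f (s i)) \<circ> r) \<longlonglongrightarrow> l"
    using K unfolding compact_def by metis
  obtain e where e: "e > 0" "\<not> eventually (\<lambda>s. dist (f s) l < e) (at_left \<zeta>)"
    using nolim[of l] unfolding tendsto_iff by blast
  obtain q where q: "q \<in> D" "dist l q < e / 4" using D[of "ball l (e / 4)"] e by (auto simp: dist_commute)
  \<comment> \<open>\<open>a > e / 4\<close> leaves room in the ball about \<open>q\<close> for a
    neighbourhood of \<open>l\<close>; \<open>2 * a < 2 * e / 3 < e - e / 4\<close> keeps points at
    distance \<open>e\<close> from \<open>l\<close> beyond radius \<open>2 * a\<close>.\<close>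
  obtain a where a: "a \<in> \<rat>" "e / 4 < a" "a < e / 3" using Rats_dense_in_real[of "e/4" "e/3"] e by auto
  show ?thesis
  proof (rule that[OF q(1) a(1)])
    show "a > 0" using a e by simp
    fix b assume b: "b < \<zeta>"
    have "eventually (\<lambda>i. dist (f (s (r i))) l < a - e / 4) sequentially"
      using l(3) a(2) unfolding tendsto_iff by (auto simp: o_def)
    moreover have "eventually (\<lambda>i. s (r i) > b) sequentially"
      using eventually_compose_filterlim[OF order_tendstoD(1)[OF s_lim b] filterlim_subseq[OF l(2)]] .
    ultimately have "eventually (\<lambda>i. dist (f (s (r i))) l < a - e / 4 \<and> s (r i) > b) sequentially"
      by eventually_elim simp
    then obtain i where i: "dist (f (s (r i))) l < a - e / 4" "s (r i) > b"
      using eventually_happens' sequentially_bot by blast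
    have "dist q (f (s (r i))) < a"
      using dist_triangle[of q "f (s (r i))" l] i q by (simp add: dist_commute)
    then show "\<exists>s. 0 < s \<and> b < s \<and> s < \<zeta> \<and> dist q (f s) < a" using i s by blast
    have "\<exists>s>max b 0. s < \<zeta> \<and> \<not> dist (f s) l < e"
      using e(2) b \<zeta> unfolding eventually_at_left_field by (metis max_less_iff_conj)
    then obtain u where u: "u > max b 0" "u < \<zeta>" "dist (f u) l \<ge> e" by force
    have "dist q (f u) > 2 * a"
      using dist_triangle[of "f u" l q] u q a by (simp add: dist_commute)
    then show "\<exists>s. 0 < s \<and> b < s \<and> s < \<zeta> \<and> dist q (f s) > 2 * a" using u by auto
  qed
qed

lemma countable_dense:
  obtains D :: "'a::{metric_space, second_countable_topology} set"
  where "countable D" "\<And>U. open U \<Longrightarrow> U \<noteq> {} \<Longrightarrow> \<exists>d\<in>D. d \<in> U"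
  using countable_dense_setE by metis

context standard_process begin

lemma exit_time_mono: "D \<subseteq> D' \<Longrightarrow> exit_time X D \<omega> \<le> exit_time X D' \<omega>"
  unfolding exit_time_def by (rule Inf_superset_mono) blast

lemma exit_time_gt:
  assumes "ennreal t < exit_time X D \<omega>" "0 < s" "s \<le> t"
  shows "X s \<omega> \<in> Some ` D"
proof (rule ccontr)
  assume "X s \<omega> \<notin> Some ` D"
  then have "exit_time X D \<omega> \<le> ennreal s" unfolding exit_time_def using assms by (intro Inf_lower) auto
  also have "\<dots> \<le> ennreal t" using assms by (intro ennreal_leI) simp
  finally show False using assms(1) by simp
qed

text \<open>If all exit times \<open>Tn n\<close> were at most \<open>t\<close> with the process
  alive at \<open>t\<close>, it would be in M at their supremum \<open>T\<close>. By
  quasi-left-continuity the positions at \<open>Tn n\<close> would converge to that at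
  \<open>T\<close>, which is interior to some \<open>K j\<close>; but the position at
  \<open>Tn n\<close> is never interior to \<open>K n\<close>. This rules out a left limit
  \<open>None\<close> before death.\<close>

lemma path_in_compact:
  assumes K: "\<And>n. compact (K n)" "incseq K" "(\<Union>n. interior (K n)) = UNIV"
  shows "AE \<omega> in P z. \<forall>t\<ge>0. X t \<omega> \<noteq> None \<longrightarrow> (\<exists>n. ennreal t < exit_time X (K n) \<omega>)"
proof -
  define Tn where "Tn n = exit_time X (K n)" for n
  define T where "T \<omega> = (SUP n. Tn n \<omega>)" for \<omega>
  have opt: "optional_time (Tn n)" for n
    unfolding Tn_def using K by (intro optional_time_exit compact_imp_closed)
  have inc: "incseq (\<lambda>n. Tn n \<omega>)" for \<omega>
    unfolding Tn_def using K(2) by (auto simp: incseq_def intro: exit_time_mono)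
  have lim: "(\<lambda>n. Tn n \<omega>) \<longlonglongrightarrow> T \<omega>" for \<omega>
    unfolding T_def by (rule LIMSEQ_SUP[OF inc])
  have T: "stopping_time_F (P None) F T"
    unfolding stopping_time_F_def
  proof (intro allI impI)
    fix t :: real assume t: "t \<ge> 0"
    then interpret sigma_algebra \<Omega> "F t" by (rule F_sigma)
    have "{\<omega>\<in>\<Omega>. T \<omega> \<le> ennreal t} = {\<omega>\<in>\<Omega>. \<forall>n. Tn n \<omega> \<le> ennreal t}"
      by (auto simp: T_def SUP_le_iff)
    then show "{\<omega>\<in>\<Omega>. T \<omega> \<le> ennreal t} \<in> F t"
      using sets_Collect_countable_All[of "\<lambda>n \<omega>. Tn n \<omega> \<le> ennreal t"] optional_time_le[OF opt t order_refl] by simp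
  qed
  have "AE \<omega> in P z. \<omega> \<in> \<Omega>" using AE_space[of "P z"] by (simp add: space_P[of z])
  moreover have "AE \<omega> in P z. T \<omega> < \<top> \<longrightarrow> X (enn2real (T \<omega>)) \<omega> \<noteq> None \<longrightarrow>
           limitin cem_top (\<lambda>n. X (enn2real (Tn n \<omega>)) \<omega>) (X (enn2real (T \<omega>)) \<omega>) sequentially"
    by (rule quasi_left_cont) (use opt inc lim T optional_time_stopping in auto)
  ultimately show ?thesis
  proof eventually_elim
    case (elim \<omega>)
    show ?case
    proof (intro allI impI; rule ccontr)
      fix t :: real assume t: "t \<ge> 0" "X t \<omega> \<noteq> None" and "\<nexists>n. ennreal t < exit_time X (K n) \<omega>"
      then have le: "Tn n \<omega> \<le> ennreal t" for n by (auto simp: Tn_def not_less)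
      then have Tt: "T \<omega> \<le> ennreal t" by (auto simp: T_def SUP_le_iff)
      then have "enn2real (T \<omega>) \<le> t" using t by (intro enn2real_leI)
      then have "X (enn2real (T \<omega>)) \<omega> \<noteq> None" using absorbing[OF elim(1), of "enn2real (T \<omega>)" t] t by auto
      then obtain x where x: "X (enn2real (T \<omega>)) \<omega> = Some x" by auto
      have "T \<omega> < \<top>" using Tt by (rule le_less_trans) simp
      then have lim: "limitin cem_top (\<lambda>n. X (enn2real (Tn n \<omega>)) \<omega>) (Some x) sequentially"
        using elim(2) x by simp
      obtain j where j: "x \<in> interior (K j)" using K(3) by blast
      have "eventually (\<lambda>n. X (enn2real (Tn n \<omega>)) \<omega> \<in> Some ` interior (K j)) sequentially"
        using limitin_cem_Some[OF lim _ j] by simp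
      then have "eventually (\<lambda>n. X (enn2real (Tn n \<omega>)) \<omega> \<in> Some ` interior (K j) \<and> n \<ge> j) sequentially"
        using eventually_ge_at_top eventually_conj by blast
      then obtain n where n: "X (enn2real (Tn n \<omega>)) \<omega> \<in> Some ` interior (K j)" "n \<ge> j"
        using eventually_happens' sequentially_bot by blast
      then obtain w where w: "X (enn2real (Tn n \<omega>)) \<omega> = Some w" "w \<in> interior (K j)" by auto
      have "Tn n \<omega> < \<top>" using le[of n] by (rule le_less_trans) simp
      then have "hit_after (- Some ` K n) (\<lambda>_. 0) \<omega> = ennreal (enn2real (Tn n \<omega>))"
        by (simp add: Tn_def exit_time_hit_after)
      then have "w \<in> closure (Some -` (- Some ` K n))"
        by (rule X_hit_after[OF elim(1) _ _ w(1)]) simp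
      moreover have "Some -` (- Some ` K n) = - K n" by auto
      ultimately have "w \<notin> interior (K n)" by (simp add: closure_complement)
      moreover have "interior (K j) \<subseteq> interior (K n)" using K(2) n(2) by (intro interior_mono) (auto simp: incseq_def)
      ultimately show False using w by auto
    qed
  qed
qed

text \<open>Alternating visits to the ball of radius \<open>a\<close> and to the region beyond
  \<open>2 * a\<close>, in the manner of upcrossings. Odd indices are inner visits, positive even
  ones outer visits.\<close>

fun crossing :: "'a \<Rightarrow> real \<Rightarrow> nat \<Rightarrow> 'w \<Rightarrow> ennreal" where
  "crossing q a 0 = (\<lambda>_. 0)"
| "crossing q a (Suc j) = hit_after (if even j then Some ` ball q a else Some ` {w. dist q w > 2 * a}) (crossing q a j)"

lemma optional_time_crossing: "optional_time (crossing q a j)"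
proof (induction j)
  case (Suc j)
  have "open {w. 2 * a < dist q w}" by (intro open_Collect_less continuous_intros)
  then show ?case using Suc by (auto intro!: optional_time_hit_after simp: inj_vimage_image_eq)
qed (simp add: optional_time_const)

lemma incseq_crossing: "incseq (\<lambda>j. crossing q a j \<omega>)"
  by (rule incseq_SucI) (simp add: hit_after_ge)

lemma X_crossing:
  assumes w: "\<omega> \<in> \<Omega>" and S: "crossing q a (Suc j) \<omega> = ennreal h" "h \<ge> 0" and x: "X h \<omega> = Some x"
  shows "if even j then dist q x \<le> a else dist q x \<ge> 2 * a"
proof (cases "even j")
  case True
  then have "x \<in> closure (ball q a)"
    using X_hit_after[OF w, of "Some ` ball q a" "crossing q a j" h x] S x by (simp add: inj_vimage_image_eq)
  also have "closure (ball q a) \<subseteq> cball q a" by (rule closure_minimal) auto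
  finally show ?thesis using True by simp
next
  case False
  then have "x \<in> closure {w. 2 * a < dist q w}"
    using X_hit_after[OF w, of "Some ` {w. 2 * a < dist q w}" "crossing q a j" h x] S x by (simp add: inj_vimage_image_eq)
  also have "\<dots> \<subseteq> {w. 2 * a \<le> dist q w}"
    by (rule closure_minimal) (auto intro!: closed_Collect_le continuous_intros)
  finally show ?thesis using False by simp
qed

lemma limitin_not_None:
  assumes "limitin cem_top (\<lambda>s. X s \<omega>) l (at_left t)" "t > 0" "compact K" "\<And>s. 0 < s \<Longrightarrow> s < t \<Longrightarrow> X s \<omega> \<in> Some ` K"
  shows "l \<noteq> None"
proof
  assume "l = None"
  then have "eventually (\<lambda>s. X s \<omega> \<notin> Some ` K) (at_left t)" using limitin_cem_None assms by blast
  moreover have "eventually (\<lambda>s. 0 < s \<and> s < t) (at_left t)"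
    using assms(2) by (auto simp: eventually_at_left_field)
  ultimately have "eventually (\<lambda>s. False) (at_left t)" by eventually_elim (use assms(4) in auto)
  then show False by simp
qed

text \<open>Infinitely many crossings before \<open>u\<close> would accumulate at a time
  \<open>S\<close> where the path has a left limit in M, although positions at consecutive crossings
  are at least \<open>a\<close> apart.\<close>

lemma crossing_unbounded:
  assumes w: "\<omega> \<in> \<Omega>" and alive: "\<And>t. t \<ge> 0 \<Longrightarrow> X t \<omega> \<noteq> None"
    and K: "\<And>t. t \<ge> 0 \<Longrightarrow> \<exists>K. compact K \<and> (\<forall>s. 0 < s \<and> s \<le> t \<longrightarrow> X s \<omega> \<in> Some ` K)"
    and a: "a > 0"
  shows "\<not> (\<forall>j. crossing q a j \<omega> \<le> ennreal u)"
proof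
  assume le: "\<forall>j. crossing q a j \<omega> \<le> ennreal u"
  define s where "s j = enn2real (crossing q a j \<omega>)" for j
  have fin: "crossing q a j \<omega> < \<top>" for j using le by (meson ennreal_less_top le_less_trans)
  have s: "crossing q a j \<omega> = ennreal (s j)" "s j \<ge> 0" for j using fin[of j] by (auto simp: s_def)
  have inc: "incseq s"
    using incseq_crossing[of q a \<omega>] s by (simp add: incseq_def ennreal_le_iff)
  have d: "if even j then dist q (the (X (s (Suc j)) \<omega>)) \<le> a else dist q (the (X (s (Suc j)) \<omega>)) \<ge> 2 * a" for j
  proof (rule X_crossing[OF w s(1) s(2)])
    show "X (s (Suc j)) \<omega> = Some (the (X (s (Suc j)) \<omega>))" using alive[OF s(2)[of "Suc j"]] by simp
  qed
  \<comment> \<open>Different positions force different times. Strictness places every crossing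
    before \<open>S\<close>, where the left limit sees it.\<close>
  have less: "s (Suc j) < s (Suc (Suc j))" for j
  proof -
    have "s (Suc j) \<le> s (Suc (Suc j))" using inc by (simp add: incseq_def)
    moreover have "s (Suc j) \<noteq> s (Suc (Suc j))" using d[of j] d[of "Suc j"] a by (cases "even j") auto
    ultimately show ?thesis by simp
  qed
  have bnd: "s j \<le> max u 0" for j
    using le[rule_format, of j] s[of j] by (cases "u \<ge> 0") (auto simp: ennreal_le_iff max_def ennreal_neg)
  obtain S where S: "s \<longlonglongrightarrow> S" "\<And>j. s j \<le> S" using incseq_convergent[OF inc, of "max u 0"] bnd by blast
  have lt: "s (Suc j) < S" for j using less[of j] S(2)[of "Suc (Suc j)"] by simp
  then have S0: "S > 0" using s(2)[of "Suc 0"] by (meson le_less_trans)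
  obtain l where l: "limitin cem_top (\<lambda>s. X s \<omega>) l (at_left S)" using left_limit[OF w S0 alive] S0 by auto
  obtain K where "compact K" "\<And>s. 0 < s \<Longrightarrow> s < S \<Longrightarrow> X s \<omega> \<in> Some ` K" using K[of S] S0 by auto
  then have "l \<noteq> None" using limitin_not_None[OF l S0] by blast
  then obtain m where m: "l = Some m" by auto
  have "eventually (\<lambda>s. X s \<omega> \<in> Some ` ball m (a / 3)) (at_left S)"
    using limitin_cem_Some[OF l[unfolded m], of "ball m (a/3)"] a by simp
  then obtain b where b: "b < S" "\<And>s. b < s \<Longrightarrow> s < S \<Longrightarrow> X s \<omega> \<in> Some ` ball m (a / 3)"
    unfolding eventually_at_left_field by blast
  obtain N where N: "\<And>j. j \<ge> N \<Longrightarrow> b < s j"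
    using order_tendstoD(1)[OF S(1) b(1)] by (auto simp: eventually_sequentially)
  have cl: "dist m (the (X (s (Suc j)) \<omega>)) < a / 3" if "j \<ge> N" for j
  proof -
    have "X (s (Suc j)) \<omega> \<in> Some ` ball m (a / 3)" using b(2) N[of "Suc j"] lt[of j] that by simp
    then show ?thesis by auto
  qed
  have "dist q (the (X (s (Suc (2*N))) \<omega>)) \<le> a" "dist q (the (X (s (Suc (Suc (2*N)))) \<omega>)) \<ge> 2 * a"
    using d[of "2*N"] d[of "Suc (2*N)"] by auto
  moreover have "dist m (the (X (s (Suc (2*N))) \<omega>)) < a / 3" "dist m (the (X (s (Suc (Suc (2*N)))) \<omega>)) < a / 3"
    using cl[of "2*N"] cl[of "Suc (2*N)"] by auto
  ultimately show False
    using dist_triangle[of q m "the (X (s (Suc (2*N))) \<omega>)"] 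
      dist_triangle[of q "the (X (s (Suc (Suc (2*N)))) \<omega>)" m] a by (simp add: dist_commute)
qed

text \<open>The complement of \<open>crossing_unbounded\<close>: a path that oscillates at
  \<open>\<zeta>\<close> completes all its crossings strictly before \<open>\<zeta>\<close>.\<close>

lemma crossing_before:
  assumes "\<And>b. b < \<zeta> \<Longrightarrow> \<exists>s. 0 < s \<and> b < s \<and> s < \<zeta> \<and> X s \<omega> \<in> Some ` ball q a"
    "\<And>b. b < \<zeta> \<Longrightarrow> \<exists>s. 0 < s \<and> b < s \<and> s < \<zeta> \<and> X s \<omega> \<in> Some ` {w. dist q w > 2 * a}" and "\<zeta> > 0"
  shows "crossing q a j \<omega> < ennreal \<zeta>"
proof (induction j)
  case 0 then show ?case using assms by simp
next
  case (Suc j)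
  define b where "b = enn2real (crossing q a j \<omega>)"
  have "crossing q a j \<omega> < \<top>" using Suc by (rule less_trans) simp
  then have b: "crossing q a j \<omega> = ennreal b" "b \<ge> 0" by (auto simp: b_def)
  then have "b < \<zeta>" using Suc by (simp add: ennreal_less_iff)
  then obtain s where s: "0 < s" "b < s" "s < \<zeta>" "X s \<omega> \<in> (if even j then Some ` ball q a else Some ` {w. dist q w > 2 * a})"
    using assms(1,2)[of b] by (cases "even j") auto
  then show ?case using b by (auto simp: hit_after_less ennreal_less_iff simp del: ball_eq_ball_iff intro!: exI[of _ s] split: if_splits)
qed

lemma left_lim_eq: "limitin cem_top (\<lambda>r. X r \<omega>) (Some l) (at_left s) \<Longrightarrow> left_lim X s \<omega> = Some l"
  unfolding left_lim_def using limitin_cem_unique[OF lc _ _ trivial_limit_at_left_real]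
  by (auto intro!: the_equality)

lemma jump_sum_ge_1:
  assumes "limitin cem_top (\<lambda>r. X r \<omega>) (Some l) (at_left s)" "0 < s" "s \<le> t" "G l (X s \<omega>) = 1"
  shows "1 \<le> jump_sum X G t \<omega>"
  unfolding jump_sum_def
  by (rule SUP_upper2[of "{s}"]) (use assms left_lim_eq in auto)

end

section \<open>Conservativeness and big jumps\<close>

context stable_like_process begin

lemma J_le:
  assumes "far x r" shows "emeasure (J x) (- (Some ` ball x r)) \<le> ennreal (C3 * C / \<phi> r)"
proof -
  have r: "\<phi> r > 0" using phi_pos far_gt_1[OF assms] by simp
  have "emeasure (J x) (- (Some ` ball x r)) \<le> ennreal C3 / Etau P X x r"
    using B3 assms by (simp add: far_def)
  also have "\<dots> \<le> ennreal C3 / ennreal (\<phi> r / C)"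
  proof (cases "Etau P X x r")
    case (real e)
    have a: "0 < \<phi> r / C" using r params by simp
    have b: "\<phi> r / C \<le> e" using Etau_bounds(1)[OF assms] real by (simp add: ennreal_le_iff)
    have e: "e > 0" using a b by linarith
    have "C3 / e \<le> C3 / (\<phi> r / C)"
      by (intro divide_left_mono b mult_pos_pos e a) (use params in simp)
    moreover have "ennreal C3 / Etau P X x r = ennreal (C3 / e)"
      using real e params divide_ennreal[of C3 e] by simp
    moreover have "ennreal C3 / ennreal (\<phi> r / C) = ennreal (C3 / (\<phi> r / C))"
      by (rule divide_ennreal) (use r params in auto)
    ultimately show ?thesis by (simp only: ennreal_leI)
  qed simp
  also have "\<dots> = ennreal (C3 * C / \<phi> r)"
    using r params by (subst divide_ennreal) auto
  finally show ?thesis .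
qed

lemma sets_J [measurable_cong]: "sets (J x) = sets cemB"
  using levy by (simp add: levy_system_def)

lemma levy_formula:
  assumes "G \<in> borel_measurable (borel \<Otimes>\<^sub>M cemB)" "t > 0" "\<And>x. G (x, Some x) = 0"
  shows "(\<integral>\<^sup>+ \<omega>. jump_sum X (\<lambda>x y. G (x, y)) t \<omega> \<partial>P (Some z)) =
        (\<integral>\<^sup>+ \<omega>. (\<integral>\<^sup>+ s. indicator {0..t} s *
            (case X s \<omega> of None \<Rightarrow> 0 | Some x \<Rightarrow> \<integral>\<^sup>+ y. G (x, y) \<partial>J x) \<partial>lborel) \<partial>P (Some z))"
  using levy assms unfolding levy_system_def by blast

text \<open>\<open>None\<close> lies outside every ball, so (B3) bounds this mass by
  \<open>C3 * C / \<phi> r\<close> for all large \<open>r\<close>.\<close>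

lemma J_None: "emeasure (J x) {None} = 0"
proof -
  have le: "emeasure (J x) {None} \<le> 0 + ennreal e" if e: "e > 0" for e
  proof -
    have "eventually (\<lambda>r. C3 * C / e \<le> \<phi> r) at_top" using phi_at_top by (simp add: filterlim_at_top)
    then have "eventually (\<lambda>r. C3 * C / e \<le> \<phi> r \<and> far x r) at_top"
      using eventually_far eventually_conj by blast
    then obtain r where r: "C3 * C / e \<le> \<phi> r" "far x r" 
      using eventually_happens' trivial_limit_at_top_linorder by blast
    have "- (Some ` ball x r) \<in> sets (J x)"
      unfolding sets_J using openin_sets_cemB[OF openin_cem_Some[OF open_ball]] sets.compl_sets
      by (metis Compl_eq_Diff_UNIV space_cemB)
    then have "emeasure (J x) {None} \<le> emeasure (J x) (- (Some ` ball x r))"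
      by (intro emeasure_mono) auto
    also have "\<dots> \<le> ennreal (C3 * C / \<phi> r)" by (rule J_le[OF r(2)])
    also have "\<dots> \<le> ennreal e"
      using r(1) e phi_pos far_gt_1[OF r(2)] by (intro ennreal_leI) (simp add: field_simps)
    finally show ?thesis by simp
  qed
  have "emeasure (J x) {None} \<le> 0" by (rule ennreal_le_epsilon) (rule le)
  then show ?thesis by simp
qed

lemma AE_space_Omega: "AE \<omega> in P z. \<omega> \<in> \<Omega>" 
  using AE_space[of "P z"] by (simp add: space_P[of z])

text \<open>A left limit in M at death can fail in two ways: the path leaves every
  \<open>K j\<close> before death, or it stays in one of them and oscillates. Either way an
  increasing sequence of exit or crossing times precedes death and remains below an integer bound,
  which \<open>no_announced_death\<close> forbids for each of countably many sequences and
  bounds.\<close>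

lemma death_left_limit:
  "AE \<omega> in P (Some y). \<forall>t>0. X t \<omega> = None \<longrightarrow>
     (\<exists>s l. 0 < s \<and> s \<le> t \<and> X s \<omega> = None \<and> limitin cem_top (\<lambda>r. X r \<omega>) (Some l) (at_left s))"
proof -
  obtain K :: "nat \<Rightarrow> 'a set" where K: "\<And>n. compact (K n)" "incseq K" "(\<Union>n. interior (K n)) = UNIV"
    by (rule compact_exhaustion[OF lc]) (rule that)
  obtain D :: "'a set" where D: "countable D" "\<And>U. open U \<Longrightarrow> U \<noteq> {} \<Longrightarrow> \<exists>d\<in>D. d \<in> U"
    by (rule countable_dense) (rule that)
  define alive_after where "alive_after S \<omega> \<longleftrightarrow> (\<exists>q>0. S \<omega> < ennreal q \<and> X q \<omega> \<noteq> None)" for S :: "'w \<Rightarrow> ennreal" and \<omega>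
  note comp = path_in_compact[OF K, of "Some y"]
  have ae1: "AE \<omega> in P (Some y). \<forall>u::nat. \<not> (\<forall>j. exit_time X (K j) \<omega> \<le> ennreal (real (Suc u)) \<and> alive_after (exit_time X (K j)) \<omega>)"
    unfolding AE_all_countable alive_after_def
  proof (rule allI, rule no_announced_death)
    fix u :: nat
    show "optional_time (exit_time X (K j))" for j using K by (intro optional_time_exit compact_imp_closed)
    show "incseq (\<lambda>j. exit_time X (K j) \<omega>)" for \<omega>
      using K(2) by (auto simp: incseq_def intro: exit_time_mono)
    show "AE \<omega> in P (Some y). \<omega> \<in> immortal \<longrightarrow> \<not> (\<forall>j. exit_time X (K j) \<omega> \<le> ennreal (real (Suc u)))"
      using comp
    proof eventually_elim
      case (elim \<omega>)
      show ?case using elim[rule_format, of "real (Suc u)"] immortalD[of "real (Suc u)" \<omega>] by (auto simp: not_le)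
    qed
  qed simp
  have ae2: "AE \<omega> in P (Some y). \<forall>q\<in>D. \<forall>a\<in>\<rat> \<inter> {0<..}. \<forall>u::nat. \<not> (\<forall>j. crossing q a j \<omega> \<le> ennreal (real (Suc u)) \<and> alive_after (crossing q a j) \<omega>)"
    unfolding AE_all_countable AE_ball_countable[OF D(1)] AE_ball_countable[OF countable_Int1[OF countable_rat]] alive_after_def
  proof (intro allI ballI, rule no_announced_death)
    fix q :: 'a and a :: real and u :: nat assume a: "a \<in> \<rat> \<inter> {0<..}"
    show "optional_time (crossing q a j)" for j by (rule optional_time_crossing)
    show "incseq (\<lambda>j. crossing q a j \<omega>)" for \<omega> by (rule incseq_crossing)
    show "AE \<omega> in P (Some y). \<omega> \<in> immortal \<longrightarrow> \<not> (\<forall>j. crossing q a j \<omega> \<le> ennreal (real (Suc u)))"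
      using comp AE_space_Omega
    proof eventually_elim
      case (elim \<omega>)
      show ?case
      proof
        assume im: "\<omega> \<in> immortal"
        show "\<not> (\<forall>j. crossing q a j \<omega> \<le> ennreal (real (Suc u)))"
        proof (rule crossing_unbounded[OF elim(2)])
          show "X t \<omega> \<noteq> None" if "t \<ge> 0" for t using immortalD[OF that im] .
          show "\<exists>K. compact K \<and> (\<forall>s. 0 < s \<and> s \<le> t \<longrightarrow> X s \<omega> \<in> Some ` K)" if t: "t \<ge> 0" for t
          proof -
            obtain n where "ennreal t < exit_time X (K n) \<omega>" using elim(1) t immortalD[OF t im] by blast
            then show ?thesis using exit_time_gt K(1) by blast
          qed
          show "a > 0" using a by simp
        qed
      qed
    qed
  qed simp
  show ?thesis using ae1 ae2 AE_space_Omega X_0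
  proof eventually_elim
    case (elim \<omega>)
    note w = elim(3)
    show ?case
    proof (intro allI impI)
      fix t :: real assume t: "t > 0" "X t \<omega> = None"
      define \<zeta> where "\<zeta> = Inf {s. 0 \<le> s \<and> X s \<omega> = None}"
      have bb: "bdd_below {s. 0 \<le> s \<and> X s \<omega> = None}" by (rule bdd_belowI[of _ 0]) auto
      have ne: "{s. 0 \<le> s \<and> X s \<omega> = None} \<noteq> {}" using t by (auto intro: less_imp_le)
      have before: "X s \<omega> \<noteq> None" if "0 \<le> s" "s < \<zeta>" for s
        using cInf_lower[OF _ bb, of s] that by (auto simp: \<zeta>_def)
      have \<zeta>t: "\<zeta> \<le> t" unfolding \<zeta>_def using t by (intro cInf_lower bb) auto
      have \<zeta>0: "\<zeta> \<ge> 0" unfolding \<zeta>_def using ne by (intro cInf_greatest) auto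
      have op: "open (Some -` (- {None :: 'a option}))" by (auto simp: vimage_def)
      \<comment> \<open>The infimum is attained, because a living path stays alive for a
        while.\<close>
      have \<zeta>N: "X \<zeta> \<omega> = None"
      proof (rule ccontr)
        assume "X \<zeta> \<omega> \<noteq> None"
        then have "X \<zeta> \<omega> \<in> - {None}" by simp
        then obtain \<delta> where d: "\<delta> > 0" "\<And>s'. \<zeta> \<le> s' \<Longrightarrow> s' < \<zeta> + \<delta> \<Longrightarrow> X s' \<omega> \<in> - {None}"
          using right_stable[OF w \<zeta>0 _ op] by blast
        have "\<zeta> < \<zeta> + \<delta>" using d by simp
        then obtain s where s: "0 \<le> s" "X s \<omega> = None" "s < \<zeta> + \<delta>"
          using cInf_lessD[OF ne, of "\<zeta> + \<delta>"] by (auto simp: \<zeta>_def)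
        have "\<zeta> \<le> s" unfolding \<zeta>_def using s by (intro cInf_lower bb) auto
        then show False using d(2)[of s] s by simp
      qed
      then have \<zeta>0: "\<zeta> > 0" using \<zeta>0 elim(4) by (cases "\<zeta> = 0") auto
      obtain u :: nat where u: "\<zeta> \<le> real (Suc u)"
        using real_arch_simple[of \<zeta>] by (metis le_Suc_eq of_nat_le_iff order_trans order_refl)
      have alive: "alive_after S \<omega>" if S: "S \<omega> < ennreal \<zeta>" for S
      proof -
        have "S \<omega> < \<top>" using S by (rule less_trans) simp
        then obtain h where h: "S \<omega> = ennreal h" "h \<ge> 0" by (cases "S \<omega>") auto
        have hz: "h < \<zeta>" using S h by (simp add: ennreal_less_iff)
        show ?thesis unfolding alive_after_def
          by (rule exI[of _ "(h + \<zeta>) / 2"]) (use h hz before[of "(h + \<zeta>) / 2"] \<zeta>0 in \<open>auto simp: ennreal_less_iff\<close>)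
      qed
      \<comment> \<open>Some exit time does not precede death, so up to death the path stays in this
        \<open>K j\<close>.\<close>
      obtain j where j: "\<not> (exit_time X (K j) \<omega> \<le> ennreal (real (Suc u)) \<and> alive_after (exit_time X (K j)) \<omega>)"
        using elim(1) by blast
      have "exit_time X (K j) \<omega> \<le> ennreal \<zeta>"
        unfolding exit_time_def using \<zeta>0 \<zeta>N by (intro Inf_lower) auto
      also have "\<dots> \<le> ennreal (real (Suc u))" using u by (rule ennreal_leI)
      finally have "\<not> alive_after (exit_time X (K j)) \<omega>" using j by simp
      then have ex: "\<not> exit_time X (K j) \<omega> < ennreal \<zeta>" using alive by blast
      have XK: "X s \<omega> \<in> Some ` K j" if "0 < s" "s < \<zeta>" for s
      proof (rule exit_time_gt[OF _ that(1) order_refl])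
        have "ennreal s < ennreal \<zeta>" using that by (simp add: ennreal_less_iff)
        then show "ennreal s < exit_time X (K j) \<omega>" using ex by (simp add: not_less)
      qed
      have fK: "the (X s \<omega>) \<in> K j" and fS: "X s \<omega> = Some (the (X s \<omega>))" if "0 < s" "s < \<zeta>" for s
        using XK[OF that] by auto
      \<comment> \<open>Otherwise, for some \<open>q\<close> and \<open>a\<close>, all crossings
        precede death, against the second exceptional set.\<close>
      have "\<exists>l. ((\<lambda>s. the (X s \<omega>)) \<longlongrightarrow> l) (at_left \<zeta>)"
      proof (rule ccontr)
        assume "\<not> (\<exists>l. ((\<lambda>s. the (X s \<omega>)) \<longlongrightarrow> l) (at_left \<zeta>))"
        then have nolim: "\<not> ((\<lambda>s. the (X s \<omega>)) \<longlongrightarrow> l) (at_left \<zeta>)" for l by blast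
        obtain q a where qa: "q \<in> D" "a \<in> \<rat>" "a > 0"
          "\<And>b. b < \<zeta> \<Longrightarrow> \<exists>s. 0 < s \<and> b < s \<and> s < \<zeta> \<and> dist q (the (X s \<omega>)) < a"
          "\<And>b. b < \<zeta> \<Longrightarrow> \<exists>s. 0 < s \<and> b < s \<and> s < \<zeta> \<and> dist q (the (X s \<omega>)) > 2 * a"
          by (rule oscillation[where f = "\<lambda>s. the (X s \<omega>)", OF K(1)[of j] _ \<zeta>0 _ nolim]) (erule (1) fK, erule (1) D(2), rule that)
        have less: "crossing q a i \<omega> < ennreal \<zeta>" for i
        proof (rule crossing_before[OF _ _ \<zeta>0])
          fix b assume b: "b < \<zeta>"
          obtain s where s: "0 < s" "b < s" "s < \<zeta>" "dist q (the (X s \<omega>)) < a" using qa(4)[OF b] by blast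
          show "\<exists>s>0. b < s \<and> s < \<zeta> \<and> X s \<omega> \<in> Some ` ball q a"
            by (rule exI[of _ s]) (use s fS[OF s(1,3)] in \<open>auto intro!: image_eqI[of _ _ "the (X s \<omega>)"]\<close>)
          obtain s where s: "0 < s" "b < s" "s < \<zeta>" "dist q (the (X s \<omega>)) > 2 * a" using qa(5)[OF b] by blast
          show "\<exists>s>0. b < s \<and> s < \<zeta> \<and> X s \<omega> \<in> Some ` {w. 2 * a < dist q w}"
            by (rule exI[of _ s]) (use s fS[OF s(1,3)] in \<open>auto intro!: image_eqI[of _ _ "the (X s \<omega>)"]\<close>)
        qed
        have "crossing q a i \<omega> \<le> ennreal (real (Suc u))" for i
          using less[of i] ennreal_leI[OF u] by (meson less_imp_le order_trans)
        moreover have "alive_after (crossing q a i) \<omega>" for i using alive less by blast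
        moreover have "a \<in> \<rat> \<inter> {0<..}" using qa by simp
        ultimately show False using elim(2) qa(1) by blast
      qed
      then obtain l where l: "((\<lambda>s. the (X s \<omega>)) \<longlongrightarrow> l) (at_left \<zeta>)" by blast
      have "limitin cem_top (\<lambda>r. X r \<omega>) (Some l) (at_left \<zeta>)"
        unfolding limitin_def
      proof (intro conjI allI impI)
        fix U :: "'a option set" assume U: "openin cem_top U \<and> Some l \<in> U"
        then have "open (Some -` U)" "l \<in> Some -` U" by (auto simp: openin_cem_top)
        then have "eventually (\<lambda>s. the (X s \<omega>) \<in> Some -` U) (at_left \<zeta>)" by (rule topological_tendstoD[OF l])
        moreover have "eventually (\<lambda>s. 0 < s \<and> s < \<zeta>) (at_left \<zeta>)"
          using \<zeta>0 by (auto simp: eventually_at_left_field)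
        ultimately show "eventually (\<lambda>s. X s \<omega> \<in> U) (at_left \<zeta>)"
          by eventually_elim (use fS in auto)
      qed simp
      then show "\<exists>s l. 0 < s \<and> s \<le> t \<and> X s \<omega> = None \<and> limitin cem_top (\<lambda>r. X r \<omega>) (Some l) (at_left s)"
        using \<zeta>0 \<zeta>t \<zeta>N by blast
    qed
  qed
qed

text \<open>By \<open>death_left_limit\<close> a death by time \<open>n\<close> is a jump from M to
  \<open>None\<close>. Its probability is at most the expected number of such jumps, which the Levy
  system expresses through \<open>J x {None} = 0\<close>.\<close>

lemma immortal_AE: "AE \<omega> in P (Some y). \<omega> \<in> immortal"
proof -
  define G :: "'a \<times> 'a option \<Rightarrow> ennreal" where "G = (\<lambda>(x, z). indicator {None} z)"
  have G: "G \<in> borel_measurable (borel \<Otimes>\<^sub>M cemB)" unfolding G_def by measurable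
  have "AE \<omega> in P (Some y). X (real n) \<omega> \<noteq> None" for n :: nat
  proof (cases "n = 0")
    case True then show ?thesis using X_0[of "Some y"] by auto
  next
    case False
    define A where "A = {\<omega>\<in>\<Omega>. \<not> X (real n) \<omega> \<noteq> None}"
    have A: "A \<in> sets (P (Some y))" unfolding A_def 
      using alive_sets[of "real n" "Some y"] sets.sets_Collect_neg[of "P (Some y)" "\<lambda>\<omega>. X (real n) \<omega> \<noteq> None"]
      by (simp add: space_P[of "Some y"])
    have "emeasure (P (Some y)) A = (\<integral>\<^sup>+ \<omega>. indicator A \<omega> \<partial>P (Some y))" using A by simp
    also have "\<dots> \<le> (\<integral>\<^sup>+ \<omega>. jump_sum X (\<lambda>x y. G (x, y)) (real n) \<omega> \<partial>P (Some y))"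
    proof (rule nn_integral_mono_AE)
      show "AE \<omega> in P (Some y). indicator A \<omega> \<le> jump_sum X (\<lambda>x y. G (x, y)) (real n) \<omega>"
        using death_left_limit
      proof eventually_elim
        case (elim \<omega>)
        show ?case
        proof (cases "\<omega> \<in> A")
          case True
          then obtain s l where s: "0 < s" "s \<le> real n" "X s \<omega> = None" "limitin cem_top (\<lambda>r. X r \<omega>) (Some l) (at_left s)"
            using elim False unfolding A_def by (auto dest!: spec[of _ "real n"])
          have "1 \<le> jump_sum X (\<lambda>x y. G (x, y)) (real n) \<omega>"
            by (rule jump_sum_ge_1[OF s(4,1,2)]) (simp add: G_def s)
          then show ?thesis using True by simp
        qed simp
      qed
    qed
    also have "\<dots> = (\<integral>\<^sup>+ \<omega>. (\<integral>\<^sup>+ s. indicator {0..real n} s *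
            (case X s \<omega> of None \<Rightarrow> 0 | Some x \<Rightarrow> \<integral>\<^sup>+ y. G (x, y) \<partial>J x) \<partial>lborel) \<partial>P (Some y))"
      by (rule levy_formula[OF G]) (use False in \<open>auto simp: G_def\<close>)
    also have "\<dots> = 0"
    proof -
      have "(\<integral>\<^sup>+ z. G (x, z) \<partial>J x) = 0" for x
        unfolding G_def using J_None[of x] by (simp add: sets_J)
      then have "(case X s \<omega> of None \<Rightarrow> 0 | Some x \<Rightarrow> \<integral>\<^sup>+ y. G (x, y) \<partial>J x) = 0" for s \<omega>
        by (auto split: option.split)
      then show ?thesis by simp
    qed
    finally have "A \<in> null_sets (P (Some y))" using A by auto
    then have "AE \<omega> in P (Some y). \<omega> \<notin> A" by (rule AE_not_in)
    then show ?thesis using AE_space_Omega by eventually_elim (simp add: A_def)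
  qed
  then have "AE \<omega> in P (Some y). \<forall>n::nat. X (real n) \<omega> \<noteq> None" by (simp add: AE_all_countable)
  then show ?thesis using AE_space_Omega by eventually_elim (simp add: immortal_def)
qed

text \<open>Up to \<open>t\<close> the living path runs inside a compact set, so its left limit
  there cannot be \<open>None\<close>.\<close>

lemma left_limits_AE:
  "AE \<omega> in P (Some y). \<forall>t>0. \<exists>l. limitin cem_top (\<lambda>r. X r \<omega>) (Some l) (at_left t)"
proof -
  obtain K :: "nat \<Rightarrow> 'a set" where K: "\<And>n. compact (K n)" "incseq K" "(\<Union>n. interior (K n)) = UNIV"
    by (rule compact_exhaustion[OF lc]) (rule that)
  show ?thesis using path_in_compact[OF K, of "Some y"] immortal_AE AE_space_Omega
  proof eventually_elim
    case (elim \<omega>)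
    show ?case
    proof (intro allI impI)
      fix t :: real assume t: "t > 0"
      have al: "X t \<omega> \<noteq> None" using immortalD[OF _ elim(2)] t by simp
      obtain l where l: "limitin cem_top (\<lambda>s. X s \<omega>) l (at_left t)" using left_limit[OF elim(3) t al] ..
      obtain n where n: "ennreal t < exit_time X (K n) \<omega>" using elim(1) al t by (meson less_imp_le)
      have "l \<noteq> None"
        by (rule limitin_not_None[OF l t K(1)[of n]]) (use exit_time_gt[OF n] in auto)
      then show "\<exists>l. limitin cem_top (\<lambda>r. X r \<omega>) (Some l) (at_left t)" using l by auto
    qed
  qed
qed

text \<open>The expected number of jumps of size at least \<open>\<rho>\<close> bounds the
  probability, and such jumps occur at rate at most \<open>C3 * C / \<phi> \<rho>\<close>. Only
  jumps that start in \<open>cball y r\<close> are counted, since (B3) is available there.\<close>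

lemma big_jump_bound:
  assumes far: "\<And>x. x \<in> cball y r \<Longrightarrow> far x \<rho>" and t: "t > 0" and A: "A \<in> sets (P (Some y))"
    and jump: "AE \<omega> in P (Some y). \<omega> \<in> A \<longrightarrow> (\<exists>s l. 0 < s \<and> s \<le> t \<and> l \<in> cball y r \<and> X s \<omega> \<notin> Some ` ball l \<rho> \<and>
        limitin cem_top (\<lambda>r. X r \<omega>) (Some l) (at_left s))" and \<rho>: "\<rho> > 0"
  shows "emeasure (P (Some y)) A \<le> ennreal (t * (C3 * C / \<phi> \<rho>))"
proof -
  interpret prob_space "P (Some y)" by (rule prob_P)
  \<comment> \<open>Phrased with \<open>the\<close> to be visibly measurable on the product. It
    means that \<open>z\<close> lies outside \<open>ball x \<rho>\<close>, where \<open>None\<close>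
    counts as outside.\<close>
  define H where "H = (\<lambda>(x, z). x \<in> cball y r \<and> (z = None \<or> \<rho> \<le> dist x (the z)))"
  define G :: "'a \<times> 'a option \<Rightarrow> ennreal" where "G = (\<lambda>p. if H p then 1 else 0)"
  have H: "H (x, z) \<longleftrightarrow> x \<in> cball y r \<and> z \<notin> Some ` ball x \<rho>" for x z
    unfolding H_def by (cases z) auto
  have [measurable]: "Measurable.pred cemB (\<lambda>z::'a option. z = None)"
    using None_sets_cemB by (simp add: pred_def)
  have G: "G \<in> borel_measurable (borel \<Otimes>\<^sub>M cemB)" 
    unfolding G_def H_def mem_cball by measurable
  have "emeasure (P (Some y)) A = (\<integral>\<^sup>+ \<omega>. indicator A \<omega> \<partial>P (Some y))" using A by simp
  also have "\<dots> \<le> (\<integral>\<^sup>+ \<omega>. jump_sum X (\<lambda>x y. G (x, y)) t \<omega> \<partial>P (Some y))"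
  proof (rule nn_integral_mono_AE)
    show "AE \<omega> in P (Some y). indicator A \<omega> \<le> jump_sum X (\<lambda>x y. G (x, y)) t \<omega>"
      using jump
    proof eventually_elim
      case (elim \<omega>)
      show ?case
      proof (cases "\<omega> \<in> A")
        case True
        then obtain s l where s: "0 < s" "s \<le> t" "l \<in> cball y r" "X s \<omega> \<notin> Some ` ball l \<rho>"
          "limitin cem_top (\<lambda>r. X r \<omega>) (Some l) (at_left s)"
          using elim by blast
        have "H (l, X s \<omega>)" using H s by blast
        then have "1 \<le> jump_sum X (\<lambda>x y. G (x, y)) t \<omega>"
          by (intro jump_sum_ge_1[OF s(5,1,2)]) (simp add: G_def)
        then show ?thesis using True by simp
      qed simp
    qed
  qed
  also have "\<dots> = (\<integral>\<^sup>+ \<omega>. (\<integral>\<^sup>+ s. indicator {0..t} s *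
          (case X s \<omega> of None \<Rightarrow> 0 | Some x \<Rightarrow> \<integral>\<^sup>+ y. G (x, y) \<partial>J x) \<partial>lborel) \<partial>P (Some y))"
    by (rule levy_formula[OF G t]) (use \<rho> H in \<open>auto simp: G_def\<close>)
  also have "\<dots> \<le> (\<integral>\<^sup>+ \<omega>. (\<integral>\<^sup>+ s. ennreal (C3 * C / \<phi> \<rho>) * indicator {0..t} s \<partial>lborel) \<partial>P (Some y))"
  proof (intro nn_integral_mono)
    fix \<omega> s
    have "(\<integral>\<^sup>+ z. G (x, z) \<partial>J x) \<le> ennreal (C3 * C / \<phi> \<rho>)" for x
    proof (cases "x \<in> cball y r")
      case True
      have m: "- (Some ` ball x \<rho>) \<in> sets (J x)"
        unfolding sets_J using openin_sets_cemB[OF openin_cem_Some[OF open_ball]] sets.compl_sets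
        by (metis Compl_eq_Diff_UNIV space_cemB)
      have "(\<integral>\<^sup>+ z. G (x, z) \<partial>J x) \<le> (\<integral>\<^sup>+ z. indicator (- (Some ` ball x \<rho>)) z \<partial>J x)"
        by (intro nn_integral_mono) (use H in \<open>auto simp: G_def indicator_def\<close>)
      also have "\<dots> = emeasure (J x) (- (Some ` ball x \<rho>))" using m by simp
      also have "\<dots> \<le> ennreal (C3 * C / \<phi> \<rho>)" by (rule J_le[OF far[OF True]])
      finally show ?thesis .
    next
      case False
      then have "G (x, z) = 0" for z using H by (simp add: G_def)
      then show ?thesis by simp
    qed
    then have "(case X s \<omega> of None \<Rightarrow> 0 | Some x \<Rightarrow> \<integral>\<^sup>+ y. G (x, y) \<partial>J x) \<le> ennreal (C3 * C / \<phi> \<rho>)"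
      by (auto split: option.split)
    then show "indicator {0..t} s * (case X s \<omega> of None \<Rightarrow> 0 | Some x \<Rightarrow> \<integral>\<^sup>+ y. G (x, y) \<partial>J x)
       \<le> ennreal (C3 * C / \<phi> \<rho>) * indicator {0..t} s"
      by (auto simp: indicator_def)
  qed
  also have "\<dots> = ennreal (t * (C3 * C / \<phi> \<rho>))"
  proof -
    have "(\<integral>\<^sup>+ s. ennreal (C3 * C / \<phi> \<rho>) * indicator {0..t} s \<partial>lborel) = ennreal (C3 * C / \<phi> \<rho>) * ennreal t"
      using t by (subst nn_integral_cmult_indicator) auto
    also have "\<dots> = ennreal (t * (C3 * C / \<phi> \<rho>))"
      using t params phi_pos[OF \<rho>] by (subst ennreal_mult[symmetric]) (auto simp: mult.commute)
    finally show ?thesis by (simp add: emeasure_space_1)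
  qed
  finally show ?thesis .
qed

end

section \<open>Exit times from balls\<close>

context standard_process begin

lemma stopped_sigma_Int:
  assumes S: "optional_time S" and A: "A \<in> stopped_sigma (P None) F S" and B: "B \<in> stopped_sigma (P None) F S"
  shows "A \<inter> B \<in> stopped_sigma (P None) F S"
  unfolding stopped_sigma_def
proof (intro CollectI conjI allI impI)
  show "A \<inter> B \<in> sets (P None)" using A B by (auto simp: stopped_sigma_def)
  fix t :: real assume t: "t \<ge> 0"
  interpret sigma_algebra \<Omega> "F t" by (rule F_sigma[OF t])
  have "A \<inter> {\<omega>\<in>\<Omega>. S \<omega> \<le> ennreal t} \<in> F t" "B \<inter> {\<omega>\<in>\<Omega>. S \<omega> \<le> ennreal t} \<in> F t"
    using A B t by (auto simp: stopped_sigma_def)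
  then have "(A \<inter> {\<omega>\<in>\<Omega>. S \<omega> \<le> ennreal t}) \<inter> (B \<inter> {\<omega>\<in>\<Omega>. S \<omega> \<le> ennreal t}) \<in> F t" by (rule Int)
  then show "A \<inter> B \<inter> {\<omega>\<in>\<Omega>. S \<omega> \<le> ennreal t} \<in> F t" by (simp add: Int_ac)
qed

lemma stopped_sigma_less_const:
  assumes S: "optional_time S" and t: "t > 0"
  shows "{\<omega>\<in>\<Omega>. S \<omega> < ennreal t} \<in> stopped_sigma (P None) F S"
  unfolding stopped_sigma_def
proof (intro CollectI conjI allI impI)
  show "{\<omega>\<in>\<Omega>. S \<omega> < ennreal t} \<in> sets (P None)" by (rule optional_time_sets[OF S t])
  fix u :: real assume u: "u \<ge> 0"
  interpret sigma_algebra \<Omega> "F u" by (rule F_sigma[OF u])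
  show "{\<omega>\<in>\<Omega>. S \<omega> < ennreal t} \<inter> {\<omega>\<in>\<Omega>. S \<omega> \<le> ennreal u} \<in> F u"
  proof (cases "u < t")
    case True
    then have "{\<omega>\<in>\<Omega>. S \<omega> < ennreal t} \<inter> {\<omega>\<in>\<Omega>. S \<omega> \<le> ennreal u} = {\<omega>\<in>\<Omega>. S \<omega> \<le> ennreal u}"
      using u by (auto intro: le_less_trans simp: ennreal_less_iff)
    then show ?thesis using optional_time_le[OF S u] by simp
  next
    case False
    then show ?thesis using optional_timeD[OF S t, of u] optional_time_le[OF S u order_refl] by (intro Int) auto
  qed
qed

text \<open>On \<open>U \<le> u\<close> also \<open>S \<le> u\<close>, so \<open>S < T\<close> holds
  iff \<open>T > u\<close> or some rational \<open>q \<le> u\<close> separates \<open>S\<close> from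
  \<open>T\<close>; both are events of \<open>F u\<close>. \<open>T\<close> itself may exceed
  \<open>U\<close>.\<close>

lemma stopped_sigma_less:
  assumes S: "optional_time S" and T: "optional_time T" and U: "optional_time U" and SU: "\<And>\<omega>. S \<omega> \<le> U \<omega>"
  shows "{\<omega>\<in>\<Omega>. S \<omega> < T \<omega>} \<in> stopped_sigma (P None) F U"
  unfolding stopped_sigma_def
proof (intro CollectI conjI allI impI)
  have bet: "(\<exists>q\<in>{0..} \<inter> \<rat>. x \<le> ennreal q \<and> ennreal q < y) \<longleftrightarrow> x < y" for x y
  proof
    assume "x < y"
    then obtain r where r: "x < ennreal r" "ennreal r < y" "0 < r"
    proof -
      obtain z where z: "x < z" "z < y" using dense \<open>x < y\<close> by blast
      then have "z < \<top>" by (metis less_top not_less_iff_gr_or_eq order.strict_trans top.extremum_strict)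
      then obtain r where "z = ennreal r" "r \<ge> 0" by (cases z) auto
      moreover have "r \<noteq> 0" using z calculation by auto
      ultimately show ?thesis using z that[of r] by simp
    qed
    obtain r' where r': "x < ennreal r'" "ennreal r' < ennreal r" "0 \<le> r'"
    proof -
      obtain z where z: "x < z" "z < ennreal r" using dense r(1) by blast
      then obtain r' where "z = ennreal r'" "r' \<ge> 0" by (cases z) auto
      then show ?thesis using z that by blast
    qed
    then have "r' < r" by (simp add: ennreal_less_iff)
    then obtain q where q: "q \<in> \<rat>" "r' < q" "q < r" using Rats_dense_in_real by blast
    have "x \<le> ennreal q" using r' q by (meson ennreal_leI less_imp_le order_trans)
    moreover have "ennreal q < y" using r(2) q r' by (meson ennreal_leI le_less_trans less_imp_le)
    ultimately show "\<exists>q\<in>{0..} \<inter> \<rat>. x \<le> ennreal q \<and> ennreal q < y" using q r' by auto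
  qed auto
  have cnt: "countable ({0..} \<inter> \<rat> :: real set)" by (rule countable_Int2[OF countable_rat])
  have "{\<omega>\<in>\<Omega>. \<exists>q\<in>{0..} \<inter> \<rat>. S \<omega> \<le> ennreal q \<and> \<not> T \<omega> \<le> ennreal q} \<in> sets (P None)"
  proof (intro sets.sets_Collect_countable_Ex' sets.sets_Collect_conj sets.sets_Collect_neg cnt)
    fix q :: real assume "q \<in> {0..} \<inter> \<rat>"
    then have q: "q \<ge> 0" by simp
    show "{\<omega>\<in>\<Omega>. S \<omega> \<le> ennreal q} \<in> sets (P None)" "{\<omega>\<in>\<Omega>. T \<omega> \<le> ennreal q} \<in> sets (P None)"
      using optional_time_le[OF S q order_refl] optional_time_le[OF T q order_refl] F_subset[OF q] by auto
  qed
  then show "{\<omega>\<in>\<Omega>. S \<omega> < T \<omega>} \<in> sets (P None)" by (simp add: not_le bet)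
  fix u :: real assume u: "u \<ge> 0"
  interpret sigma_algebra \<Omega> "F u" by (rule F_sigma[OF u])
  have eq: "S \<omega> < T \<omega> \<and> U \<omega> \<le> ennreal u \<longleftrightarrow>
      U \<omega> \<le> ennreal u \<and> (\<not> T \<omega> \<le> ennreal u \<or> (\<exists>q\<in>{0..} \<inter> \<rat>. q \<le> u \<and> \<not> T \<omega> \<le> ennreal q \<and> S \<omega> \<le> ennreal q))" for \<omega>
  proof (cases "U \<omega> \<le> ennreal u")
    case True
    then have Su: "S \<omega> \<le> ennreal u" using SU order_trans by blast
    have "S \<omega> < T \<omega> \<longleftrightarrow> (\<not> T \<omega> \<le> ennreal u \<or> (\<exists>q\<in>{0..} \<inter> \<rat>. q \<le> u \<and> \<not> T \<omega> \<le> ennreal q \<and> S \<omega> \<le> ennreal q))"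
    proof
      assume "S \<omega> < T \<omega>"
      then obtain q where q: "q \<ge> 0" "q \<in> \<rat>" "S \<omega> \<le> ennreal q" "ennreal q < T \<omega>" using bet by auto
      show "\<not> T \<omega> \<le> ennreal u \<or> (\<exists>q\<in>{0..} \<inter> \<rat>. q \<le> u \<and> \<not> T \<omega> \<le> ennreal q \<and> S \<omega> \<le> ennreal q)"
      proof (cases "T \<omega> \<le> ennreal u")
        case True
        then have "ennreal q < ennreal u" using q(4) by (rule less_le_trans[rotated])
        then have "q \<le> u" using q(1) by (simp add: ennreal_less_iff)
        then show ?thesis using q by (auto simp: not_le)
      qed simp
    next
      assume "\<not> T \<omega> \<le> ennreal u \<or> (\<exists>q\<in>{0..} \<inter> \<rat>. q \<le> u \<and> \<not> T \<omega> \<le> ennreal q \<and> S \<omega> \<le> ennreal q)"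
      then show "S \<omega> < T \<omega>" using Su by (auto simp: not_le)
    qed
    then show ?thesis using True by simp
  qed simp
  have "{\<omega>\<in>\<Omega>. \<exists>q\<in>{0..} \<inter> \<rat>. q \<le> u \<and> \<not> T \<omega> \<le> ennreal q \<and> S \<omega> \<le> ennreal q} \<in> F u"
  proof (rule sets_Collect_countable_Ex'[OF _ cnt])
    fix q :: real assume "q \<in> {0..} \<inter> \<rat>"
    then have q: "q \<ge> 0" by simp
    show "{\<omega>\<in>\<Omega>. q \<le> u \<and> \<not> T \<omega> \<le> ennreal q \<and> S \<omega> \<le> ennreal q} \<in> F u"
    proof (cases "q \<le> u")
      case True
      have "{\<omega>\<in>\<Omega>. \<not> T \<omega> \<le> ennreal q \<and> S \<omega> \<le> ennreal q} \<in> F u"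
        by (intro sets_Collect_conj sets_Collect_neg optional_time_le S T q True)
      then show ?thesis using True by simp
    qed simp
  qed
  from sets_Collect_conj[OF sets_Collect_disj[OF sets_Collect_neg[OF optional_time_le[OF T u order_refl]] this] optional_time_le[OF U u order_refl]]
  have "{\<omega>\<in>\<Omega>. U \<omega> \<le> ennreal u \<and> (\<not> T \<omega> \<le> ennreal u \<or> (\<exists>q\<in>{0..} \<inter> \<rat>. q \<le> u \<and> \<not> T \<omega> \<le> ennreal q \<and> S \<omega> \<le> ennreal q))} \<in> F u"
    by (simp only: disj_commute)
  moreover have "{\<omega>\<in>\<Omega>. S \<omega> < T \<omega>} \<inter> {\<omega>\<in>\<Omega>. U \<omega> \<le> ennreal u} = {\<omega>\<in>\<Omega>. S \<omega> < T \<omega> \<and> U \<omega> \<le> ennreal u}" by auto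
  ultimately show "{\<omega>\<in>\<Omega>. S \<omega> < T \<omega>} \<inter> {\<omega>\<in>\<Omega>. U \<omega> \<le> ennreal u} \<in> F u" by (simp only: eq)
qed

lemma stopped_sigma_sets: "A \<in> stopped_sigma (P None) F S \<Longrightarrow> A \<in> sets (P z)"
  using sets_P[of z] by (auto simp: stopped_sigma_def)

text \<open>The right side says \<open>q - S < t\<close> for a rational \<open>q\<close> after
  \<open>S\<close>. It is split at \<open>q < t\<close> because \<open>ennreal\<close> sends
  negative numbers to 0: for \<open>q < t\<close> the bound is automatic, whereas
  \<open>S > ennreal (q - t)\<close> would fail at \<open>S = 0\<close>.\<close>

lemma shift_exit_iff:
  assumes w: "\<omega> \<in> \<Omega>" and h: "S \<omega> = ennreal h" "h \<ge> 0" and D: "closed D"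
  shows "exit_time X D (\<theta> h \<omega>) < ennreal t \<longleftrightarrow>
    (\<exists>q\<in>{0<..} \<inter> \<rat>. (S \<omega> < ennreal q \<and> X q \<omega> \<in> - Some ` D) \<and> (q < t \<or> (t \<le> q \<and> \<not> S \<omega> \<le> ennreal (q - t))))"
proof
  assume "exit_time X D (\<theta> h \<omega>) < ennreal t"
  then obtain s where s: "0 < s" "s < t" "X s (\<theta> h \<omega>) \<notin> Some ` D" unfolding exit_time_less by blast
  then have U: "X (s + h) \<omega> \<in> - Some ` D" using shift[OF h(2) _ w, of s] by simp
  have op: "open (Some -` (- Some ` D))" using D by (auto simp: vimage_Compl inj_vimage_image_eq)
  obtain \<delta> where d: "\<delta> > 0" "\<And>r. s + h \<le> r \<Longrightarrow> r < s + h + \<delta> \<Longrightarrow> X r \<omega> \<in> - Some ` D"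
    using right_stable[OF w _ U op] s h by (metis add_nonneg_nonneg less_imp_le)
  obtain q where q: "q \<in> \<rat>" "s + h < q" "q < min (s + h + \<delta>) (t + h)"
    using Rats_dense_in_real[of "s + h" "min (s + h + \<delta>) (t + h)"] s d by auto
  have "X q \<omega> \<in> - Some ` D" using d(2)[of q] q by simp
  moreover have "S \<omega> < ennreal q" using q s h by (simp add: ennreal_less_iff)
  moreover have "q < t \<or> (t \<le> q \<and> \<not> S \<omega> \<le> ennreal (q - t))"
    using q h by (cases "q < t") (auto simp: ennreal_le_iff)
  moreover have "q > 0" using q s h by simp
  ultimately show "\<exists>q\<in>{0<..} \<inter> \<rat>. (S \<omega> < ennreal q \<and> X q \<omega> \<in> - Some ` D) \<and> (q < t \<or> (t \<le> q \<and> \<not> S \<omega> \<le> ennreal (q - t)))"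
    using q by blast
next
  assume "\<exists>q\<in>{0<..} \<inter> \<rat>. (S \<omega> < ennreal q \<and> X q \<omega> \<in> - Some ` D) \<and> (q < t \<or> (t \<le> q \<and> \<not> S \<omega> \<le> ennreal (q - t)))"
  then obtain q where q: "q > 0" "S \<omega> < ennreal q" "X q \<omega> \<in> - Some ` D" "q < t \<or> (t \<le> q \<and> \<not> S \<omega> \<le> ennreal (q - t))"
    by auto
  have hq: "h < q" using q h by (simp add: ennreal_less_iff)
  have "q - h < t" using q(4) h hq by (auto simp: ennreal_le_iff)
  moreover have "X (q - h) (\<theta> h \<omega>) \<notin> Some ` D" using shift[OF h(2) _ w, of "q - h"] hq q(3) by simp
  ultimately show "exit_time X D (\<theta> h \<omega>) < ennreal t" unfolding exit_time_less using hq by (intro exI[of _ "q - h"]) auto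
qed

text \<open>The axioms on \<open>\<theta>\<close> contain no measurability, so the event is
  rewritten through the unshifted path. Measurability is needed wherever another event is to be
  bounded by this one.\<close>

lemma shift_exit_sets:
  assumes S: "optional_time S" and D: "closed D" and A: "A \<in> stopped_sigma (P None) F S"
  shows "{\<omega>\<in>A. S \<omega> < \<top> \<and> \<theta> (enn2real (S \<omega>)) \<omega> \<in> {\<omega>\<in>\<Omega>. exit_time X D \<omega> < ennreal t}} \<in> sets (P z)"
proof -
  define Q where "Q \<omega> \<longleftrightarrow> (\<exists>q\<in>{0<..} \<inter> \<rat>. (S \<omega> < ennreal q \<and> X q \<omega> \<in> - Some ` D) \<and> (q < t \<or> (t \<le> q \<and> \<not> S \<omega> \<le> ennreal (q - t))))" for \<omega>
  have op: "open (Some -` (- Some ` D))" using D by (auto simp: vimage_Compl inj_vimage_image_eq)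
  have As: "A \<in> sets (P None)" "A \<subseteq> \<Omega>" using stopped_sigma_sets[OF A, of None] sets.sets_into_space by auto
  have "{\<omega>\<in>\<Omega>. Q \<omega>} \<in> sets (P None)"
    unfolding Q_def
  proof (intro sets.sets_Collect_countable_Ex' countable_Int2 countable_rat)
    fix q :: real assume "q \<in> {0<..} \<inter> \<rat>"
    then have q: "q > 0" by simp
    have X: "{\<omega>\<in>\<Omega>. X q \<omega> \<in> - Some ` D} \<in> sets (P None)" 
      using F_X[OF _ order_refl op, of q] F_subset[of q] q by auto
    show "{\<omega>\<in>\<Omega>. (S \<omega> < ennreal q \<and> X q \<omega> \<in> - Some ` D) \<and> (q < t \<or> (t \<le> q \<and> \<not> S \<omega> \<le> ennreal (q - t)))} \<in> sets (P None)"
    proof (cases "q < t")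
      case True
      then show ?thesis using sets.sets_Collect_conj[OF X optional_time_sets(1)[OF S q]] by simp
    next
      case False
      then have "{\<omega>\<in>\<Omega>. S \<omega> \<le> ennreal (q - t)} \<in> sets (P None)"
        using optional_time_le[OF S _ order_refl, of "q - t"] F_subset[of "q - t"] by auto
      from sets.sets_Collect_conj[OF sets.sets_Collect_neg[OF this] sets.sets_Collect_conj[OF X optional_time_sets(1)[OF S q]]]
      show ?thesis using False by simp
    qed
  qed
  moreover have "{\<omega>\<in>\<Omega>. S \<omega> < \<top>} \<in> sets (P None)"
  proof -
    have "S \<omega> < \<top> \<longleftrightarrow> (\<exists>n::nat. S \<omega> < ennreal (real (Suc n)))" for \<omega>
    proof
      assume "S \<omega> < \<top>"
      then obtain r where r: "S \<omega> = ennreal r" "r \<ge> 0" by (cases "S \<omega>") auto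
      obtain n :: nat where "r \<le> real n" using real_arch_simple by blast
      then have "S \<omega> < ennreal (real (Suc n))" using r by (simp add: ennreal_less_iff del: ennreal_plus)
      then show "\<exists>n::nat. S \<omega> < ennreal (real (Suc n))" ..
    qed (metis ennreal_less_top less_trans)
    then have "{\<omega>\<in>\<Omega>. S \<omega> < \<top>} = {\<omega>\<in>\<Omega>. \<exists>n::nat. S \<omega> < ennreal (real (Suc n))}" by simp
    also have "\<dots> \<in> sets (P None)"
      by (intro sets.sets_Collect_countable_Ex optional_time_sets(1)[OF S]) simp
    finally show ?thesis .
  qed
  ultimately have "A \<inter> ({\<omega>\<in>\<Omega>. Q \<omega>} \<inter> {\<omega>\<in>\<Omega>. S \<omega> < \<top>}) \<in> sets (P None)" using As by blast
  moreover have "{\<omega>\<in>A. S \<omega> < \<top> \<and> \<theta> (enn2real (S \<omega>)) \<omega> \<in> {\<omega>\<in>\<Omega>. exit_time X D \<omega> < ennreal t}} = A \<inter> ({\<omega>\<in>\<Omega>. Q \<omega>} \<inter> {\<omega>\<in>\<Omega>. S \<omega> < \<top>})"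
  proof -
    have "\<theta> (enn2real (S \<omega>)) \<omega> \<in> {\<omega>\<in>\<Omega>. exit_time X D \<omega> < ennreal t} \<longleftrightarrow> Q \<omega>" if "\<omega> \<in> A" "S \<omega> < \<top>" for \<omega>
    proof -
      have w: "\<omega> \<in> \<Omega>" using that As by auto
      have h: "S \<omega> = ennreal (enn2real (S \<omega>))" "enn2real (S \<omega>) \<ge> 0" using that by auto
      show ?thesis using shift_exit_iff[where S=S and h="enn2real (S \<omega>)", OF w h D, of t] shift_space[OF h(2) w] unfolding Q_def by simp
    qed
    then show ?thesis using As by auto
  qed
  ultimately show ?thesis using sets_P[of z] by simp
qed

text \<open>Unlike \<open>exit_time_gt\<close> this includes \<open>h = 0\<close>, which
  \<open>exit_time\<close> ignores: a path outside a closed set stays outside for a while, so the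
  exit time would be at most \<open>h\<close>.\<close>

lemma X_before_exit:
  assumes w: "\<omega> \<in> \<Omega>" and h: "ennreal h < exit_time X D \<omega>" "h \<ge> 0" and D: "closed D"
  shows "X h \<omega> \<in> Some ` D"
proof (rule ccontr)
  assume "X h \<omega> \<notin> Some ` D"
  then have U: "X h \<omega> \<in> - Some ` D" by simp
  have op: "open (Some -` (- Some ` D))" using D by (auto simp: vimage_Compl inj_vimage_image_eq)
  obtain \<delta> where d: "\<delta> > 0" "\<And>r. h \<le> r \<Longrightarrow> r < h + \<delta> \<Longrightarrow> X r \<omega> \<in> - Some ` D"
    using right_stable[OF w h(2) U op] by blast
  have "exit_time X D \<omega> \<le> ennreal h"
  proof (rule ennreal_le_epsilon)
    fix e :: real assume e: "e > 0"
    define r where "r = h + min (e / 2) (\<delta> / 2)"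
    have r: "0 < r" "h \<le> r" "r < h + \<delta>" "r < h + e" using e d h by (auto simp: r_def min_def)
    have "exit_time X D \<omega> < ennreal (h + e)" unfolding exit_time_less using r d(2)[of r] by blast
    then show "exit_time X D \<omega> \<le> ennreal h + ennreal e" using h e by (simp add: less_imp_le ennreal_plus)
  qed
  then show False using h by simp
qed

end

context stable_like_process begin

text \<open>To leave \<open>cball y ((2 N + 1) \<rho>)\<close> before time \<open>t\<close>, the process either has a jump of size at least
  \<open>\<rho>\<close>, or it enters each gap between \<open>cball y ((2 k + 1) \<rho>)\<close> and \<open>cball y ((2 k + 2) \<rho>)\<close> and then moves
  by \<open>\<rho>\<close> within time \<open>t\<close>, which has conditional probability at most \<open>1 - stay_const\<close> for each \<open>k < N\<close>.\<close>

lemma exit_tail: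
  assumes \<rho>: "\<rho> > 0" and far: "\<And>x. x \<in> cball y ((2 * real N + 2) * \<rho>) \<Longrightarrow> far x \<rho>"
    and t: "0 < t" "t \<le> \<phi> \<rho> / C"
  shows "measure (P (Some y)) {\<omega>\<in>\<Omega>. exit_time X (cball y ((2 * real N + 1) * \<rho>)) \<omega> < ennreal t}
    \<le> (1 - stay_const) ^ N + t * (C3 * C / \<phi> \<rho>)"
proof -
  interpret prob_space "P (Some y)" by (rule prob_P)
  define S where "S k = exit_time X (cball y ((2 * real k + 1) * \<rho>))" for k :: nat
  define S' where "S' k = exit_time X (cball y ((2 * real k + 2) * \<rho>))" for k :: nat
  have S: "optional_time (S k)" and S': "optional_time (S' k)" for k
    unfolding S_def S'_def by (auto intro: optional_time_exit)
  have cballs: "cball y (a * \<rho>) \<subseteq> cball y (b * \<rho>)" if "a \<le> b" for a b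
    using \<rho> that by (intro subset_cball mult_right_mono) auto
  have SS': "S k \<omega> \<le> S' k \<omega>" for k \<omega>
    unfolding S_def S'_def by (intro exit_time_mono cballs) simp
  have S'S: "S' k \<omega> \<le> S (Suc k) \<omega>" for k \<omega>
    unfolding S_def S'_def by (intro exit_time_mono cballs) simp
  have Smono: "S i \<omega> \<le> S k \<omega>" if "i \<le> k" for i k \<omega>
    unfolding S_def using that by (intro exit_time_mono cballs) simp
  \<comment> \<open>\<open>S i < S' i\<close> means that gap \<open>i\<close> is not jumped over.
    \<open>B k\<close> asks this of the first \<open>k\<close> gaps; \<open>A k\<close> adds gap
    \<open>k\<close>, which controls the position at time \<open>S k\<close> and is still decided at
    that time.\<close>
  define B where "B k = {\<omega>\<in>\<Omega>. S k \<omega> < ennreal t \<and> (\<forall>i<k. S i \<omega> < S' i \<omega>)}" for k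
  define A where "A k = {\<omega>\<in>\<Omega>. S k \<omega> < ennreal t \<and> (\<forall>i<Suc k. S i \<omega> < S' i \<omega>)}" for k
  have part: "{\<omega>\<in>\<Omega>. S k \<omega> < ennreal t \<and> (\<forall>i<n. S i \<omega> < S' i \<omega>)} \<in> stopped_sigma (P None) F (S k)" if "n \<le> Suc k" for n k
    using that
  proof (induction n)
    case 0 then show ?case using stopped_sigma_less_const[OF S t(1), of k] by simp
  next
    case (Suc n)
    have "{\<omega>\<in>\<Omega>. S n \<omega> < S' n \<omega>} \<in> stopped_sigma (P None) F (S k)"
      using Suc by (intro stopped_sigma_less S S' Smono) simp
    then have "{\<omega>\<in>\<Omega>. S k \<omega> < ennreal t \<and> (\<forall>i<n. S i \<omega> < S' i \<omega>)} \<inter> {\<omega>\<in>\<Omega>. S n \<omega> < S' n \<omega>} \<in> stopped_sigma (P None) F (S k)"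
      using Suc by (intro stopped_sigma_Int[OF S]) auto
    moreover have "{\<omega>\<in>\<Omega>. S k \<omega> < ennreal t \<and> (\<forall>i<n. S i \<omega> < S' i \<omega>)} \<inter> {\<omega>\<in>\<Omega>. S n \<omega> < S' n \<omega>} = {\<omega>\<in>\<Omega>. S k \<omega> < ennreal t \<and> (\<forall>i<Suc n. S i \<omega> < S' i \<omega>)}"
      by (auto simp: less_Suc_eq)
    ultimately show ?case by simp
  qed
  have B: "B k \<in> sets (P (Some y))" and Ast: "A k \<in> stopped_sigma (P None) F (S k)" and A: "A k \<in> sets (P (Some y))" for k
    using part[of k k] part[of "Suc k" k] stopped_sigma_sets by (auto simp: A_def B_def)
  have sc: "0 \<le> 1 - stay_const"
  proof -
    have "ennreal stay_const \<le> 1"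
      using survival[of y] emeasure_le_1 order_trans by blast
    then show ?thesis using stay_const_pos by (simp add: ennreal_le_1)
  qed
  have step: "prob (B (Suc k)) \<le> (1 - stay_const) * prob (B k)" if k: "k < N" for k
  proof -
    let ?D = "cball y ((2 * real (Suc k) + 1) * \<rho>)"
    let ?\<Lambda> = "{\<omega>\<in>\<Omega>. exit_time X ?D \<omega> < ennreal t}"
    have "emeasure (P (Some y)) (B (Suc k)) \<le> emeasure (P (Some y)) {\<omega>\<in>A k. S k \<omega> < \<top> \<and> \<theta> (enn2real (S k \<omega>)) \<omega> \<in> ?\<Lambda>}"
    proof (rule emeasure_mono)
      show "{\<omega>\<in>A k. S k \<omega> < \<top> \<and> \<theta> (enn2real (S k \<omega>)) \<omega> \<in> ?\<Lambda>} \<in> sets (P (Some y))"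
        by (rule shift_exit_sets[OF S _ Ast]) simp
      show "B (Suc k) \<subseteq> {\<omega>\<in>A k. S k \<omega> < \<top> \<and> \<theta> (enn2real (S k \<omega>)) \<omega> \<in> ?\<Lambda>}"
      proof
        fix \<omega> assume "\<omega> \<in> B (Suc k)"
        then have w: "\<omega> \<in> \<Omega>" and St: "S (Suc k) \<omega> < ennreal t" and lt: "\<forall>i<Suc k. S i \<omega> < S' i \<omega>" by (auto simp: B_def)
        \<comment> \<open>Strictness makes the next exit happen at a positive time of the shifted
          path.\<close>
        have Sk: "S k \<omega> < S (Suc k) \<omega>" using lt S'S[of k \<omega>] by (auto intro: less_le_trans)
        have "S k \<omega> < ennreal t" using Sk St by (rule less_trans)
        then have wA: "\<omega> \<in> A k" using w lt by (simp add: A_def)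
        define h where "h = enn2real (S k \<omega>)"
        have fin: "S k \<omega> < \<top>" using \<open>S k \<omega> < ennreal t\<close> by (rule less_trans) simp
        then have h: "S k \<omega> = ennreal h" "h \<ge> 0" by (auto simp: h_def)
        obtain s where s: "0 < s" "s < t" "X s \<omega> \<notin> Some ` ?D" using St unfolding S_def exit_time_less by blast
        then have "S (Suc k) \<omega> \<le> ennreal s" unfolding S_def exit_time_def by (intro Inf_lower) auto
        then have "h < s" using Sk h by (metis ennreal_less_iff less_le_trans)
        have "X (s - h) (\<theta> h \<omega>) \<notin> Some ` ?D" using shift[OF h(2) _ w, of "s - h"] \<open>h < s\<close> s by simp
        then have "exit_time X ?D (\<theta> h \<omega>) < ennreal t"
          unfolding exit_time_less using \<open>h < s\<close> s h by (intro exI[of _ "s - h"]) auto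
        then show "\<omega> \<in> {\<omega>\<in>A k. S k \<omega> < \<top> \<and> \<theta> (enn2real (S k \<omega>)) \<omega> \<in> ?\<Lambda>}"
          using wA fin shift_space[OF h(2) w] by (simp add: h_def)
      qed
    qed
    also have "\<dots> \<le> ennreal (1 - stay_const) * emeasure (P (Some y)) (A k)"
    proof (rule strong_markov_upper[OF optional_time_stopping[OF S] Ast path_sigma_exit])
      fix \<omega> assume wA: "\<omega> \<in> A k" "S k \<omega> < \<top>"
      define h where "h = enn2real (S k \<omega>)"
      have h: "S k \<omega> = ennreal h" "h \<ge> 0" using wA by (auto simp: h_def)
      have w: "\<omega> \<in> \<Omega>" and "ennreal h < S' k \<omega>" using wA h by (auto simp: A_def)
      then obtain x where x: "X h \<omega> = Some x" "x \<in> cball y ((2 * real k + 2) * \<rho>)"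
        using X_before_exit[OF w _ h(2)] unfolding S'_def by (metis closed_cball imageE)
      have kN: "2 * real k + 2 \<le> 2 * real N + 2" using k by simp
      have "far x \<rho>" using far x(2) cballs[OF kN] by blast
      \<comment> \<open>\<open>?D\<close> has radius \<open>(2 * k + 3) * \<rho>\<close>, one
        \<open>\<rho>\<close> more than the ball that contains \<open>x\<close>.\<close>
      moreover have "ball x \<rho> \<subseteq> ?D"
      proof
        fix v assume "v \<in> ball x \<rho>"
        then have "dist y v \<le> (2 * real k + 2) * \<rho> + \<rho>"
          using dist_triangle[of y v x] x(2) by simp
        then show "v \<in> ?D" by (simp add: algebra_simps)
      qed
      ultimately have "measure (P (Some x)) ?\<Lambda> \<le> 1 - C4 * exp (- C5 * real 1)"
        using t by (intro stay_prob) auto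
      then show "emeasure (P (X (enn2real (S k \<omega>)) \<omega>)) ?\<Lambda> \<le> ennreal (1 - stay_const)"
        using x by (simp add: h_def[symmetric] finite_measure.emeasure_eq_measure[OF prob_space.finite_measure[OF prob_P]] stay_const_def ennreal_leI)
    qed simp
    also have "\<dots> \<le> ennreal (1 - stay_const) * emeasure (P (Some y)) (B k)"
      by (intro mult_left_mono emeasure_mono B) (auto simp: A_def B_def)
    finally show ?thesis using sc by (simp add: emeasure_eq_measure ennreal_mult[symmetric] ennreal_le_iff)
  qed
  have BN: "prob (B k) \<le> (1 - stay_const) ^ k" if "k \<le> N" for k
    using that
  proof (induction k)
    case (Suc k)
    have "prob (B (Suc k)) \<le> (1 - stay_const) * prob (B k)" using Suc by (intro step) simp
    also have "\<dots> \<le> (1 - stay_const) * (1 - stay_const) ^ k" using Suc sc by (intro mult_left_mono) auto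
    finally show ?case by simp
  qed simp
  \<comment> \<open>\<open>S i = S' i\<close> means that the path passes at once from radius at most
    \<open>(2 * i + 1) * \<rho>\<close> to at least \<open>(2 * i + 2) * \<rho>\<close>, a jump of
    size at least \<open>\<rho>\<close>.\<close>
  define bigjump where "bigjump = {\<omega>\<in>\<Omega>. \<exists>i<N. S i \<omega> < ennreal t \<and> \<not> S i \<omega> < S' i \<omega>}"
  have bigjump: "bigjump \<in> sets (P (Some y))"
  proof -
    have eq: "bigjump = {\<omega>\<in>\<Omega>. \<exists>i\<in>{..<N}. S i \<omega> < ennreal t \<and> \<not> S i \<omega> < S' i \<omega>}" unfolding bigjump_def by auto
    show ?thesis unfolding eq sets_P[of "Some y"]
      by (intro sets.sets_Collect_finite_Ex sets.sets_Collect_conj sets.sets_Collect_neg optional_time_sets(1)[OF S t(1)]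
          stopped_sigma_sets[OF stopped_sigma_less[OF S S' S order_refl]]) simp
  qed
  have "emeasure (P (Some y)) bigjump \<le> ennreal (t * (C3 * C / \<phi> \<rho>))"
  proof (rule big_jump_bound[OF far t(1) bigjump _ \<rho>])
    show "AE \<omega> in P (Some y). \<omega> \<in> bigjump \<longrightarrow> (\<exists>s l. 0 < s \<and> s \<le> t \<and> l \<in> cball y ((2 * real N + 2) * \<rho>) \<and>
        X s \<omega> \<notin> Some ` ball l \<rho> \<and> limitin cem_top (\<lambda>r. X r \<omega>) (Some l) (at_left s))"
      using left_limits_AE[of y] X_0[of "Some y"] AE_space_Omega[of "Some y"]
    proof eventually_elim
      case (elim \<omega>)
      show ?case
      proof
        assume "\<omega> \<in> bigjump"
        then obtain i where i: "i < N" "S i \<omega> < ennreal t" "\<not> S i \<omega> < S' i \<omega>" by (auto simp: bigjump_def)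
        define h where "h = enn2real (S i \<omega>)"
        have "S i \<omega> < \<top>" using i(2) by (rule less_trans) simp
        then have h: "S i \<omega> = ennreal h" "h \<ge> 0" by (auto simp: h_def)
        have h': "S' i \<omega> = ennreal h" using i(3) SS'[of i \<omega>] h by auto
        \<comment> \<open>Left limits exist only at positive times; a path started at the centre
          does not leave the ball at once.\<close>
        have "h \<noteq> 0"
        proof
          assume h0: "h = 0"
          have "X 0 \<omega> \<in> Some ` ball y \<rho>" using elim(2) \<rho> by simp
          then obtain \<delta> where d: "\<delta> > 0" "\<And>s'. 0 \<le> s' \<Longrightarrow> s' < 0 + \<delta> \<Longrightarrow> X s' \<omega> \<in> Some ` ball y \<rho>"
            using right_stable[OF elim(3), of 0 "Some ` ball y \<rho>"] by (auto simp: inj_vimage_image_eq)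
          have "S i \<omega> < ennreal \<delta>" using h h0 d by simp
          then obtain s where s: "0 < s" "s < \<delta>" "X s \<omega> \<notin> Some ` cball y ((2 * real i + 1) * \<rho>)"
            unfolding S_def exit_time_less by blast
          have "ball y \<rho> \<subseteq> cball y ((2 * real i + 1) * \<rho>)"
            using cballs[of 1 "2 * real i + 1"] by auto
          then show False using d(2)[of s] s by auto
        qed
        then have h0: "h > 0" using h by simp
        obtain l where l: "limitin cem_top (\<lambda>r. X r \<omega>) (Some l) (at_left h)" using elim(1) h0 by blast
        have XD: "X s \<omega> \<in> Some ` cball y ((2 * real i + 1) * \<rho>)" if "0 < s" "s < h" for s
          by (rule exit_time_gt[OF _ that(1) order_refl]) (use that h in \<open>simp add: S_def[symmetric] ennreal_less_iff\<close>)
        have lD: "l \<in> cball y ((2 * real i + 1) * \<rho>)"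
        proof (rule ccontr)
          assume "l \<notin> cball y ((2 * real i + 1) * \<rho>)"
          then have "eventually (\<lambda>s. X s \<omega> \<in> Some ` (- cball y ((2 * real i + 1) * \<rho>))) (at_left h)"
            using limitin_cem_Some[OF l, of "- cball y ((2 * real i + 1) * \<rho>)"] by auto
          moreover have "eventually (\<lambda>s. 0 < s \<and> s < h) (at_left h)"
            using h0 by (auto simp: eventually_at_left_field)
          ultimately have "eventually (\<lambda>s. False) (at_left h)" by eventually_elim (use XD in fastforce)
          then show False by simp
        qed
        have nb: "X h \<omega> \<notin> Some ` ball l \<rho>"
        proof
          assume "X h \<omega> \<in> Some ` ball l \<rho>"
          then obtain x where x: "X h \<omega> = Some x" "dist l x < \<rho>" by auto
          have "hit_after (- Some ` cball y ((2 * real i + 2) * \<rho>)) (\<lambda>_. 0) \<omega> = ennreal h"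
            using h' by (simp add: S'_def exit_time_hit_after)
          then have "x \<in> closure (Some -` (- Some ` cball y ((2 * real i + 2) * \<rho>)))"
            by (rule X_hit_after[OF elim(3) _ h(2) x(1)])
          also have "Some -` (- Some ` cball y ((2 * real i + 2) * \<rho>)) = - cball y ((2 * real i + 2) * \<rho>)" by auto
          also have "closure (- cball y ((2 * real i + 2) * \<rho>)) \<subseteq> - ball y ((2 * real i + 2) * \<rho>)"
            by (rule closure_minimal) (auto simp: closed_Compl)
          finally have "dist y x \<ge> (2 * real i + 2) * \<rho>" by simp
          moreover have "dist y x \<le> dist y l + dist l x" by (rule dist_triangle)
          ultimately show False using lD x by (simp add: algebra_simps)
        qed
        have iN: "2 * real i + 1 \<le> 2 * real N + 2" using i by simp
        have "l \<in> cball y ((2 * real N + 2) * \<rho>)" using lD cballs[OF iN] by blast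
        moreover have "h \<le> t" using i(2) h by (simp add: ennreal_less_iff)
        ultimately show "\<exists>s l. 0 < s \<and> s \<le> t \<and> l \<in> cball y ((2 * real N + 2) * \<rho>) \<and>
          X s \<omega> \<notin> Some ` ball l \<rho> \<and> limitin cem_top (\<lambda>r. X r \<omega>) (Some l) (at_left s)"
          using h0 l nb by blast
      qed
    qed
  qed
  moreover have "0 \<le> t * (C3 * C / \<phi> \<rho>)" using t params phi_pos[OF \<rho>] by simp
  ultimately have "prob bigjump \<le> t * (C3 * C / \<phi> \<rho>)" by (simp add: emeasure_eq_measure ennreal_le_iff)
  moreover have "prob {\<omega>\<in>\<Omega>. S N \<omega> < ennreal t} \<le> prob (B N \<union> bigjump)"
  proof (rule finite_measure_mono)
    show "{\<omega>\<in>\<Omega>. S N \<omega> < ennreal t} \<subseteq> B N \<union> bigjump"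
    proof
      fix \<omega> assume "\<omega> \<in> {\<omega>\<in>\<Omega>. S N \<omega> < ennreal t}"
      then have w: "\<omega> \<in> \<Omega>" "S N \<omega> < ennreal t" by auto
      have "S i \<omega> < ennreal t" if "i < N" for i using Smono[of i N \<omega>] that w(2) by (meson le_less_trans less_imp_le)
      then show "\<omega> \<in> B N \<union> bigjump" using w by (auto simp: B_def bigjump_def)
    qed
  qed (use B bigjump in auto)
  moreover have "prob (B N \<union> bigjump) \<le> prob (B N) + prob bigjump" using B bigjump by (intro measure_Un_le) auto
  ultimately have "prob {\<omega>\<in>\<Omega>. S N \<omega> < ennreal t} \<le> (1 - stay_const) ^ N + t * (C3 * C / \<phi> \<rho>)"
    using BN[of N] by simp
  then show ?thesis by (simp add: S_def)
qed

end

section \<open>The lower bound\<close>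

context stable_like_process begin

lemma bdd_above_phi: "bdd_above {r. r > 0 \<and> \<phi> r \<le> v}"
proof -
  have "eventually (\<lambda>r. v + 1 \<le> \<phi> r) at_top" using phi_at_top by (simp add: filterlim_at_top)
  then have "eventually (\<lambda>r. v + 1 \<le> \<phi> r \<and> r > 0) at_top"
    using eventually_gt_at_top eventually_conj by blast
  then obtain r0 where r0: "v + 1 \<le> \<phi> r0" "r0 > 0"
    using eventually_happens' trivial_limit_at_top_linorder by blast
  show ?thesis
  proof (rule bdd_aboveI)
    fix r assume "r \<in> {r. r > 0 \<and> \<phi> r \<le> v}"
    then show "r \<le> r0" using phi_le[of r0 r] r0 by force
  qed
qed

lemma gen_inv_ge: "r > 0 \<Longrightarrow> \<phi> r \<le> v \<Longrightarrow> r \<le> gen_inv \<phi> v"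
  unfolding gen_inv_def by (intro cSup_upper bdd_above_phi) auto

lemma gen_inv_le:
  assumes "r > 0" "\<phi> r \<le> v" "\<And>r. r > 0 \<Longrightarrow> \<phi> r \<le> v \<Longrightarrow> r \<le> b"
  shows "gen_inv \<phi> v \<le> b"
  unfolding gen_inv_def using assms by (intro cSup_least) auto

section \<open>Scales and times of the lower bound\<close>

definition rad :: "nat \<Rightarrow> real" where "rad k = ell ^ k * (2 * R)"
text \<open>For \<open>k \<ge> 1\<close> this makes \<open>exp (- C7 * exit_steps k)\<close> at most
  \<open>1 / k^2\<close>, which is summable; the final \<open>+ 1\<close> provides
  \<open>n \<ge> 1\<close> in (B4). \<open>tm k\<close> is then at least that many expected exit
  times at radius \<open>rad k\<close>, as soon as it is \<open>far\<close>.\<close>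

definition exit_steps :: "nat \<Rightarrow> nat" where "exit_steps k = nat \<lceil>2 * ln (real k) / C7\<rceil> + 1"
definition tm :: "nat \<Rightarrow> real" where "tm k = real (exit_steps k) * (C * \<phi> (rad k))"

lemma rad_gt: "rad k > R" 
proof -
  have "1 * (2 * R) \<le> ell ^ k * (2 * R)" using params by (intro mult_right_mono) auto
  moreover have "R < 1 * (2 * R)" using params by simp
  ultimately show ?thesis unfolding rad_def by linarith
qed

lemma rad_pos: "rad k > 0" using rad_gt[of k] params by simp

lemma filterlim_rad: "filterlim rad at_top sequentially"
proof -
  have "filterlim (\<lambda>k. ell ^ k * (2 * R)) at_top sequentially"
    using params(1,4) by real_asymp
  then show ?thesis by (simp add: rad_def[abs_def])
qed

lemma tm_ge: "2 ^ k * (\<phi> (2 * R) / C\<^sup>2) \<le> tm k"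
proof -
  have p: "\<phi> (rad k) > 0" by (rule phi_pos[OF rad_pos])
  have "2 ^ k * \<phi> (2 * R) \<le> C\<^sup>2 * \<phi> (rad k)"
    using phi_growth[of "2 * R" k] params by (simp add: rad_def)
  then have "2 ^ k * (\<phi> (2 * R) / C\<^sup>2) \<le> \<phi> (rad k)" using params by (simp add: field_simps)
  also have "\<dots> \<le> 1 * (C * \<phi> (rad k))" using params p by simp
  also have "\<dots> \<le> tm k" unfolding tm_def using params p by (intro mult_right_mono) (auto simp: exit_steps_def)
  finally show ?thesis .
qed

text \<open>\<open>exit_steps\<close> is of order \<open>ln k\<close>, and \<open>tm\<close> grows
  at least like \<open>2 ^ k\<close>, so \<open>ln (ln (tm k))\<close> is at least of the same
  order. Dividing by it cancels the number of steps.\<close>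

lemma tm_growth:
  obtains A where "A > 0" "eventually (\<lambda>k. ln (ln (tm k)) > 0 \<and> tm k > 1 \<and> ln (tm k) > 1 \<and>
    tm (Suc k) / ln (ln (tm k)) \<le> A * \<phi> (rad (Suc k))) sequentially"
proof
  define d where "d = ln (\<phi> (2 * R) / C\<^sup>2)"
  \<comment> \<open>\<open>2 / C7\<close> is the slope of \<open>exit_steps\<close> in
    \<open>ln k\<close>; the additional 1 absorbs the additive constants.\<close>
  define A where "A = C * (2 / C7 + 1)"
  have c0: "\<phi> (2 * R) / C\<^sup>2 > 0" using phi_pos[of "2*R"] params by simp
  show A: "A > 0" using params by (simp add: A_def add_pos_pos)
  have e1: "eventually (\<lambda>k::nat. 2 * ln (real k + 1) / C7 + 2 \<le> (2 / C7 + 1) * ln (real k * ln 2 + d)) sequentially"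
  proof -
    \<comment> \<open>With \<open>ln 2 \<ge> 1 / 2\<close> this threshold gives
      \<open>(k + 1) / 4 \<le> k * ln 2 + d\<close>; the next one leaves room for the loss
      \<open>ln 4 < 2\<close> and for the summand 2.\<close>
    have "eventually (\<lambda>k::nat. real k \<ge> 1 - 4 * d) sequentially" by real_asymp
    moreover have "eventually (\<lambda>k::nat. ln (real k + 1) \<ge> 4 / C7 + 4) sequentially" by real_asymp
    ultimately show ?thesis
    proof eventually_elim
      case (elim k)
      have "ln (1 / 2 :: real) \<le> 1 / 2 - 1" by (rule ln_le_minus_one) simp
      then have ln2: "ln 2 \<ge> (1 / 2 :: real)" by (simp add: ln_div)
      have "real k * (1 / 2) \<le> real k * ln 2" using ln2 by (intro mult_left_mono) auto
      then have "(real k + 1) / 4 \<le> real k * ln 2 + d" using elim(1) by simp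
      then have "ln ((real k + 1) / 4) \<le> ln (real k * ln 2 + d)" by (subst ln_le_cancel_iff) auto
      moreover have "ln ((real k + 1) / 4) \<ge> ln (real k + 1) - 2"
        using ln_realpow[of 2 2] ln_2_less_1 by (subst ln_div) auto
      ultimately have "(2 / C7 + 1) * (ln (real k + 1) - 2) \<le> (2 / C7 + 1) * ln (real k * ln 2 + d)"
        using params by (intro mult_left_mono) auto
      moreover have "2 * ln (real k + 1) / C7 + 2 \<le> (2 / C7 + 1) * (ln (real k + 1) - 2)"
        using elim(2) by (simp add: algebra_simps)
      ultimately show ?case by linarith
    qed
  qed
  have e2: "eventually (\<lambda>k::nat. real k * ln 2 + d > exp 1) sequentially" by real_asymp
  show "eventually (\<lambda>k. ln (ln (tm k)) > 0 \<and> tm k > 1 \<and> ln (tm k) > 1 \<and>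
    tm (Suc k) / ln (ln (tm k)) \<le> A * \<phi> (rad (Suc k))) sequentially"
    using e1 e2
  proof eventually_elim
    case (elim k)
    have pos: "2 ^ k * (\<phi> (2 * R) / C\<^sup>2) > 0" using c0 by (intro mult_pos_pos) auto
    have "real k * ln 2 + d = ln (2 ^ k * (\<phi> (2 * R) / C\<^sup>2))"
      unfolding d_def using c0 by (subst ln_mult) (auto simp: ln_realpow)
    also have "\<dots> \<le> ln (tm k)" using tm_ge[of k] pos by (simp only: ln_le_cancel_iff less_le_trans)
    finally have lt: "real k * ln 2 + d \<le> ln (tm k)" .
    have e: "exp 1 > (1::real)" by simp
    have l0: "real k * ln 2 + d > 0" using elim(2) e by linarith
    have l1: "ln (tm k) > 1" using lt elim(2) e by linarith
    have l2: "ln (real k * ln 2 + d) \<le> ln (ln (tm k))" using lt l0 by (subst ln_le_cancel_iff) auto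
    have "1 = ln (exp 1 :: real)" by simp
    also have "\<dots> < ln (real k * ln 2 + d)" using elim(2) l0 by (subst ln_less_cancel_iff) auto
    finally have l3: "ln (real k * ln 2 + d) > 1" .
    have t1: "tm k > 1"
    proof -
      have "tm k > 0" using tm_ge[of k] pos by linarith
      then show ?thesis using l1 ln_gt_zero_iff[of "tm k"] by linarith
    qed
    have "real (exit_steps (Suc k)) \<le> 2 * ln (real k + 1) / C7 + 2"
    proof -
      have "2 * ln (real (Suc k)) / C7 \<ge> 0" using params by simp
      then have "real (nat \<lceil>2 * ln (real (Suc k)) / C7\<rceil>) \<le> 2 * ln (real (Suc k)) / C7 + 1" by linarith
      then show ?thesis by (simp add: exit_steps_def add.commute)
    qed
    also have "\<dots> \<le> (2 / C7 + 1) * ln (ln (tm k))"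
      using elim(1) l2 params by (meson add_nonneg_nonneg divide_nonneg_nonneg less_imp_le mult_left_mono order_trans zero_le_one zero_le_numeral)
    finally have "real (exit_steps (Suc k)) * (C * \<phi> (rad (Suc k))) \<le> ((2 / C7 + 1) * ln (ln (tm k))) * (C * \<phi> (rad (Suc k)))"
      using params phi_pos[OF rad_pos[of "Suc k"]] by (intro mult_right_mono) auto
    then have "tm (Suc k) \<le> A * \<phi> (rad (Suc k)) * ln (ln (tm k))" by (simp add: tm_def A_def mult_ac)
    then show ?case using l1 l2 l3 t1 by (auto simp: field_simps)
  qed
qed

text \<open>The argument of the inverse is at most \<open>A * \<phi> (rad (Suc k))\<close> on this
  interval. \<open>phi_growth\<close> over \<open>j\<close> steps with
  \<open>2 ^ j > A * C\<^sup>2\<close> beats the factor \<open>A\<close>, and one more step leads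
  from \<open>rad k\<close> to \<open>rad (Suc k)\<close>; hence
  \<open>b = ell ^ Suc j\<close>.\<close>

lemma gen_inv_growth:
  obtains b where "b > 0"
    "eventually (\<lambda>k. \<forall>t. tm k \<le> t \<and> t < tm (Suc k) \<longrightarrow> 0 < gen_inv \<phi> (t / ln (ln t)) \<and> gen_inv \<phi> (t / ln (ln t)) \<le> b * rad k) sequentially"
proof -
  obtain A where A: "A > 0" "eventually (\<lambda>k. ln (ln (tm k)) > 0 \<and> tm k > 1 \<and> ln (tm k) > 1 \<and>
    tm (Suc k) / ln (ln (tm k)) \<le> A * \<phi> (rad (Suc k))) sequentially" by (rule tm_growth) (rule that)
  obtain j where j: "A * C\<^sup>2 < 2 ^ j" using real_arch_pow[of 2] by auto
  have tinf: "filterlim tm at_top sequentially"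
  proof (rule filterlim_at_top_mono[OF _ always_eventually])
    have c0: "\<phi> (2 * R) / C\<^sup>2 > 0" using phi_pos[of "2*R"] params by simp
    show "filterlim (\<lambda>k. 2 ^ k * (\<phi> (2 * R) / C\<^sup>2)) at_top sequentially"
      using c0 by real_asymp
    show "\<forall>k. 2 ^ k * (\<phi> (2 * R) / C\<^sup>2) \<le> tm k" using tm_ge by blast
  qed
  have "filterlim (\<lambda>t::real. t / ln (ln t)) at_top at_top" by real_asymp
  then have "eventually (\<lambda>t::real. \<phi> (2 * R) \<le> t / ln (ln t)) at_top" by (simp add: filterlim_at_top)
  then obtain t0 where t0: "\<And>t. t \<ge> t0 \<Longrightarrow> \<phi> (2 * R) \<le> t / ln (ln t)" by (auto simp: eventually_at_top_linorder)
  have "eventually (\<lambda>k. tm k \<ge> t0) sequentially" using tinf by (simp add: filterlim_at_top)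
  with A(2) have "eventually (\<lambda>k. \<forall>t. tm k \<le> t \<and> t < tm (Suc k) \<longrightarrow> 0 < gen_inv \<phi> (t / ln (ln t)) \<and> gen_inv \<phi> (t / ln (ln t)) \<le> ell ^ Suc j * rad k) sequentially"
  proof eventually_elim
    case (elim k)
    show ?case
    proof (intro allI impI)
      fix t assume t: "tm k \<le> t \<and> t < tm (Suc k)"
      have R: "2 * R > 0" using params by simp
      have ph: "\<phi> (2 * R) \<le> t / ln (ln t)" using t0 t elim by auto
      have "2 * R \<le> gen_inv \<phi> (t / ln (ln t))" by (rule gen_inv_ge[OF R ph])
      moreover have "gen_inv \<phi> (t / ln (ln t)) \<le> ell ^ Suc j * rad k"
      proof (rule gen_inv_le[OF R ph])
        fix r assume r: "r > 0" "\<phi> r \<le> t / ln (ln t)"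
        have l: "ln (ln (tm k)) \<le> ln (ln t)"
        proof -
          have "ln (tm k) \<le> ln t" using t elim by (subst ln_le_cancel_iff) auto
          then show ?thesis using elim by (subst ln_le_cancel_iff) auto
        qed
        have "t / ln (ln t) \<le> tm (Suc k) / ln (ln (tm k))"
          using t elim l by (intro frac_le) auto
        also have "\<dots> \<le> A * \<phi> (rad (Suc k))" using elim by blast
        finally have le: "\<phi> r \<le> A * \<phi> (rad (Suc k))" using r by linarith
        have "A * C\<^sup>2 * \<phi> (rad (Suc k)) < 2 ^ j * \<phi> (rad (Suc k))"
          using j phi_pos[OF rad_pos[of "Suc k"]] by (intro mult_strict_right_mono) auto
        also have "\<dots> \<le> C\<^sup>2 * \<phi> (ell ^ j * rad (Suc k))" by (rule phi_growth[OF rad_gt])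
        finally have "C\<^sup>2 * (A * \<phi> (rad (Suc k))) < C\<^sup>2 * \<phi> (ell ^ j * rad (Suc k))" by (simp add: mult_ac)
        then have "A * \<phi> (rad (Suc k)) < \<phi> (ell ^ j * rad (Suc k))" using params by simp
        then have "\<phi> r < \<phi> (ell ^ j * rad (Suc k))" using le by simp
        moreover have "ell ^ j * rad (Suc k) > 0" using params rad_pos[of "Suc k"] by simp
        ultimately have "r < ell ^ j * rad (Suc k)" using phi_le[of "ell ^ j * rad (Suc k)" r] by linarith
        then show "r \<le> ell ^ Suc j * rad k" by (simp add: rad_def mult_ac)
      qed
      ultimately show "0 < gen_inv \<phi> (t / ln (ln t)) \<and> gen_inv \<phi> (t / ln (ln t)) \<le> ell ^ Suc j * rad k"
        using R by simp
    qed
  qed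
  moreover have "ell ^ Suc j > 0" using params by simp
  ultimately show ?thesis using that by blast
qed

lemma exits_eventually:
  "AE \<omega> in P (Some y). eventually (\<lambda>k. \<exists>s. 0 < s \<and> s < tm k \<and> X s \<omega> \<notin> Some ` ball y (rad k)) sequentially"
proof -
  interpret prob_space "P (Some y)" by (rule prob_P)
  define A where "A k = (if far y (rad k) then {\<omega> \<in> space (P (Some y)). exit_time X (ball y (rad k)) \<omega> \<ge> of_nat (exit_steps k) * Etau P X y (rad k)} else {})" for k
  have n1: "exit_steps k \<ge> 1" for k by (simp add: exit_steps_def)
  have A: "A k \<in> sets (P (Some y))" for k
  proof (cases "far y (rad k)")
    case True
    have "0 < C4 * exp (- C5 * real (exit_steps k))" using params by simp
    also have "\<dots> \<le> prob (A k)" using B4(1)[of y "rad k" "exit_steps k"] True n1 by (simp add: A_def far_def)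
    finally show ?thesis using measure_notin_sets[of "A k"] by (metis less_irrefl)
  qed (simp add: A_def)
  have le: "prob (A k) \<le> C6 * inverse (real k ^ 2)" if k: "k \<ge> 1" for k
  proof (cases "far y (rad k)")
    case True
    have "prob (A k) \<le> C6 * exp (- C7 * real (exit_steps k))" using B4(2)[of y "rad k" "exit_steps k"] True n1 by (simp add: A_def far_def)
    also have "\<dots> \<le> C6 * exp (- (2 * ln (real k)))"
    proof -
      have "2 * ln (real k) / C7 \<le> real (exit_steps k)" unfolding exit_steps_def by linarith
      then have "2 * ln (real k) \<le> C7 * real (exit_steps k)" using params by (simp add: field_simps)
      then show ?thesis using params by simp
    qed
    also have "exp (- (2 * ln (real k))) = inverse (real k ^ 2)"
      using k by (simp add: exp_minus exp_double)
    finally show ?thesis .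
  next
    case False
    then show ?thesis using params by (simp add: A_def)
  qed
  have "summable (\<lambda>k. prob (A k))"
  proof (rule summable_comparison_test_ev)
    show "eventually (\<lambda>k. norm (prob (A k)) \<le> C6 * inverse (real k ^ 2)) sequentially"
      using eventually_ge_at_top[of 1] by eventually_elim (use le in simp)
    show "summable (\<lambda>k. C6 * inverse (real k ^ 2))"
      by (intro summable_mult inverse_power_summable) simp
  qed
  then have "AE \<omega> in P (Some y). eventually (\<lambda>k. \<omega> \<in> space (P (Some y)) - A k) sequentially"
    using A by (intro borel_cantelli_AE1) (auto simp: emeasure_eq_measure)
  then show ?thesis
  proof eventually_elim
    case (elim \<omega>)
    have "eventually (\<lambda>k. far y (rad k)) sequentially"
      using eventually_compose_filterlim[OF eventually_far filterlim_rad] .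
    with elim show ?case
    proof eventually_elim
      case (elim k)
      have "exit_time X (ball y (rad k)) \<omega> < of_nat (exit_steps k) * Etau P X y (rad k)"
        using elim by (auto simp: A_def not_le)
      also have "\<dots> \<le> of_nat (exit_steps k) * ennreal (C * \<phi> (rad k))"
        by (intro mult_left_mono Etau_bounds(2) elim(2)) simp
      also have "\<dots> = ennreal (tm k)"
        using params phi_pos[OF rad_pos[of k]] by (simp add: tm_def ennreal_of_nat_eq_real_of_nat ennreal_mult)
      finally show ?case unfolding exit_time_less .
    qed
  qed
qed

lemma cdist_ge:
  assumes "X s \<omega> \<notin> Some ` ball y r" shows "ereal (r - dist x y) \<le> cdist x (X s \<omega>)"
proof (cases "X s \<omega>")
  case (Some z)
  then have "dist y z \<ge> r" using assms by auto
  then show ?thesis using dist_triangle[of y z x] Some by (simp add: cdist_def dist_commute)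
qed (simp add: cdist_def)

abbreviation sup_dist :: "'a \<Rightarrow> 'w \<Rightarrow> real \<Rightarrow> ereal" where
  "sup_dist x \<omega> t \<equiv> (SUP s\<in>{0<..t}. cdist x (X s \<omega>)) / ereal (gen_inv \<phi> (t / ln (ln t)))"

text \<open>For \<open>t\<close> between \<open>tm k\<close> and \<open>tm (Suc k)\<close> the path
  has already left the ball of radius \<open>rad k\<close> about \<open>y\<close>, so the supremum
  about \<open>x\<close> is at least \<open>rad k / 2\<close>, against a denominator of at most
  \<open>b * rad k\<close>.\<close>

lemma liminf_lower:
  obtains b1 :: real where "b1 > 0" "\<And>x y. AE \<omega> in P (Some y). ereal b1 \<le> Liminf at_top (sup_dist x \<omega>)"
proof -
  obtain b where b: "b > 0"
    "eventually (\<lambda>k. \<forall>t. tm k \<le> t \<and> t < tm (Suc k) \<longrightarrow> 0 < gen_inv \<phi> (t / ln (ln t)) \<and> gen_inv \<phi> (t / ln (ln t)) \<le> b * rad k) sequentially"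
    by (rule gen_inv_growth) (rule that)
  have "AE \<omega> in P (Some y). ereal (1 / (2 * b)) \<le> Liminf at_top (sup_dist x \<omega>)" for x y
    using exits_eventually[of y]
  proof eventually_elim
    case (elim \<omega>)
    have "eventually (\<lambda>k. 2 * dist x y \<le> rad k) sequentially" using filterlim_rad by (simp add: filterlim_at_top)
    with elim b(2) have "eventually (\<lambda>k. (\<exists>s. 0 < s \<and> s < tm k \<and> X s \<omega> \<notin> Some ` ball y (rad k)) \<and> 2 * dist x y \<le> rad k \<and>
      (\<forall>t. tm k \<le> t \<and> t < tm (Suc k) \<longrightarrow> 0 < gen_inv \<phi> (t / ln (ln t)) \<and> gen_inv \<phi> (t / ln (ln t)) \<le> b * rad k)) sequentially"
      by eventually_elim blast
    then obtain k0 where k0: "\<And>k. k \<ge> k0 \<Longrightarrow> (\<exists>s. 0 < s \<and> s < tm k \<and> X s \<omega> \<notin> Some ` ball y (rad k)) \<and> 2 * dist x y \<le> rad k \<and>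
      (\<forall>t. tm k \<le> t \<and> t < tm (Suc k) \<longrightarrow> 0 < gen_inv \<phi> (t / ln (ln t)) \<and> gen_inv \<phi> (t / ln (ln t)) \<le> b * rad k)"
      unfolding eventually_sequentially by metis
    have "eventually (\<lambda>t. ereal (1 / (2 * b)) \<le> sup_dist x \<omega> t) at_top"
      using eventually_ge_at_top[of "tm k0"]
    proof eventually_elim
      case (elim t)
      have ex: "\<exists>m. m \<ge> k0 \<and> t < tm m"
      proof -
        have c0: "\<phi> (2 * R) / C\<^sup>2 > 0" using phi_pos[of "2*R"] params by simp
        obtain n where n: "t / (\<phi> (2 * R) / C\<^sup>2) < 2 ^ n" using real_arch_pow[of 2] by auto
        also have "(2::real) ^ n \<le> 2 ^ (n + k0)" by (rule power_increasing) auto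
        finally have "t < 2 ^ (n + k0) * (\<phi> (2 * R) / C\<^sup>2)" using c0 by (simp only: pos_divide_less_eq)
        then show ?thesis using tm_ge[of "n + k0"] by (intro exI[of _ "n + k0"]) auto
      qed
      \<comment> \<open>The least such index yields consecutive indices around \<open>t\<close>
        without recourse to monotonicity of \<open>tm\<close>.\<close>
      define m where "m = (LEAST m. m \<ge> k0 \<and> t < tm m)"
      have m: "m \<ge> k0" "t < tm m" using LeastI_ex[OF ex] by (auto simp: m_def)
      have "m \<noteq> k0" using m elim by auto
      then obtain k where k: "m = Suc k" "k \<ge> k0" using m(1) by (cases m) auto
      have "\<not> (k \<ge> k0 \<and> t < tm k)" using not_less_Least[of k "\<lambda>m. m \<ge> k0 \<and> t < tm m"] k by (auto simp: m_def)
      then have t: "tm k \<le> t" "t < tm (Suc k)" using k m by auto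
      obtain s where s: "0 < s" "s < tm k" "X s \<omega> \<notin> Some ` ball y (rad k)" using k0[OF k(2)] by blast
      have g: "0 < gen_inv \<phi> (t / ln (ln t))" "gen_inv \<phi> (t / ln (ln t)) \<le> b * rad k" and dxy: "2 * dist x y \<le> rad k"
        using k0[OF k(2)] t by blast+
      have "ereal (rad k / 2) \<le> ereal (rad k - dist x y)" using dxy by simp
      also have "\<dots> \<le> cdist x (X s \<omega>)" by (rule cdist_ge[OF s(3)])
      also have "\<dots> \<le> (SUP s\<in>{0<..t}. cdist x (X s \<omega>))" using s t by (intro SUP_upper) auto
      finally have "ereal (rad k / 2) / ereal (gen_inv \<phi> (t / ln (ln t))) \<le> sup_dist x \<omega> t"
        using g by (intro ereal_divide_right_mono) auto
      moreover have "ereal (1 / (2 * b)) \<le> ereal (rad k / 2) / ereal (gen_inv \<phi> (t / ln (ln t)))"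
        using g b(1) by (simp add: field_simps)
      ultimately show ?case by (rule order_trans[rotated])
    qed
    then show ?case by (rule Liminf_bounded)
  qed
  then show ?thesis using that[of "1 / (2 * b)"] b(1) by simp
qed

end

section \<open>The upper bound\<close>

context standard_process begin

lemma stopped_sigma_const:
  assumes "A \<in> F \<tau>" "\<tau> \<ge> 0"
  shows "A \<in> stopped_sigma (P None) F (\<lambda>_. ennreal \<tau>)"
  unfolding stopped_sigma_def
proof (intro CollectI conjI allI impI)
  show "A \<in> sets (P None)" using assms F_subset by blast
  then have A: "A \<subseteq> \<Omega>" by (rule sets.sets_into_space)
  fix t :: real assume t: "t \<ge> 0"
  interpret sigma_algebra \<Omega> "F t" by (rule F_sigma[OF t])
  show "A \<inter> {\<omega>\<in>\<Omega>. ennreal \<tau> \<le> ennreal t} \<in> F t"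
  proof (cases "\<tau> \<le> t")
    case True
    then have "A \<inter> {\<omega>\<in>\<Omega>. ennreal \<tau> \<le> ennreal t} = A" using A by (auto intro: ennreal_leI)
    then show ?thesis using F_mono[OF assms(2) True] assms by auto
  next
    case False
    then have "A \<inter> {\<omega>\<in>\<Omega>. ennreal \<tau> \<le> ennreal t} = {}" using t assms by (auto simp: ennreal_le_iff)
    then show ?thesis by (simp only: empty_sets)
  qed
qed

text \<open>This is \<open>strong_markov_upper\<close> at a constant optional time, for which every
  event of \<open>F \<tau>\<close> is admissible.\<close>

lemma markov_exit_bound:
  assumes Q: "Q \<in> F \<tau>" "\<tau> \<ge> 0" and D: "closed D" and \<kappa>: "\<kappa> \<ge> 0"
    and bound: "\<And>\<omega>. \<omega> \<in> Q \<Longrightarrow> measure (P (X \<tau> \<omega>)) {\<omega>\<in>\<Omega>. exit_time X D \<omega> < ennreal t} \<le> \<kappa>"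
    and A: "\<And>\<omega>. \<omega> \<in> A \<Longrightarrow> \<omega> \<in> Q \<and> exit_time X D (\<theta> \<tau> \<omega>) < ennreal t"
  shows "measure (P z) A \<le> \<kappa> * measure (P z) Q"
proof -
  interpret prob_space "P z" by (rule prob_P)
  let ?E = "{\<omega>\<in>Q. (\<lambda>_. ennreal \<tau>) \<omega> < \<top> \<and> \<theta> (enn2real ((\<lambda>_. ennreal \<tau>) \<omega>)) \<omega> \<in> {\<omega>\<in>\<Omega>. exit_time X D \<omega> < ennreal t}}"
  note st = stopped_sigma_const[OF Q]
  have E: "?E \<in> sets (P z)" by (rule shift_exit_sets[OF optional_time_const D st])
  have Qs: "Q \<subseteq> \<Omega>" using Q F_subset sets.sets_into_space by blast
  have "A \<subseteq> ?E"
  proof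
    fix \<omega> assume "\<omega> \<in> A"
    from A[OF this] Qs show "\<omega> \<in> ?E" using Q(2) shift_space[OF Q(2)] by auto
  qed
  then have "prob A \<le> prob ?E" using E by (rule finite_measure_mono)
  also have "\<dots> \<le> \<kappa> * prob Q"
  proof -
    have "emeasure (P z) ?E \<le> ennreal \<kappa> * emeasure (P z) Q"
    proof (rule strong_markov_upper[OF optional_time_stopping[OF optional_time_const] st path_sigma_exit[OF D]])
      fix \<omega> assume "\<omega> \<in> Q"
      then show "emeasure (P (X (enn2real (ennreal \<tau>)) \<omega>)) {\<omega>\<in>\<Omega>. exit_time X D \<omega> < ennreal t} \<le> ennreal \<kappa>"
        using bound Q(2) by (simp add: finite_measure.emeasure_eq_measure[OF prob_space.finite_measure[OF prob_P]] ennreal_leI)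
    qed
    then show ?thesis using \<kappa> by (simp add: emeasure_eq_measure ennreal_mult[symmetric] ennreal_le_iff)
  qed
  finally show ?thesis .
qed

end

context stable_like_process begin

section \<open>Scales and times of the upper bound\<close>

definition srad :: "nat \<Rightarrow> real" where "srad n = ell ^ (n\<^sup>2)"
text \<open>For \<open>n \<ge> 1\<close> the exponent is \<open>(n - 1)^2 + n\<close>. This is
  \<open>n\<close> growth steps above \<open>srad (n - 1)\<close>, so
  \<open>\<phi> (shell n)\<close> dominates \<open>2 ^ n * \<phi> (srad (n - 1))\<close> up to a
  constant, and \<open>n - 1\<close> steps below \<open>srad n\<close>, so that \<open>n\<close>
  shells of this width fit inside.\<close>

definition shell :: "nat \<Rightarrow> real" where "shell n = ell ^ (n\<^sup>2 - n + 1)"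
text \<open>The factor 8 is 2 times 4: the path is examined at \<open>stm n / 2\<close>, and
  \<open>4 * ln n\<close> exceeds the bound \<open>3 * ln n\<close> for the iterated logarithm
  there.\<close>

definition stm :: "nat \<Rightarrow> real" where "stm n = 8 * \<phi> (srad n) * ln (real n)"

lemma srad_pos: "srad n > 0" and shell_pos: "shell n > 0"
  using params by (auto simp: srad_def shell_def)

lemma filterlim_srad: "filterlim srad at_top sequentially"
proof -
  have "filterlim (\<lambda>n::nat. ell powr (real n * real n)) at_top sequentially" using params(4) by real_asymp
  moreover have "ell powr (real n * real n) = srad n" for n
    using params by (simp add: srad_def powr_realpow[symmetric] power2_eq_square)
  ultimately show ?thesis by simp
qed

lemma shell_eq: "shell (Suc n) = ell ^ Suc n * srad n"
proof -
  have "(Suc n)\<^sup>2 - Suc n + 1 = Suc n + n\<^sup>2" by (simp add: power2_eq_square)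
  then show ?thesis unfolding shell_def srad_def by (simp only: power_add)
qed

lemma srad_shell: "ell * srad n = ell ^ n * shell n"
proof -
  have "Suc (n\<^sup>2) = n + (n\<^sup>2 - n + 1)" by (cases n) (auto simp: power2_eq_square)
  then have "ell ^ Suc (n\<^sup>2) = ell ^ (n + (n\<^sup>2 - n + 1))" by (simp only:)
  then show ?thesis unfolding shell_def srad_def by (simp only: power_add power_Suc)
qed

lemma eventually_shell: "eventually (\<lambda>n. (2 * real n + 2) * shell n \<le> srad n) sequentially"
proof -
  have "eventually (\<lambda>n::nat. (2 * real n + 2) * ell \<le> ell ^ n) sequentially" using params(4) by real_asymp
  then show ?thesis
  proof eventually_elim
    case (elim n)
    have "ell * ((2 * real n + 2) * shell n) = (2 * real n + 2) * ell * shell n" by simp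
    also have "\<dots> \<le> ell ^ n * shell n" using elim shell_pos[of n] by (intro mult_right_mono) auto
    also have "\<dots> = ell * srad n" by (simp add: srad_shell)
    finally show ?case using params by simp
  qed
qed

lemma far_mono: "far x r \<Longrightarrow> r \<le> s \<Longrightarrow> far x s" by (simp add: far_def)

text \<open>In this ball \<open>dd ob x\<close> is of order \<open>srad n\<close>, so the threshold
  is of order \<open>ell powr (\<upsilon> * n^2)\<close>. The exponent \<open>n^2 - n + 1\<close> of
  \<open>shell n\<close> eventually beats it because \<open>\<upsilon> < 1\<close>.\<close>

lemma eventually_far_shell:
  assumes K: "K \<ge> 1"
  shows "eventually (\<lambda>n. \<forall>x\<in>cball y (K * srad n). far x (shell n)) sequentially"
proof -
  have d: "1 - \<upsilon> > 0" using params by simp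
  have "filterlim (\<lambda>n::nat. ell powr ((1 - \<upsilon>) * real n ^ 2 - real n + 1)) at_top sequentially"
    using d params(4) by real_asymp
  then have "eventually (\<lambda>n::nat. R * (2 * K) powr \<upsilon> < ell powr ((1 - \<upsilon>) * real n ^ 2 - real n + 1)) sequentially"
    by (simp add: filterlim_at_top_dense)
  moreover have "eventually (\<lambda>n. dist y ob + 1 \<le> srad n) sequentially"
    using filterlim_srad by (simp add: filterlim_at_top)
  ultimately show ?thesis
  proof eventually_elim
    case (elim n)
    show ?case
    proof
      fix x assume x: "x \<in> cball y (K * srad n)"
      have "dd ob x \<le> K * srad n + (dist y ob + 1)"
        using x dist_triangle[of x ob y] by (simp add: dd_def dist_commute)
      also have "\<dots> \<le> K * srad n + 1 * srad n" using elim by simp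
      also have "\<dots> \<le> 2 * K * srad n" using K srad_pos[of n] mult_right_mono[of 1 K "srad n"] by simp
      finally have "dd ob x powr \<upsilon> \<le> (2 * K * srad n) powr \<upsilon>"
        using params by (intro powr_mono2) (auto simp: dd_def)
      also have "\<dots> = (2 * K) powr \<upsilon> * srad n powr \<upsilon>"
        using K srad_pos[of n] by (simp add: powr_mult)
      also have "srad n powr \<upsilon> = ell powr (\<upsilon> * real n ^ 2)"
        using params by (simp add: srad_def powr_realpow[symmetric] powr_powr mult.commute)
      finally have "R * dd ob x powr \<upsilon> \<le> R * ((2 * K) powr \<upsilon> * ell powr (\<upsilon> * real n ^ 2))"
        using params by (intro mult_left_mono) auto
      also have "\<dots> = (R * (2 * K) powr \<upsilon>) * ell powr (\<upsilon> * real n ^ 2)" by simp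
      also have "\<dots> < ell powr ((1 - \<upsilon>) * real n ^ 2 - real n + 1) * ell powr (\<upsilon> * real n ^ 2)"
        using elim params by (intro mult_strict_right_mono) auto
      also have "\<dots> = ell powr (real n ^ 2 - real n + 1)"
        by (simp add: powr_add[symmetric] algebra_simps)
      also have "\<dots> = shell n"
      proof -
        have "n \<le> n\<^sup>2" by (simp add: power2_nat_le_imp_le power2_eq_square)
        then have "real n ^ 2 - real n + 1 = real (n\<^sup>2 - n + 1)" by (simp add: of_nat_diff)
        then show ?thesis unfolding shell_def using params by (simp only: powr_realpow)
      qed
      finally show "far x (shell n)" by (simp add: far_def)
    qed
  qed
qed

text \<open>The last estimate is \<open>phi_growth\<close> over \<open>n\<close> steps from
  \<open>srad (n - 1)\<close> to \<open>shell n\<close>: the time \<open>2 * stm (n - 1)\<close> is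
  short on the scale of a single shell.\<close>

lemma eventually_stm:
  "eventually (\<lambda>n. 0 < stm n \<and> 0 < stm (n - 1) \<and> stm (n - 1) \<le> stm n \<and>
     2 * stm (n - 1) \<le> 16 * C\<^sup>2 * (ln (real n) / 2 ^ n) * \<phi> (shell n)) sequentially"
proof -
  have "eventually (\<lambda>n. R < srad n) sequentially"
    using filterlim_srad by (simp add: filterlim_at_top_dense)
  then obtain N where N: "\<And>n. n \<ge> N \<Longrightarrow> R < srad n" by (auto simp: eventually_sequentially)
  show ?thesis using eventually_ge_at_top[of "N + 3"]
  proof eventually_elim
    case (elim n)
    then obtain m where m: "n = Suc m" "m \<ge> N" "m \<ge> 2" by (cases n) auto
    have p: "\<phi> (srad k) > 0" for k by (rule phi_pos[OF srad_pos])
    have l: "ln (real m) > 0" "ln (real n) > 0" "ln (real m) \<le> ln (real n)" using m by auto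
    have "srad m \<le> srad n" unfolding srad_def using params m by (intro power_increasing) auto
    then have "\<phi> (srad m) \<le> \<phi> (srad n)" by (intro phi_le srad_pos)
    then have "stm m \<le> stm n" unfolding stm_def using p[of m] p[of n] l by (intro mult_mono) auto
    moreover have "stm m > 0" "stm n > 0" using p l by (auto simp: stm_def)
    moreover have "2 * stm m \<le> 16 * C\<^sup>2 * (ln (real n) / 2 ^ n) * \<phi> (shell n)"
    proof -
      have "2 ^ n * \<phi> (srad m) \<le> C\<^sup>2 * \<phi> (shell n)"
        using phi_growth[OF N[OF m(2)], of n] m(1) by (simp only: shell_eq)
      then have "16 * (ln (real n) / 2 ^ n) * (2 ^ n * \<phi> (srad m)) \<le> 16 * (ln (real n) / 2 ^ n) * (C\<^sup>2 * \<phi> (shell n))"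
        using l by (intro mult_left_mono) auto
      moreover have "2 * stm m \<le> 16 * (ln (real n) / 2 ^ n) * (2 ^ n * \<phi> (srad m))"
        using l p[of m] by (simp add: stm_def)
      ultimately show ?thesis by (simp add: mult_ac)
    qed
    ultimately show ?case using m(1) by simp
  qed
qed

lemma stay_const_le_1: "stay_const \<le> 1"
proof -
  have "ennreal stay_const \<le> emeasure (P (Some ob)) immortal" by (rule survival)
  also have "\<dots> \<le> 1" by (rule prob_space.emeasure_le_1[OF prob_P])
  finally show ?thesis by (simp add: ennreal_le_1)
qed

text \<open>\<open>exit_tail\<close> with \<open>n\<close> shells of width \<open>shell n\<close>:
  the shell term is geometric, the jump term of order \<open>ln n / 2 ^ n\<close>. The doubled time
  lets the event cover the instant \<open>stm (n - 1)\<close> itself.\<close>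

lemma early_exit_summable:
  "summable (\<lambda>n. measure (P (Some y)) {\<omega>\<in>\<Omega>. exit_time X (cball y (srad n)) \<omega> < ennreal (2 * stm (n - 1))})"
proof (rule summable_comparison_test_ev)
  \<comment> \<open>\<open>(3 / 4) ^ n\<close> dominates \<open>ln n / 2 ^ n\<close>, because
    eventually \<open>ln n \<le> (3 / 2) ^ n\<close>.\<close>
  let ?g = "\<lambda>n. (1 - stay_const) ^ n + (C3 * C * (16 * C\<^sup>2)) * (3 / 4) ^ n"
  show "summable ?g" using stay_const_pos stay_const_le_1
    by (intro summable_add summable_mult summable_geometric) auto
  have "eventually (\<lambda>n::nat. ln (real n) \<le> (3 / 2) ^ n) sequentially" by real_asymp
  then have e1: "eventually (\<lambda>n::nat. ln (real n) / 2 ^ n \<le> (3 / 4) ^ n) sequentially"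
  proof eventually_elim
    case (elim n)
    have "(3 / 4 :: real) ^ n = (3 / 2) ^ n / 2 ^ n" by (simp add: power_divide[symmetric])
    then show ?case using elim by (simp add: divide_right_mono)
  qed
  have "(\<lambda>n::nat. 16 * C\<^sup>2 * (ln (real n) / 2 ^ n)) \<longlonglongrightarrow> 0" by real_asymp
  then have e2: "eventually (\<lambda>n::nat. 16 * C\<^sup>2 * (ln (real n) / 2 ^ n) < 1 / C) sequentially"
    by (rule order_tendstoD) (use params in simp)
  show "eventually (\<lambda>n. norm (measure (P (Some y)) {\<omega>\<in>\<Omega>. exit_time X (cball y (srad n)) \<omega> < ennreal (2 * stm (n - 1))}) \<le> ?g n) sequentially"
    using e1 e2 eventually_stm eventually_shell eventually_far_shell[of 1 y, OF order_refl]
  proof eventually_elim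
    case (elim n)
    interpret prob_space "P (Some y)" by (rule prob_P)
    have ps: "\<phi> (shell n) > 0" by (rule phi_pos[OF shell_pos])
    have "2 * stm (n - 1) \<le> 16 * C\<^sup>2 * (ln (real n) / 2 ^ n) * \<phi> (shell n)" using elim by blast
    also have "\<dots> \<le> 1 / C * \<phi> (shell n)" using elim(2) ps by (intro mult_right_mono) auto
    finally have t: "2 * stm (n - 1) \<le> \<phi> (shell n) / C" by simp
    have sub: "cball y ((2 * real n + 2) * shell n) \<subseteq> cball y (1 * srad n)"
      using elim(4) by (intro subset_cball) simp
    have sub2: "cball y ((2 * real n + 1) * shell n) \<subseteq> cball y (srad n)"
      using elim(4) shell_pos[of n] by (intro subset_cball) (simp add: algebra_simps)
    have "prob {\<omega>\<in>\<Omega>. exit_time X (cball y (srad n)) \<omega> < ennreal (2 * stm (n - 1))}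
      \<le> prob {\<omega>\<in>\<Omega>. exit_time X (cball y ((2 * real n + 1) * shell n)) \<omega> < ennreal (2 * stm (n - 1))}"
    proof (rule finite_measure_mono)
      show "{\<omega>\<in>\<Omega>. exit_time X (cball y (srad n)) \<omega> < ennreal (2 * stm (n - 1))}
        \<subseteq> {\<omega>\<in>\<Omega>. exit_time X (cball y ((2 * real n + 1) * shell n)) \<omega> < ennreal (2 * stm (n - 1))}"
        using exit_time_mono[OF sub2] by (auto intro: le_less_trans)
      show "{\<omega>\<in>\<Omega>. exit_time X (cball y ((2 * real n + 1) * shell n)) \<omega> < ennreal (2 * stm (n - 1))} \<in> events"
        using elim(3) by (intro optional_time_sets(1) optional_time_exit) auto
    qed
    also have "\<dots> \<le> (1 - stay_const) ^ n + 2 * stm (n - 1) * (C3 * C / \<phi> (shell n))"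
      by (rule exit_tail[OF shell_pos _ _ t]) (use elim sub in auto)
    also have "2 * stm (n - 1) * (C3 * C / \<phi> (shell n)) \<le> (C3 * C * (16 * C\<^sup>2)) * (3 / 4) ^ n"
    proof -
      have "2 * stm (n - 1) * (C3 * C / \<phi> (shell n)) \<le> (16 * C\<^sup>2 * (ln (real n) / 2 ^ n) * \<phi> (shell n)) * (C3 * C / \<phi> (shell n))"
        using elim(3) params ps by (intro mult_right_mono) auto
      also have "\<dots> = (C3 * C * (16 * C\<^sup>2)) * (ln (real n) / 2 ^ n)" using ps by simp
      also have "\<dots> \<le> (C3 * C * (16 * C\<^sup>2)) * (3 / 4) ^ n" using elim(1) params by (intro mult_left_mono) auto
      finally show ?thesis .
    qed
    finally show ?case by simp
  qed
qed

text \<open>With \<open>m\<close> about \<open>ln n / C5\<close>, (B4) gives a probability of order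
  \<open>1 / n\<close>. The larger radius lets \<open>m\<close> time units reach
  \<open>stm n\<close>: in the condition on \<open>j\<close>, 8 comes from \<open>stm\<close>,
  \<open>C5\<close> from \<open>m\<close>, \<open>C\<^sup>2\<close> from \<open>phi_growth\<close>
  and one more \<open>C\<close> from the unit \<open>\<phi> r / C\<close>.\<close>

lemma stay_long:
  assumes j: "8 * C5 * C ^ 3 \<le> 2 ^ j"
  shows "eventually (\<lambda>n. \<forall>z\<in>cball y (ell ^ j * srad n).
    measure (P (Some z)) {\<omega>\<in>\<Omega>. exit_time X (cball y (2 * (ell ^ j * srad n))) \<omega> < ennreal (stm n)} \<le> 1 - C4 * exp (- C5) / real n) sequentially"
proof -
  have ell1: "ell ^ j \<ge> 1" using params by simp
  have "eventually (\<lambda>n. R < srad n) sequentially"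
    using filterlim_srad by (simp add: filterlim_at_top_dense)
  then show ?thesis using eventually_far_shell[OF ell1, of y] eventually_shell eventually_ge_at_top[of 2]
  proof eventually_elim
    case (elim n)
    show ?case
    proof
      fix z assume z: "z \<in> cball y (ell ^ j * srad n)"
      have "shell n \<le> srad n"
      proof -
        have "1 * shell n \<le> (2 * real n + 2) * shell n" using shell_pos[of n] by (intro mult_right_mono) auto
        then show ?thesis using elim(3) by simp
      qed
      also have "\<dots> \<le> ell ^ j * srad n" using ell1 srad_pos[of n] by simp
      finally have far: "far z (ell ^ j * srad n)" using elim(2) z far_mono by blast
      \<comment> \<open>Rounding up costs at most one more unit, that is the factor
        \<open>exp (- C5)\<close>.\<close>
      define m where "m = nat \<lceil>ln (real n) / C5\<rceil>"
      have ln0: "ln (real n) > 0" using elim(4) by simp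
      have "ln (real n) / C5 > 0" using ln0 params by simp
      then have m: "m \<ge> 1" "ln (real n) / C5 \<le> real m" "real m \<le> ln (real n) / C5 + 1"
        unfolding m_def by linarith+
      have ph: "2 ^ j * \<phi> (srad n) \<le> C\<^sup>2 * \<phi> (ell ^ j * srad n)" by (rule phi_growth[OF elim(1)])
      have "stm n * C ^ 3 * C5 = ln (real n) * \<phi> (srad n) * (8 * C5 * C ^ 3)" by (simp add: stm_def)
      also have "\<dots> \<le> ln (real n) * \<phi> (srad n) * 2 ^ j"
        using j ln0 phi_pos[OF srad_pos[of n]] by (intro mult_left_mono) auto
      also have "\<dots> \<le> ln (real n) * (C\<^sup>2 * \<phi> (ell ^ j * srad n))" using ph ln0 by (simp add: mult_ac)
      finally have "stm n \<le> ln (real n) / C5 * (\<phi> (ell ^ j * srad n) / C)"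
        using params by (simp add: field_simps power2_eq_square power3_eq_cube)
      also have "\<dots> \<le> real m * (\<phi> (ell ^ j * srad n) / C)"
        using m(2) params phi_pos[of "ell ^ j * srad n"] srad_pos[of n] by (intro mult_right_mono) auto
      finally have t: "stm n \<le> real m * (\<phi> (ell ^ j * srad n) / C)" .
      have sub: "ball z (ell ^ j * srad n) \<subseteq> cball y (2 * (ell ^ j * srad n))"
      proof
        fix v assume "v \<in> ball z (ell ^ j * srad n)"
        then show "v \<in> cball y (2 * (ell ^ j * srad n))" using dist_triangle[of y v z] z by simp
      qed
      have "measure (P (Some z)) {\<omega>\<in>\<Omega>. exit_time X (cball y (2 * (ell ^ j * srad n))) \<omega> < ennreal (stm n)} \<le> 1 - C4 * exp (- C5 * real m)"
        by (rule stay_prob[OF far _ sub m(1) t]) simp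
      moreover have "C4 * exp (- C5) / real n \<le> C4 * exp (- C5 * real m)"
      proof -
        have "C5 * real m \<le> ln (real n) + C5" using m(3) params by (simp add: field_simps)
        then have "exp (- C5 - ln (real n)) \<le> exp (- C5 * real m)" by simp
        moreover have "exp (- C5 - ln (real n)) = exp (- C5) / real n" using elim(4) by (simp add: exp_diff)
        ultimately have "C4 * (exp (- C5) / real n) \<le> C4 * exp (- C5 * real m)"
          using params by (intro mult_left_mono) auto
        then show ?thesis by simp
      qed
      ultimately show "measure (P (Some z)) {\<omega>\<in>\<Omega>. exit_time X (cball y (2 * (ell ^ j * srad n))) \<omega> < ennreal (stm n)} \<le> 1 - C4 * exp (- C5) / real n"
        by linarith
    qed
  qed
qed

text \<open>A conditional Borel-Cantelli argument: given a past with \<open>ok n\<close>, failure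
  has probability at most \<open>1 - c / n\<close>, and the product of these factors tends to 0. So
  infinitely often either \<open>fail n\<close> or \<open>ok n\<close> is violated, and the latter
  happens only finitely often by \<open>early_exit_summable\<close>.\<close>

lemma stays_infinitely_often:
  assumes j: "8 * C5 * C ^ 3 \<le> 2 ^ j"
  shows "AE \<omega> in P (Some y). \<forall>N. \<exists>n>N. \<not> exit_time X (cball y (2 * (ell ^ j * srad n))) \<omega> < ennreal (stm n)"
proof -
  interpret prob_space "P (Some y)" by (rule prob_P)
  define b where "b = ell ^ j"
  define c where "c = C4 * exp (- C5)"
  have b: "b \<ge> 1" using params by (simp add: b_def)
  have c: "c > 0" using params by (simp add: c_def)
  define fail where "fail n \<omega> \<longleftrightarrow> exit_time X (cball y (2 * (b * srad n))) \<omega> < ennreal (stm n)" for n \<omega>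
  \<comment> \<open>The position at \<open>stm (n - 1)\<close> is listed separately, since the exit
    condition sees only earlier times.\<close>
  define ok where "ok n \<omega> \<longleftrightarrow> \<not> exit_time X (cball y (b * srad n)) \<omega> < ennreal (stm (n - 1)) \<and>
     \<not> X (stm (n - 1)) \<omega> \<in> - Some ` cball y (b * srad n)" for n \<omega>
  have "eventually (\<lambda>n. (0 < stm n \<and> 0 < stm (n - 1) \<and> stm (n - 1) \<le> stm n) \<and>
     (\<forall>z\<in>cball y (b * srad n). measure (P (Some z)) {\<omega>\<in>\<Omega>. fail n \<omega>} \<le> 1 - c / real n)) sequentially"
    using eventually_stm stay_long[OF j, of y] by eventually_elim (simp add: b_def c_def fail_def)
  then obtain N0 where N0: "\<And>n. n \<ge> N0 \<Longrightarrow> 0 < stm n" "\<And>n. n \<ge> N0 \<Longrightarrow> 0 < stm (n - 1)" "\<And>n. n \<ge> N0 \<Longrightarrow> stm (n - 1) \<le> stm n"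
    "\<And>n z. n \<ge> N0 \<Longrightarrow> z \<in> cball y (b * srad n) \<Longrightarrow> measure (P (Some z)) {\<omega>\<in>\<Omega>. fail n \<omega>} \<le> 1 - c / real n"
    unfolding eventually_sequentially by blast
  \<comment> \<open>With indices up to \<open>M\<close> the event lies in \<open>F (stm M)\<close>,
    and so does \<open>ok (Suc M)\<close>: both are known when the attempt with index
    \<open>Suc M\<close> starts.\<close>
  define Q where "Q N M = {\<omega>\<in>\<Omega>. \<forall>n\<in>{N<..M}. fail n \<omega> \<and> ok n \<omega>}" for N M
  have fail_F: "{\<omega>\<in>\<Omega>. fail n \<omega>} \<in> F (stm n)" if "n \<ge> N0" for n
    unfolding fail_def using N0(1)[OF that] by (intro optional_timeD optional_time_exit) auto
  have ok_F: "{\<omega>\<in>\<Omega>. ok n \<omega>} \<in> F (stm (n - 1))" if n: "n \<ge> N0" for n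
  proof -
    have t: "0 < stm (n - 1)" by (rule N0(2)[OF n])
    interpret sigma_algebra \<Omega> "F (stm (n - 1))" using F_sigma t by simp
    have op: "open (Some -` (- Some ` cball y (b * srad n)))" by (auto simp: vimage_Compl inj_vimage_image_eq open_Compl)
    have "{\<omega>\<in>\<Omega>. \<not> X (stm (n - 1)) \<omega> \<in> - Some ` cball y (b * srad n)} \<in> F (stm (n - 1))"
      by (intro sets_Collect_neg F_X op) (use t in auto)
    moreover have "{\<omega>\<in>\<Omega>. \<not> exit_time X (cball y (b * srad n)) \<omega> < ennreal (stm (n - 1))} \<in> F (stm (n - 1))"
      by (intro sets_Collect_neg optional_timeD optional_time_exit) (use t in auto)
    ultimately show ?thesis unfolding ok_def by (intro sets_Collect_conj)
  qed
  have Q_F: "Q N M \<in> F (stm M)" if "M \<ge> N" "N \<ge> N0" for N M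
    using that(1)
  proof (induction M rule: dec_induct)
    case base
    interpret sigma_algebra \<Omega> "F (stm N)" using F_sigma N0(1)[OF that(2)] by simp
    show ?case by (simp add: Q_def)
  next
    case (step M)
    have S: "Suc M \<ge> N0" "M \<ge> N0" using step that by auto
    have mono: "F (stm M) \<subseteq> F (stm (Suc M))" using N0(3)[OF S(1)] N0(1)[OF S(2)] by (intro F_mono) auto
    interpret sigma_algebra \<Omega> "F (stm (Suc M))" using F_sigma N0(1)[OF S(1)] by simp
    have "{N<..Suc M} = insert (Suc M) {N<..M}" using step by auto
    then have "Q N (Suc M) = Q N M \<inter> ({\<omega>\<in>\<Omega>. fail (Suc M) \<omega>} \<inter> {\<omega>\<in>\<Omega>. ok (Suc M) \<omega>})" by (auto simp: Q_def)
    then show ?case using step.IH mono fail_F[OF S(1)] ok_F[OF S(1)] by auto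
  qed
  have Qs: "Q N M \<in> events" if "M \<ge> N" "N \<ge> N0" for N M
    using Q_F[OF that] F_sets[of "stm M"] N0(1)[of M] that by auto
  have Q_le: "prob (Q N M) \<le> exp (- c * (ln (real M + 1) - ln (real N + 1)))" if "M \<ge> N" "N \<ge> N0" for N M
    using that(1)
  proof (induction M rule: dec_induct)
    case base then show ?case by simp
  next
    case (step M)
    have S: "Suc M \<ge> N0" "M \<ge> N0" using step that by auto
    have tM: "stm M > 0" "stm M \<le> stm (Suc M)" using N0(1)[OF S(2)] N0(3)[OF S(1)] by auto
    define Q' where "Q' = Q N M \<inter> {\<omega>\<in>\<Omega>. ok (Suc M) \<omega>}"
    interpret FM: sigma_algebra \<Omega> "F (stm M)" using F_sigma tM by simp
    have Q': "Q' \<in> F (stm M)" using Q_F[OF step(1) that(2)] ok_F[OF S(1)] by (auto simp: Q'_def)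
    have ob0: "y \<in> cball y (b * srad (Suc M))" using b srad_pos[of "Suc M"] by simp
    have \<kappa>: "0 \<le> 1 - c / real (Suc M)"
      using N0(4)[OF S(1) ob0] measure_nonneg order_trans by blast
    have "prob (Q N (Suc M)) \<le> (1 - c / real (Suc M)) * prob Q'"
    proof (rule markov_exit_bound[OF Q' _ _ \<kappa>, where D = "cball y (2 * (b * srad (Suc M)))" and t = "stm (Suc M)"])
      fix \<omega> assume "\<omega> \<in> Q'"
      then have "X (stm M) \<omega> \<in> Some ` cball y (b * srad (Suc M))" by (auto simp: Q'_def ok_def)
      then show "measure (P (X (stm M) \<omega>)) {\<omega>\<in>\<Omega>. exit_time X (cball y (2 * (b * srad (Suc M)))) \<omega> < ennreal (stm (Suc M))} \<le> 1 - c / real (Suc M)"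
        using N0(4)[OF S(1)] by (auto simp: fail_def)
    next
      fix \<omega> assume w: "\<omega> \<in> Q N (Suc M)"
      then have wO: "\<omega> \<in> \<Omega>" and f: "fail (Suc M) \<omega>" and o: "ok (Suc M) \<omega>" and wQ: "\<omega> \<in> Q'"
        using step(1) by (auto simp: Q_def Q'_def)
      obtain s where s: "0 < s" "s < stm (Suc M)" "X s \<omega> \<notin> Some ` cball y (2 * (b * srad (Suc M)))"
        using f unfolding fail_def exit_time_less by blast
      have sub: "cball y (b * srad (Suc M)) \<subseteq> cball y (2 * (b * srad (Suc M)))"
        using b srad_pos[of "Suc M"] by (intro subset_cball) simp
      \<comment> \<open>By \<open>ok (Suc M)\<close> no exit occurs up to and including time
        \<open>stm M\<close>, so the shifted path sees it.\<close>
      have "stm M < s"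
      proof (rule ccontr)
        assume "\<not> stm M < s"
        then consider "s < stm M" | "s = stm M" by linarith
        then show False
        proof cases
          case 1
          have "X s \<omega> \<notin> Some ` cball y (b * srad (Suc M))" using s(3) sub by blast
          then have "exit_time X (cball y (b * srad (Suc M))) \<omega> < ennreal (stm M)"
            unfolding exit_time_less using s(1) 1 by blast
          then show False using o by (simp add: ok_def)
        next
          case 2
          then show False using o s(3) sub by (auto simp: ok_def)
        qed
      qed
      then have "X (s - stm M) (\<theta> (stm M) \<omega>) \<notin> Some ` cball y (2 * (b * srad (Suc M)))"
        using shift[of "stm M" "s - stm M" \<omega>] wO s(3) tM by simp
      then have "exit_time X (cball y (2 * (b * srad (Suc M)))) (\<theta> (stm M) \<omega>) < ennreal (stm (Suc M))"
        unfolding exit_time_less using \<open>stm M < s\<close> s(2) tM by (intro exI[of _ "s - stm M"]) auto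
      then show "\<omega> \<in> Q' \<and> exit_time X (cball y (2 * (b * srad (Suc M)))) (\<theta> (stm M) \<omega>) < ennreal (stm (Suc M))"
        using wQ by simp
    qed (use tM in auto)
    also have "\<dots> \<le> (1 - c / real (Suc M)) * exp (- c * (ln (real M + 1) - ln (real N + 1)))"
    proof (intro mult_left_mono \<kappa>)
      have "prob Q' \<le> prob (Q N M)" using Qs[OF step(1) that(2)] by (intro finite_measure_mono) (auto simp: Q'_def)
      then show "prob Q' \<le> exp (- c * (ln (real M + 1) - ln (real N + 1)))" using step.IH by linarith
    qed
    \<comment> \<open>\<open>1 - x \<le> exp (- x)\<close> together with
      \<open>ln (M + 2) - ln (M + 1) \<le> 1 / (M + 1)\<close> makes the exponents
      telescope.\<close>
    also have "\<dots> \<le> exp (- c * (ln (real M + 2) - ln (real M + 1))) * exp (- c * (ln (real M + 1) - ln (real N + 1)))"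
    proof (rule mult_right_mono)
      have "ln (real M + 2) - ln (real M + 1) = ln (1 + 1 / (real M + 1))"
      proof -
        have "1 + 1 / (real M + 1) = (real M + 2) / (real M + 1)" by (simp add: field_simps)
        then show ?thesis by (simp add: ln_div)
      qed
      also have "\<dots> \<le> 1 / (real M + 1)" by (rule ln_add_one_self_le_self) simp
      finally have "c * (ln (real M + 2) - ln (real M + 1)) \<le> c * (1 / (real M + 1))" using c by (intro mult_left_mono) auto
      moreover have "1 + (- (c / real (Suc M))) \<le> exp (- (c / real (Suc M)))" by (rule exp_ge_add_one_self)
      moreover have "exp (- (c / real (Suc M))) \<le> exp (- c * (ln (real M + 2) - ln (real M + 1)))"
        using calculation(1) by (simp add: add.commute)
      ultimately show "1 - c / real (Suc M) \<le> exp (- c * (ln (real M + 2) - ln (real M + 1)))" by linarith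
    qed simp
    also have "\<dots> = exp (- c * (ln (real (Suc M) + 1) - ln (real N + 1)))"
      by (simp add: exp_add[symmetric] algebra_simps)
    finally show ?case .
  qed
  have ae1: "AE \<omega> in P (Some y). \<forall>N\<ge>N0. \<exists>n>N. \<not> fail n \<omega> \<or> \<not> ok n \<omega>"
  proof -
    have "AE \<omega> in P (Some y). N \<ge> N0 \<longrightarrow> (\<exists>n>N. \<not> fail n \<omega> \<or> \<not> ok n \<omega>)" for N
    proof (cases "N \<ge> N0")
      case True
      define E where "E = (\<Inter>M. Q N (N + M))"
      have E: "E \<in> events" unfolding E_def using Qs True by auto
      have "prob E \<le> exp (- c * (ln (real (N + M) + 1) - ln (real N + 1)))" for M
      proof -
        have "prob E \<le> prob (Q N (N + M))" using Qs True by (intro finite_measure_mono) (auto simp: E_def)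
        also have "\<dots> \<le> exp (- c * (ln (real (N + M) + 1) - ln (real N + 1)))" using True by (intro Q_le) auto
        finally show ?thesis .
      qed
      moreover have "(\<lambda>M::nat. exp (- c * (ln (real N + real M + 1) - ln (real N + 1)))) \<longlonglongrightarrow> 0"
        using c by real_asymp
      ultimately have "prob E \<le> 0" by (intro LIMSEQ_le_const[where X = "\<lambda>M. exp (- c * (ln (real (N + M) + 1) - ln (real N + 1)))"]) auto
      then have "prob E = 0" using measure_nonneg[of "P (Some y)" E] by linarith
      then have "E \<in> null_sets (P (Some y))" using E by (simp add: null_sets_def emeasure_eq_measure)
      then have "AE \<omega> in P (Some y). \<omega> \<notin> E" by (rule AE_not_in)
      then show ?thesis using AE_space_Omega by eventually_elim (fastforce simp: E_def Q_def)
    qed simp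
    then show ?thesis by (simp add: AE_all_countable)
  qed
  \<comment> \<open>Both ways of violating \<open>ok n\<close> lead to an exit from
    \<open>cball y (srad n)\<close> before \<open>2 * stm (n - 1)\<close>.\<close>
  define D where "D n = {\<omega>\<in>\<Omega>. exit_time X (cball y (srad n)) \<omega> < ennreal (2 * stm (n - 1))}" for n
  have D: "D n \<in> events" for n
    unfolding D_def
  proof (cases "stm (n - 1) > 0")
    case True
    then show "{\<omega>\<in>\<Omega>. exit_time X (cball y (srad n)) \<omega> < ennreal (2 * stm (n - 1))} \<in> events"
      by (intro optional_time_sets(1) optional_time_exit) auto
  next
    case False
    then have "ennreal (2 * stm (n - 1)) = 0" by (simp add: ennreal_neg)
    then show "{\<omega>\<in>\<Omega>. exit_time X (cball y (srad n)) \<omega> < ennreal (2 * stm (n - 1))} \<in> events" by simp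
  qed
  have "AE \<omega> in P (Some y). eventually (\<lambda>n. \<omega> \<in> space (P (Some y)) - D n) sequentially"
    using D early_exit_summable[of y] by (intro borel_cantelli_AE1) (auto simp: emeasure_eq_measure D_def)
  with ae1 AE_space_Omega show ?thesis
  proof eventually_elim
    case (elim \<omega>)
    obtain N1 where N1: "\<And>n. n \<ge> N1 \<Longrightarrow> \<omega> \<notin> D n" using elim(3) by (auto simp: eventually_sequentially)
    show ?case
    proof
      fix N
      have "N0 \<le> max N (max N0 N1)" by simp
      then obtain n where n: "n > max N (max N0 N1)" "\<not> fail n \<omega> \<or> \<not> ok n \<omega>" using elim(1) by blast
      have t: "0 < stm (n - 1)" using N0(2)[of n] n by simp
      have "ok n \<omega>"
      proof (rule ccontr)
        assume "\<not> ok n \<omega>"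
        then have "\<exists>s. 0 < s \<and> s < 2 * stm (n - 1) \<and> X s \<omega> \<notin> Some ` cball y (b * srad n)"
        proof (cases "exit_time X (cball y (b * srad n)) \<omega> < ennreal (stm (n - 1))")
          case True
          then obtain s where "0 < s" "s < stm (n - 1)" "X s \<omega> \<notin> Some ` cball y (b * srad n)" unfolding exit_time_less by blast
          then show ?thesis using t by (intro exI[of _ s]) auto
        next
          case False
          then have "X (stm (n - 1)) \<omega> \<notin> Some ` cball y (b * srad n)" using \<open>\<not> ok n \<omega>\<close> by (simp add: ok_def)
          then show ?thesis using t by (intro exI[of _ "stm (n - 1)"]) auto
        qed
        moreover have "cball y (srad n) \<subseteq> cball y (b * srad n)" using b srad_pos[of n] by (intro subset_cball) simp
        ultimately have "\<omega> \<in> D n" unfolding D_def using elim(2) by (auto simp: exit_time_less)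
        then show False using N1[of n] n by simp
      qed
      then show "\<exists>n>N. \<not> exit_time X (cball y (2 * (ell ^ j * srad n))) \<omega> < ennreal (stm n)"
        using n by (intro exI[of _ n]) (auto simp: fail_def b_def)
    qed
  qed
qed

lemma filterlim_stm: "filterlim stm at_top sequentially"
proof (rule filterlim_at_top_mono)
  show "filterlim (\<lambda>n. \<phi> (srad n)) at_top sequentially" by (rule filterlim_compose[OF phi_at_top filterlim_srad])
  show "eventually (\<lambda>n. \<phi> (srad n) \<le> stm n) sequentially"
    using eventually_ge_at_top[of 3]
  proof eventually_elim
    case (elim n)
    have "ln (real 3) \<le> ln (real n)" using elim by (subst ln_le_cancel_iff) auto
    then have "1 \<le> 8 * ln (real n)" using ln3_gt_1 by simp
    then have "\<phi> (srad n) * 1 \<le> \<phi> (srad n) * (8 * ln (real n))"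
      using phi_pos[OF srad_pos[of n]] by (intro mult_left_mono) auto
    then show ?case by (simp add: stm_def mult_ac)
  qed
qed

text \<open>\<open>\<phi>\<close> grows at most polynomially, so \<open>ln (\<phi> (srad n))\<close>
  is O(n^2) and the iterated logarithm of \<open>stm n / 2\<close> is at most
  \<open>3 * ln n\<close>. The factor \<open>4 * ln n\<close> contained in \<open>stm n / 2\<close>
  outweighs it.\<close>

lemma eventually_gen_inv_ge:
  "eventually (\<lambda>n. srad n \<le> gen_inv \<phi> (stm n / 2 / ln (ln (stm n / 2)))) sequentially"
proof -
  obtain q where q: "ell < 2 ^ q" using real_arch_pow[of 2] by auto
  define d where "d = ln (C\<^sup>2 * \<phi> (2 * R))"
  \<comment> \<open>The absolute value makes the bound independent of the sign of
    \<open>ln C2\<close>, and the \<open>+ 1\<close> keeps \<open>k\<close> positive.\<close>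
  define k where "k = real q * \<bar>ln C2\<bar> + 1"
  have k: "k > 0" by (simp add: k_def add_nonneg_pos)
  have R: "2 * R > R" "2 * R \<ge> 1" using params by auto
  have bound: "ln (\<phi> (srad n)) \<le> d + k * real n ^ 2" for n
  proof -
    have "srad n \<le> (2 ^ q) ^ (n\<^sup>2)" unfolding srad_def using q params by (intro power_mono) auto
    also have "\<dots> \<le> 2 ^ (q * n\<^sup>2) * (2 * R)" using R(2) by (simp add: power_mult)
    finally have "\<phi> (srad n) \<le> \<phi> (2 ^ (q * n\<^sup>2) * (2 * R))" by (intro phi_le srad_pos)
    also have "\<dots> \<le> C\<^sup>2 * C2 ^ (q * n\<^sup>2) * \<phi> (2 * R)" by (rule phi_doubling[OF R(1)])
    finally have "ln (\<phi> (srad n)) \<le> ln ((C\<^sup>2 * \<phi> (2 * R)) * C2 ^ (q * n\<^sup>2))"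
      using phi_pos[OF srad_pos[of n]] by (subst ln_le_cancel_iff) (auto simp: mult_ac)
    also have "\<dots> = d + real (q * n\<^sup>2) * ln C2"
      unfolding d_def using params phi_pos[of "2 * R"] by (subst ln_mult) (auto simp: ln_realpow)
    also have "\<dots> \<le> d + k * real n ^ 2"
    proof -
      have "real (q * n\<^sup>2) * ln C2 \<le> real (q * n\<^sup>2) * \<bar>ln C2\<bar>" by (intro mult_left_mono) auto
      also have "\<dots> = (real q * \<bar>ln C2\<bar>) * real n ^ 2" by simp
      also have "\<dots> \<le> k * real n ^ 2" unfolding k_def by (intro mult_right_mono) auto
      finally show ?thesis by simp
    qed
    finally show ?thesis .
  qed
  \<comment> \<open>The cube beats the quadratic bound and becomes the 3 in
    \<open>3 * ln n\<close>.\<close>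
  have e1: "eventually (\<lambda>n::nat. ln 4 + ln (ln (real n)) + d + k * real n ^ 2 \<le> real n ^ 3) sequentially"
    using k by real_asymp
  have e2: "eventually (\<lambda>n. 2 * exp 1 < stm n) sequentially"
    using filterlim_stm by (simp add: filterlim_at_top_dense)
  show ?thesis using e1 e2 eventually_ge_at_top[of 3]
  proof eventually_elim
    case (elim n)
    define s where "s = stm n / 2"
    have p: "\<phi> (srad n) > 0" by (rule phi_pos[OF srad_pos])
    have ln0: "ln (real n) > 0" using elim by simp
    have s: "s = 4 * \<phi> (srad n) * ln (real n)" by (simp add: s_def stm_def)
    have "exp 1 < s" using elim by (simp add: s_def)
    then have s1: "ln s > 1" 
      using ln_less_cancel_iff[of "exp 1" s] less_trans[OF exp_gt_zero[of 1]] by simp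
    have "ln s = ln 4 + ln (\<phi> (srad n)) + ln (ln (real n))"
      unfolding s using p ln0 by (simp add: ln_mult)
    also have "\<dots> \<le> real n ^ 3" using bound[of n] elim by linarith
    finally have "ln (ln s) \<le> ln (real n ^ 3)" using s1 elim(3) by (subst ln_le_cancel_iff) auto
    also have "\<dots> = 3 * ln (real n)" using elim by (simp add: ln_realpow)
    also have "\<dots> \<le> 4 * ln (real n)" using ln0 by simp
    finally have "\<phi> (srad n) * ln (ln s) \<le> \<phi> (srad n) * (4 * ln (real n))" using p by (intro mult_left_mono) auto
    also have "\<dots> = s" by (simp add: s)
    finally have "\<phi> (srad n) \<le> s / ln (ln s)" using s1 by (simp add: field_simps)
    then show ?case unfolding s_def by (rule gen_inv_ge[OF srad_pos])
  qed
qed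

text \<open>Arbitrarily large \<open>t\<close> with ratio at most \<open>3 * b\<close> suffice:
  \<open>2 * b\<close> comes from the ball about \<open>y\<close>, and \<open>b\<close> covers the
  distance from \<open>x\<close> to \<open>y\<close>. The choice \<open>t = stm n / 2\<close>
  matters because the supremum includes time \<open>t\<close>, while absence of an exit before
  \<open>stm n\<close> controls only earlier times.\<close>

lemma liminf_upper:
  obtains b2 :: real where "\<And>x y. AE \<omega> in P (Some y). Liminf at_top (sup_dist x \<omega>) \<le> ereal b2"
proof -
  obtain j where j: "8 * C5 * C ^ 3 < 2 ^ j" using real_arch_pow[of 2] by auto
  define b where "b = ell ^ j"
  have b: "b \<ge> 1" using params by (simp add: b_def)
  have "AE \<omega> in P (Some y). Liminf at_top (sup_dist x \<omega>) \<le> ereal (3 * b)" for x y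
    using stays_infinitely_often[OF less_imp_le[OF j], of y]
  proof eventually_elim
    case (elim \<omega>)
    show ?case
    proof (rule ccontr)
      assume "\<not> Liminf at_top (sup_dist x \<omega>) \<le> ereal (3 * b)"
      then have "eventually (\<lambda>t. ereal (3 * b) < sup_dist x \<omega> t) at_top" 
        by (intro less_LiminfD) (simp add: not_le)
      moreover have "filterlim (\<lambda>n. stm n / 2) at_top sequentially"
        using filterlim_at_top_mult_tendsto_pos[OF tendsto_const[of "1/2"] _ filterlim_stm] by simp
      ultimately have "eventually (\<lambda>n. ereal (3 * b) < sup_dist x \<omega> (stm n / 2)) sequentially"
        by (rule eventually_compose_filterlim)
      moreover have "eventually (\<lambda>n. dist x y \<le> srad n) sequentially" using filterlim_srad by (simp add: filterlim_at_top)
      moreover have "eventually (\<lambda>n. 0 < stm n) sequentially" using filterlim_stm by (simp add: filterlim_at_top_dense)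
      ultimately have "eventually (\<lambda>n. ereal (3 * b) < sup_dist x \<omega> (stm n / 2) \<and> dist x y \<le> srad n \<and> 0 < stm n \<and>
        srad n \<le> gen_inv \<phi> (stm n / 2 / ln (ln (stm n / 2)))) sequentially"
        using eventually_gen_inv_ge by eventually_elim blast
      then obtain N where N: "\<And>n. n \<ge> N \<Longrightarrow> ereal (3 * b) < sup_dist x \<omega> (stm n / 2) \<and> dist x y \<le> srad n \<and> 0 < stm n \<and>
        srad n \<le> gen_inv \<phi> (stm n / 2 / ln (ln (stm n / 2)))"
        unfolding eventually_sequentially by blast
      obtain n where n: "n > N" "\<not> exit_time X (cball y (2 * (b * srad n))) \<omega> < ennreal (stm n)"
        using elim by (auto simp: b_def)
      have nn: "ereal (3 * b) < sup_dist x \<omega> (stm n / 2)" "dist x y \<le> srad n" "0 < stm n"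
        "srad n \<le> gen_inv \<phi> (stm n / 2 / ln (ln (stm n / 2)))"
        using N[of n] n(1) by auto
      let ?g = "gen_inv \<phi> (stm n / 2 / ln (ln (stm n / 2)))"
      have sup: "(SUP s\<in>{0<..stm n / 2}. cdist x (X s \<omega>)) \<le> ereal (3 * b * srad n)"
      proof (rule SUP_least)
        fix s assume s: "s \<in> {0<..stm n / 2}"
        then have "X s \<omega> \<in> Some ` cball y (2 * (b * srad n))"
          using n(2) nn(3) unfolding exit_time_less by auto
        then obtain z where z: "X s \<omega> = Some z" "dist y z \<le> 2 * (b * srad n)" by auto
        have "dist x z \<le> dist x y + dist y z" by (rule dist_triangle)
        also have "\<dots> \<le> 1 * srad n + 2 * (b * srad n)" using z nn by simp
        also have "\<dots> \<le> b * srad n + 2 * (b * srad n)" using b srad_pos[of n] by (intro add_right_mono mult_right_mono) auto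
        finally show "cdist x (X s \<omega>) \<le> ereal (3 * b * srad n)" using z by (simp add: cdist_def)
      qed
      have g0: "?g > 0" using nn(4) srad_pos[of n] by linarith
      have "sup_dist x \<omega> (stm n / 2) \<le> ereal (3 * b * srad n) / ereal ?g"
        using sup g0 by (intro ereal_divide_right_mono) auto
      also have "\<dots> \<le> ereal (3 * b)"
        using g0 nn(4) b by (simp add: divide_le_eq)
      finally show False using nn(1) by simp
    qed
  qed
  then show ?thesis by (rule that)
qed

end

theorem mainTheorem3:
  fixes \<mu> :: "'a::{metric_space, second_countable_topology} measure"
    and P :: "'a option \<Rightarrow> 'w measure"
    and X :: "real \<Rightarrow> 'w \<Rightarrow> 'a option"
    and \<theta> :: "real \<Rightarrow> 'w \<Rightarrow> 'w"
    and F :: "real \<Rightarrow> 'w set set"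
    and J :: "'a \<Rightarrow> 'a option measure"
    and ob :: 'a and Rinf \<upsilon> :: real and \<phi> :: "real \<Rightarrow> real"
  assumes lc: "locally_compact_space (euclidean :: 'a topology)"
    and mu_borel: "sets \<mu> = sets borel"
    and mu_radon: "\<And>K. compact K \<Longrightarrow> emeasure \<mu> K < \<infinity>"
    and mu_support: "\<And>U. open U \<Longrightarrow> U \<noteq> {} \<Longrightarrow> emeasure \<mu> U > 0"
    and markov: "borel_standard_markov P X \<theta> F"
    and levy: "levy_system P X J"
    and B: "conditions_B P X J ob Rinf \<upsilon>"
    and adm: "admissible_at_infinity P X ob Rinf \<upsilon> \<phi>"
  shows "\<exists>b1 b2::real. 0 < b1 \<and> b1 \<le> b2 \<and>
    (\<forall>x y. AE \<omega> in P (Some y).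
       Liminf at_top (\<lambda>t::real. (SUP s\<in>{0<..t}. cdist x (X s \<omega>)) / ereal (gen_inv \<phi> (t / ln (ln t))))
         \<in> {ereal b1 .. ereal b2})"
proof -
  \<comment> \<open>in \<open>conditions_B\<close> the type constraint binds only the last constant, and \<open>C5\<close> is an integer\<close>
  obtain ell C2 C3 C4 C6 C7 :: real and k5 :: int where
    B2: "\<forall>s. s > Rinf \<longrightarrow> 2 * Etau P X ob (s / ell) \<le> Etau P X ob s \<and> Etau P X ob s \<le> ennreal C2 * Etau P X ob (s / 2)"
    and B3: "\<forall>x r. r > Rinf * dd ob x powr \<upsilon> \<longrightarrow> emeasure (J x) (- (Some ` ball x r)) \<le> ennreal C3 / Etau P X x r"
    and B4: "\<forall>x r (n::nat). r > Rinf * dd ob x powr \<upsilon> \<longrightarrow> n \<ge> 1 \<longrightarrow>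
         C4 * exp (- k5 * n) \<le> measure (P (Some x)) {\<omega> \<in> space (P (Some x)).
              exit_time X (ball x r) \<omega> \<ge> of_nat n * Etau P X x r} \<and>
         measure (P (Some x)) {\<omega> \<in> space (P (Some x)).
              exit_time X (ball x r) \<omega> \<ge> of_nat n * Etau P X x r} \<le> C6 * exp (- C7 * n)"
    and pos: "ell > 1" "C2 > 0" "C3 > 0" "C4 > 0" "k5 > 0" "C6 > 0" "C7 > 0"
    using B unfolding conditions_B_def by (elim conjE exE) (rule that)
  have R: "Rinf \<ge> 1" "0 < \<upsilon>" "\<upsilon> < 1" using B by (auto simp: conditions_B_def)
  obtain C :: real where C: "C \<ge> 1" "\<forall>x r. r > Rinf * dd ob x powr \<upsilon> \<longrightarrow>
        ennreal (1 / C) * Etau P X x r \<le> ennreal (\<phi> r) \<and> ennreal (\<phi> r) \<le> ennreal C * Etau P X x r"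
    using adm unfolding admissible_at_infinity_def by blast
  have \<phi>: "mono_on {0<..} \<phi>" "\<forall>r>0. \<phi> r > 0" using adm unfolding admissible_at_infinity_def by blast+
  interpret stable_like_process P X \<theta> F J ob Rinf \<upsilon> \<phi> ell C C2 C3 C4 "real_of_int k5" C6 C7
  proof (unfold_locales, fact lc, fact markov, fact levy)
    fix x r and n :: nat assume r: "r > Rinf * dd ob x powr \<upsilon>"
    show "emeasure (J x) (- (Some ` ball x r)) \<le> ennreal C3 / Etau P X x r" using B3 r by blast
    show "ennreal (1 / C) * Etau P X x r \<le> ennreal (\<phi> r)" "ennreal (\<phi> r) \<le> ennreal C * Etau P X x r"
      using C(2) r by blast+
    assume "n \<ge> 1"
    then show "C4 * exp (- real_of_int k5 * real n) \<le> measure (P (Some x)) {\<omega> \<in> space (P (Some x)). exit_time X (ball x r) \<omega> \<ge> of_nat n * Etau P X x r}"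
      "measure (P (Some x)) {\<omega> \<in> space (P (Some x)). exit_time X (ball x r) \<omega> \<ge> of_nat n * Etau P X x r} \<le> C6 * exp (- C7 * real n)"
      using B4 r by force+
  qed (use pos R B2 C(1) \<phi> in \<open>auto\<close>)
  obtain b1 :: real where b1: "b1 > 0" "\<And>x y. AE \<omega> in P (Some y). ereal b1 \<le> Liminf at_top (sup_dist x \<omega>)"
    by (rule liminf_lower) (rule that)
  obtain b2 :: real where b2: "\<And>x y. AE \<omega> in P (Some y). Liminf at_top (sup_dist x \<omega>) \<le> ereal b2"
    by (rule liminf_upper) (rule that)
  \<comment> \<open>The maximum secures the required order of the two constants.\<close>
  have "AE \<omega> in P (Some y). Liminf at_top (sup_dist x \<omega>) \<in> {ereal b1..ereal (max b1 b2)}" for x y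
    using b1(2)[of x y] b2[of x y] by eventually_elim (simp add: order.trans[of _ "ereal b2"])
  then show ?thesis using b1(1) by (intro exI[of _ b1] exI[of _ "max b1 b2"]) simp
qed

end
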